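(* A generic quartic $K3$ surface in $\mathbb P^3$ with $15$ nodes can be realized as a hyperplane section of the Igusa quartic $I_4\subset\mathbb P^4$.
   Context: We work over $\mathbb C$. The Igusa quartic $I_4\subset\mathbb P^4$ is, up to projective equivalence, the threefold $4(x^4+y^4+z^4+w^4+t^4+h^4)=(x^2+y^2+z^2+w^2+t^2+h^2)^2$ with $h:=-x-y-z-w-t$, in $\mathbb P^4(x,y,z,w,t)$. "Generic" refers to the irreducible $4$-dimensional moduli space of quartic $K3$ surfaces with $15$ nodes. *)

theory Defs
  imports "HOL-Analysis.Analysis" "HOL-Library.Poly_Mapping"
begin

section \<open>Multivariate polynomials\<close>

type_synonym ('v, 'a) mpoly = "('v \<Rightarrow>\<^sub>0 nat) \<Rightarrow>\<^sub>0 'a"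

definition mpoly_eval :: "('v \<Rightarrow> 'a) \<Rightarrow> ('v, 'a::comm_semiring_1) mpoly \<Rightarrow> 'a" where
  "mpoly_eval x p =
     (\<Sum>m\<in>Poly_Mapping.keys p. Poly_Mapping.lookup p m *
        (\<Prod>i\<in>Poly_Mapping.keys m. x i ^ Poly_Mapping.lookup m i))"

text \<open>Formal partial derivative. The truncated subtraction of exponents is harmless: where it
  truncates, the coefficient is \<open>0\<close>.\<close>

definition mpoly_pderiv :: "'v \<Rightarrow> ('v, 'a::comm_semiring_1) mpoly \<Rightarrow> ('v, 'a) mpoly" where
  "mpoly_pderiv i p =
     (\<Sum>m\<in>Poly_Mapping.keys p.
        Poly_Mapping.single (m - Poly_Mapping.single i 1)
          (of_nat (Poly_Mapping.lookup m i) * Poly_Mapping.lookup p m))"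

definition forms :: "nat \<Rightarrow> ('v::finite, 'a::zero) mpoly set" where
  "forms d = {p. \<forall>m\<in>Poly_Mapping.keys p. (\<Sum>i\<in>UNIV. Poly_Mapping.lookup m i) = d}"

definition form_at :: "('n::finite, complex) mpoly \<Rightarrow> complex^'n \<Rightarrow> complex" where
  "form_at F v = mpoly_eval (\<lambda>i. v $ i) F"


section \<open>Quartic surfaces with 15 nodes\<close>

text \<open>A point of projective space is the line \<open>vec.span {v}\<close> through a vector \<open>v \<noteq> 0\<close>; a form
  \<open>F\<close> stands for the hypersurface \<open>F = 0\<close>.\<close>

definition singular_at :: "('n::finite, complex) mpoly \<Rightarrow> complex^'n \<Rightarrow> bool" where
  "singular_at F v \<longleftrightarrow> v \<noteq> 0 \<and> form_at F v = 0 \<and> (\<forall>i. form_at (mpoly_pderiv i F) v = 0)"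

definition hessian :: "('n::finite, complex) mpoly \<Rightarrow> complex^'n \<Rightarrow> complex^'n^'n" where
  "hessian F v = (\<chi> i j. form_at (mpoly_pderiv i (mpoly_pderiv j F)) v)"

text \<open>A node is an ordinary double point: the tangent cone there, which is the quadric given by
  the Hessian form at \<open>v\<close>, has no vertex other than \<open>v\<close>; equivalently, the Hessian form is
  nondegenerate on \<open>\<complex>\<^sup>n / \<langle>v\<rangle>\<close>, the tangent space of projective space at \<open>v\<close>.\<close>

definition node_at :: "('n::finite, complex) mpoly \<Rightarrow> complex^'n \<Rightarrow> bool" where
  "node_at F v \<longleftrightarrow> singular_at F v \<and> {w. hessian F v *v w = 0} = vec.span {v}"

definition singular_points :: "('n::finite, complex) mpoly \<Rightarrow> (complex^'n) set set" where
  "singular_points F = {vec.span {v} | v. singular_at F v}"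

text \<open>The singularities are exactly 15 points, all of them nodes. Such a surface is automatically
  irreducible (two components would meet in a curve of singular points), and it is a K3 surface
  in the sense that its minimal resolution is one, since its singularities are rational double
  points.\<close>

definition nodal15 :: "(4, complex) mpoly set" where
  "nodal15 = {F \<in> forms 4. (\<forall>v. singular_at F v \<longrightarrow> node_at F v) \<and> finite (singular_points F) \<and>
     card (singular_points F) = 15}"


section \<open>The moduli space of quartic surfaces with 15 nodes\<close>

text \<open>The affine space of forms of degree \<open>d\<close> with its Zariski topology, generated by the
  nonvanishing loci of polynomials in the coefficients.\<close>

definition zariski_forms :: "nat \<Rightarrow> ('v::finite, complex) mpoly topology" where
  "zariski_forms d = topology_generated_by
     (range (\<lambda>t :: ('v \<Rightarrow>\<^sub>0 nat, complex) mpoly.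
        {F \<in> forms d. mpoly_eval (Poly_Mapping.lookup F) t \<noteq> 0}))"

definition nodal15_space :: "(4, complex) mpoly topology" where
  "nodal15_space = subtopology (zariski_forms 4) nodal15"

definition proj_equiv :: "((4, complex) mpoly \<times> (4, complex) mpoly) set" where
  "proj_equiv = {(F, G). F \<in> nodal15 \<and> G \<in> nodal15 \<and>
     (\<exists>(A :: complex^4^4) c. invertible A \<and> c \<noteq> 0 \<and>
        (\<forall>v. form_at G v = c * form_at F (A *v v)))}"

definition moduli_class :: "(4, complex) mpoly \<Rightarrow> (4, complex) mpoly set" where
  "moduli_class F = proj_equiv `` {F}"

text \<open>The quotient topology on the set of projective equivalence classes.\<close>

definition moduli15 :: "(4, complex) mpoly set topology" where
  "moduli15 = topology (\<lambda>W. W \<subseteq> nodal15 // proj_equiv \<and>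
     openin nodal15_space {F \<in> nodal15. moduli_class F \<in> W})"

lemma topspace_zariski_forms: "topspace (zariski_forms d :: ('v::finite, complex) mpoly topology) = forms d"
proof -
  let ?D = "\<lambda>t :: ('v \<Rightarrow>\<^sub>0 nat, complex) mpoly.
    {F \<in> forms d. mpoly_eval (Poly_Mapping.lookup F) t \<noteq> 0}"
  have "mpoly_eval x (Poly_Mapping.single 0 1) = 1" for x :: "('v \<Rightarrow>\<^sub>0 nat) \<Rightarrow> complex"
    by (simp add: mpoly_eval_def)
  then have one: "?D (Poly_Mapping.single 0 1) = forms d"
    by simp
  have "?D (Poly_Mapping.single 0 1) \<subseteq> \<Union>(range ?D)"
    by (rule Union_upper, rule rangeI)
  then have "forms d \<subseteq> \<Union>(range ?D)"
    unfolding one .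
  moreover have "\<Union>(range ?D) \<subseteq> forms d"
    by (rule Union_least) (erule rangeE, simp)
  ultimately show ?thesis
    unfolding zariski_forms_def topology_generated_by_topspace by (rule equalityI[rotated])
qed

lemma topspace_nodal15_space: "topspace nodal15_space = nodal15"
  by (auto simp: nodal15_space_def topspace_zariski_forms nodal15_def)

lemma openin_moduli15:
  "openin moduli15 W \<longleftrightarrow> W \<subseteq> nodal15 // proj_equiv \<and>
     openin nodal15_space {F \<in> nodal15. moduli_class F \<in> W}"
proof -
  let ?P = "\<lambda>W. W \<subseteq> nodal15 // proj_equiv \<and>
     openin nodal15_space {F \<in> nodal15. moduli_class F \<in> W}"
  have "istopology ?P"
    unfolding istopology_def
  proof (intro conjI allI impI)
    fix S T assume "?P S" "?P T"
    moreover have "{F \<in> nodal15. moduli_class F \<in> S \<inter> T} =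
      {F \<in> nodal15. moduli_class F \<in> S} \<inter> {F \<in> nodal15. moduli_class F \<in> T}" by auto
    ultimately show "S \<inter> T \<subseteq> nodal15 // proj_equiv"
      "openin nodal15_space {F \<in> nodal15. moduli_class F \<in> S \<inter> T}" by auto
  next
    fix K assume K: "\<forall>S\<in>K. ?P S"
    then show "\<Union>K \<subseteq> nodal15 // proj_equiv" by auto
    have "{F \<in> nodal15. moduli_class F \<in> \<Union>K} =
      (\<Union>S\<in>K. {F \<in> nodal15. moduli_class F \<in> S})" by auto
    then show "openin nodal15_space {F \<in> nodal15. moduli_class F \<in> \<Union>K}"
      using K by auto
  qed
  then show ?thesis
    by (simp add: moduli15_def)
qed

lemma topspace_moduli15: "topspace moduli15 = nodal15 // proj_equiv"
proof
  show "topspace moduli15 \<subseteq> nodal15 // proj_equiv"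
    using openin_moduli15 by blast
  have "{F \<in> nodal15. moduli_class F \<in> nodal15 // proj_equiv} = topspace nodal15_space"
    by (auto simp: topspace_nodal15_space moduli_class_def quotient_def)
  then have "openin moduli15 (nodal15 // proj_equiv)"
    by (simp add: openin_moduli15)
  then show "nodal15 // proj_equiv \<subseteq> topspace moduli15"
    by (rule openin_subset)
qed

lemma quotient_map_moduli_class: "quotient_map nodal15_space moduli15 moduli_class"
  unfolding quotient_map_def topspace_nodal15_space topspace_moduli15 openin_moduli15
  by (auto simp: moduli_class_def quotient_def)

lemma equiv_proj_equiv: "equiv nodal15 proj_equiv"
proof (rule equivI)
  show "proj_equiv \<subseteq> nodal15 \<times> nodal15"
    by (auto simp: proj_equiv_def)
  show "refl_on nodal15 proj_equiv"
  proof (rule refl_onI)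
    fix F assume "F \<in> nodal15"
    moreover have "\<forall>v. form_at F v = 1 * form_at F (mat 1 *v v)" by simp
    moreover have "invertible (mat 1 :: complex^4^4)"
      unfolding invertible_def by (rule exI[of _ "mat 1"]) simp
    ultimately show "(F, F) \<in> proj_equiv"
      unfolding proj_equiv_def by (auto intro!: exI[of _ "mat 1 :: complex^4^4"] exI[of _ "1 :: complex"])
  qed
  show "sym proj_equiv"
  proof (rule symI)
    fix F G assume "(F, G) \<in> proj_equiv"
    then obtain A :: "complex^4^4" and c where FG: "F \<in> nodal15" "G \<in> nodal15"
      and A: "invertible A" "c \<noteq> 0" "\<And>v. form_at G v = c * form_at F (A *v v)"
      unfolding proj_equiv_def by blast
    obtain B where B: "A ** B = mat 1" "B ** A = mat 1"
      using A(1) unfolding invertible_def by blast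
    have "form_at F v = inverse c * form_at G (B *v v)" for v
      using A(2) by (simp add: A(3) matrix_vector_mul_assoc B)
    moreover have "invertible B"
      using B unfolding invertible_def by blast
    ultimately show "(G, F) \<in> proj_equiv"
      unfolding proj_equiv_def using FG A(2) by (auto intro!: exI[of _ B] exI[of _ "inverse c"])
  qed
  show "trans proj_equiv"
  proof (rule transI)
    fix F G H assume "(F, G) \<in> proj_equiv" "(G, H) \<in> proj_equiv"
    then obtain A B :: "complex^4^4" and c d where FH: "F \<in> nodal15" "H \<in> nodal15"
      and A: "invertible A" "c \<noteq> 0" "\<And>v. form_at G v = c * form_at F (A *v v)"
      and B: "invertible B" "d \<noteq> 0" "\<And>v. form_at H v = d * form_at G (B *v v)"
      unfolding proj_equiv_def by blast
    have "form_at H v = (d * c) * form_at F ((A ** B) *v v)" for v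
      by (simp add: A(3) B(3) matrix_vector_mul_assoc)
    moreover have "invertible (A ** B)"
      using A(1) B(1) by (rule invertible_mult)
    moreover have "d * c \<noteq> 0"
      using A(2) B(2) by simp
    ultimately show "(F, H) \<in> proj_equiv"
      unfolding proj_equiv_def using FH by (auto intro!: exI[of _ "A ** B"] exI[of _ "d * c"])
  qed
qed

text \<open>A generic point of \<open>X\<close> has property \<open>P\<close>: the points of some nonempty, dense, open set have
  it. For irreducible \<open>X\<close> density follows from the other two conditions.\<close>

definition generically :: "'a topology \<Rightarrow> ('a \<Rightarrow> bool) \<Rightarrow> bool" where
  "generically X P \<longleftrightarrow>
     (\<exists>U. openin X U \<and> U \<noteq> {} \<and> X closure_of U = topspace X \<and> (\<forall>x\<in>U. P x))"


section \<open>The Igusa quartic and its hyperplane sections\<close>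

definition igusa_quartic :: "complex^5 \<Rightarrow> complex" where
  "igusa_quartic x =
     (let h = - (\<Sum>i\<in>UNIV. x $ i)
      in 4 * ((\<Sum>i\<in>UNIV. (x $ i)^4) + h^4) - ((\<Sum>i\<in>UNIV. (x $ i)^2) + h^2)^2)"

text \<open>The surface \<open>F = 0\<close> in \<open>\<P>\<^sup>3\<close> is a hyperplane section of the hypersurface \<open>\<Phi> = 0\<close> in
  \<open>\<P>\<^sup>4\<close>: there are a hyperplane \<open>a \<cdot> x = 0\<close> and a linear isomorphism \<open>A\<close> from \<open>\<complex>\<^sup>4\<close> onto it under
  which the restriction of \<open>\<Phi>\<close> to the hyperplane becomes the equation \<open>F\<close>, up to a scalar.\<close>

definition is_hyperplane_section ::
    "(complex^5 \<Rightarrow> complex) \<Rightarrow> (4, complex) mpoly \<Rightarrow> bool" where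
  "is_hyperplane_section \<Phi> F \<longleftrightarrow>
     (\<exists>(a :: complex^5) (A :: complex^4^5) c.
        a \<noteq> 0 \<and> inj (\<lambda>v. A *v v) \<and> range (\<lambda>v. A *v v) = {x. (\<Sum>i\<in>UNIV. a $ i * x $ i) = 0} \<and>
        c \<noteq> 0 \<and> (\<forall>v. form_at F v = c * \<Phi> (A *v v)))"

end

theory Submission
  imports Defs "HOL-Computational_Algebra.Polynomial_Factorial"
    "HOL-Computational_Algebra.Fundamental_Theorem_Algebra" "HOL-Computational_Algebra.Field_as_Ring"
begin

text \<open>Every quartic surface whose singularities are exactly fifteen nodes is a hyperplane section of the
  Igusa quartic; hence the whole moduli space serves as the open dense set, and an explicit quartic with
  fifteen nodes shows that it is not empty.

  Project the surface from one of its nodes. With the node at \<open>v = 0\<close> the equation is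
  \<open>q2 t\<^sup>2 + 2 q3 t + q4\<close> with forms in three variables \<open>v\<close>, and the tangent cone \<open>q2\<close> is a nondegenerate
  quadratic form (\<open>node_coordinates\<close>). The projection to the plane is a double cover branched along the
  sextic \<open>q3\<^sup>2 - q2 q4\<close>, and the other fourteen nodes lie over double points of this sextic.

  Through the image of every node there passes a line contained in the sextic (\<open>line_through_node\<close>).
  On each line through this double point the sextic cuts out a residual binary quartic; the
  discriminant of this quartic has degree at most \<open>24\<close> in the pencil of lines. Each of the other thirteen
  nodes makes it vanish to order two, so it has at least \<open>26\<close> zeros and vanishes identically. Then the
  residual quartic has a repeated factor, unless a line of the pencil lies in the sextic;
  a repeated factor would give infinitely many double points.

  A line carries only few of the nodes, so fourteen nodes produce four lines; these are tangent to the
  conic \<open>q2 = 0\<close>, since a secant would carry at most three nodes (\<open>branch_decomposition\<close>). The remaining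
  component of degree two is, on the conic \<open>q2 = 0\<close>, a square up to a constant as well. Four tangent
  lines of a conic have a normal form given by Heron's expression, and with it
  the quartic is determined by its lines and by one linear form on the conic.

  The Igusa quartic has fifteen singular lines. Written in coordinates
  \<open>(A \<plusminus> u, B \<plusminus> v, - (A + B) \<plusminus> w)\<close> adapted to such a line, it is quadratic in \<open>(A, B)\<close> with constant
  term Heron's expression in \<open>u, v, w\<close> (\<open>igusa_adapted\<close>). A hyperplane meets the line in one point, and the
  section, projected from this point, has exactly the shape found above. Solving for the
  hyperplane gives \<open>igusa_normal_form\<close>.\<close>

section \<open>Homogeneous functions and their restrictions to lines\<close>

inductive homog :: "nat \<Rightarrow> (complex^'n \<Rightarrow> complex) \<Rightarrow> bool" where
  const: "homog 0 (\<lambda>_. c)"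
| coord: "homog 1 (\<lambda>v. v $ i)"
| add: "homog d f \<Longrightarrow> homog d g \<Longrightarrow> homog d (\<lambda>v. f v + g v)"
| mult: "homog d f \<Longrightarrow> homog e g \<Longrightarrow> homog (d + e) (\<lambda>v. f v * g v)"

lemma homog_scaleC: "homog d f \<Longrightarrow> homog d (\<lambda>v. c * f v)"
  using homog.mult[OF homog.const[of c], of d f] by simp

lemma homog_zero: "homog d (\<lambda>_. 0)"
proof -
  have "homog d (\<lambda>v. (v $ i) ^ d)" for i :: 'a
  proof (induction d)
    case 0 then show ?case using homog.const[of 1] by simp
  next
    case (Suc d) then show ?case using homog.mult[OF homog.coord[of i] Suc] by simp
  qed
  from homog_scaleC[OF this, of 0] show ?thesis by simp
qed

lemma homog_diff: "homog d f \<Longrightarrow> homog d g \<Longrightarrow> homog d (\<lambda>v. f v - g v)"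
  using homog.add[of d f "\<lambda>v. (-1) * g v"] homog_scaleC[of d g "-1"] by simp

lemma homog_sum: "(\<And>i. i \<in> S \<Longrightarrow> homog d (f i)) \<Longrightarrow> homog d (\<lambda>v. \<Sum>i\<in>S. f i v)"
  by (induction S rule: infinite_finite_induct) (auto intro: homog_zero homog.add)

lemma homog_power: "homog d f \<Longrightarrow> homog (k * d) (\<lambda>v. f v ^ k)"
proof (induction k)
  case 0 then show ?case using homog.const[of 1] by simp
next
  case (Suc k) then show ?case using homog.mult[of d f "k * d"] by simp
qed

lemma homog_prod:
  "finite S \<Longrightarrow> (\<And>i. i \<in> S \<Longrightarrow> homog (d i) (f i)) \<Longrightarrow> homog (\<Sum>i\<in>S. d i) (\<lambda>v. \<Prod>i\<in>S. f i v)"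
proof (induction S rule: finite_induct)
  case empty then show ?case using homog.const[of 1] by simp
next
  case (insert i S) then show ?case using homog.mult[of "d i" "f i"] by simp
qed

lemma homog_linear: "homog 1 (\<lambda>v. \<Sum>i\<in>UNIV. c $ i * v $ i)"
  by (intro homog_sum homog_scaleC homog.coord)

lemma homog_matrix:
  assumes "homog d f" shows "homog d (\<lambda>v. f (A *v v))"
  using assms
proof induction
  case (coord i)
  have "(\<lambda>v. (A *v v) $ i) = (\<lambda>v. \<Sum>j\<in>UNIV. (A $ i) $ j * v $ j)"
    by (simp add: matrix_vector_mult_def fun_eq_iff)
  then show ?case using homog_linear[of "A $ i"] by simp
qed (auto intro: homog.intros)

lemma homog_smult: "homog d f \<Longrightarrow> f (c *s v) = c ^ d * f v"
  by (induction rule: homog.induct) (auto simp: algebra_simps power_add)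

lemma homog_one_linear:
  assumes "homog 1 f" shows "\<exists>c. \<forall>v. f v = (\<Sum>i\<in>UNIV. c $ i * v $ i)"
proof -
  have "(d = 0 \<longrightarrow> (\<exists>k. f = (\<lambda>_. k))) \<and> (d = 1 \<longrightarrow> (\<exists>c. \<forall>v. f v = (\<Sum>i\<in>UNIV. c $ i * v $ i)))"
    if "homog d f" for d and f :: "complex^'a \<Rightarrow> complex"
    using that
  proof induction
    case (coord i)
    have "\<forall>v::complex^'a. v $ i = (\<Sum>j\<in>UNIV. axis i 1 $ j * v $ j)"
      by (simp add: axis_def if_distrib[of "\<lambda>x. x * _"] cong: if_cong)
    then show ?case by auto
  next
    case (add d f g)
    show ?case
    proof (intro conjI impI)
      assume "d = 0" then show "\<exists>k. (\<lambda>v. f v + g v) = (\<lambda>_. k)" using add by auto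
    next
      assume "d = 1"
      then obtain c c' where "\<forall>v. f v = (\<Sum>i\<in>UNIV. c $ i * v $ i)" "\<forall>v. g v = (\<Sum>i\<in>UNIV. c' $ i * v $ i)"
        using add by auto
      then show "\<exists>c. \<forall>v. f v + g v = (\<Sum>i\<in>UNIV. c $ i * v $ i)"
        by (intro exI[of _ "c + c'"]) (simp add: algebra_simps sum.distrib)
    qed
  next
    case (mult d f e g)
    show ?case
    proof (intro conjI impI)
      assume "d + e = 0" then show "\<exists>k. (\<lambda>v. f v * g v) = (\<lambda>_. k)" using mult by auto
    next
      assume "d + e = 1"
      then consider "d = 0" "e = 1" | "d = 1" "e = 0" by linarith
      then show "\<exists>c. \<forall>v. f v * g v = (\<Sum>i\<in>UNIV. c $ i * v $ i)"
      proof cases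
        case 1
        then obtain k c where "f = (\<lambda>_. k)" "\<forall>v. g v = (\<Sum>i\<in>UNIV. c $ i * v $ i)" using mult by auto
        then show ?thesis by (intro exI[of _ "k *s c"]) (simp add: sum_distrib_left algebra_simps)
      next
        case 2
        then obtain k c where "g = (\<lambda>_. k)" "\<forall>v. f v = (\<Sum>i\<in>UNIV. c $ i * v $ i)" using mult by auto
        then show ?thesis by (intro exI[of _ "k *s c"]) (simp add: sum_distrib_right sum_distrib_left algebra_simps)
      qed
    qed
  qed auto
  then show ?thesis using assms by auto
qed

lemma homog_zero_const: "homog 0 f \<Longrightarrow> \<exists>k. f = (\<lambda>_. k)"
  by (induction "0::nat" f rule: homog.induct) auto

text \<open>The restriction of a form to a line as a polynomial in the parameter. Its lowest
  coefficients are the Taylor coefficients at the point \<open>b\<close> in the direction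
  \<open>w\<close>, which replace partial derivatives below.\<close>

definition along :: "(complex^'n \<Rightarrow> complex) \<Rightarrow> complex^'n \<Rightarrow> complex^'n \<Rightarrow> complex poly" where
  "along f b w = (THE p. \<forall>s. poly p s = f (b + s *s w))"

lemma alongI: "(\<And>s. poly p s = f (b + s *s w)) \<Longrightarrow> along f b w = p"
  unfolding along_def by (rule the_equality) (auto simp: poly_eq_poly_eq_iff[symmetric] fun_eq_iff)

lemma poly_eq_sum_le: "degree p \<le> n \<Longrightarrow> poly p x = (\<Sum>i\<le>n. coeff p i * x ^ i)" for p :: "'a::comm_semiring_1 poly"
  using poly_as_sum_of_monoms'[of p n] by (metis (no_types, lifting) poly_monom poly_sum sum.cong)

lemma along_ex: "homog d f \<Longrightarrow> \<exists>p. degree p \<le> d \<and> (\<forall>s. poly p s = f (b + s *s w))"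
proof (induction rule: homog.induct)
  case (const c) then show ?case by (intro exI[of _ "[:c:]"]) auto
next
  case (coord i) then show ?case by (intro exI[of _ "[:b $ i, w $ i:]"]) (auto simp: algebra_simps)
next
  case (add d f g)
  then obtain p q where "degree p \<le> d" "\<forall>s. poly p s = f (b + s *s w)"
     "degree q \<le> d" "\<forall>s. poly q s = g (b + s *s w)" by auto
  then show ?case by (intro exI[of _ "p + q"]) (auto intro: degree_add_le)
next
  case (mult d f e g)
  then obtain p q where "degree p \<le> d" "\<forall>s. poly p s = f (b + s *s w)"
     "degree q \<le> e" "\<forall>s. poly q s = g (b + s *s w)" by auto
  then show ?case
    by (intro exI[of _ "p * q"]) (auto intro: order.trans[OF degree_mult_le])
qed

lemma poly_along: "homog d f \<Longrightarrow> poly (along f b w) s = f (b + s *s w)"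
  using along_ex[of d f b w] alongI by metis

lemma degree_along: "homog d f \<Longrightarrow> degree (along f b w) \<le> d"
  using along_ex[of d f b w] alongI by metis

lemma along_add: "homog d f \<Longrightarrow> homog e g \<Longrightarrow> along (\<lambda>v. f v + g v) b w = along f b w + along g b w"
  by (rule alongI) (simp add: poly_along)

lemma along_diff: "homog d f \<Longrightarrow> homog e g \<Longrightarrow> along (\<lambda>v. f v - g v) b w = along f b w - along g b w"
  by (rule alongI) (simp add: poly_along)

lemma along_mult: "homog d f \<Longrightarrow> homog e g \<Longrightarrow> along (\<lambda>v. f v * g v) b w = along f b w * along g b w"
  by (rule alongI) (simp add: poly_along)

lemma along_power: "homog d f \<Longrightarrow> along (\<lambda>v. f v ^ k) b w = along f b w ^ k"
  by (rule alongI) (simp add: poly_along)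

lemma along_const: "along (\<lambda>_. c) b w = [:c:]"
  by (rule alongI) simp

lemma along_coord: "along (\<lambda>v. v $ i) b w = [:b $ i, w $ i:]"
  by (rule alongI) (simp add: algebra_simps)

lemma coeff_along_0: "homog d f \<Longrightarrow> coeff (along f b w) 0 = f b"
  using poly_along[of d f b w 0] by (simp add: poly_0_coeff_0)

text \<open>Reversing the roles of the two points reverses the coefficients.\<close>

lemma along_swap:
  assumes "homog d f" "i \<le> d"
  shows "coeff (along f w b) i = coeff (along f b w) (d - i)"
proof -
  have eq: "(\<Sum>i\<le>d. coeff (along f w b) i * s ^ i) = (\<Sum>i\<le>d. coeff (along f b w) (d - i) * s ^ i)" if "s \<noteq> 0" for s
  proof -
    have "(\<Sum>i\<le>d. coeff (along f w b) i * s ^ i) = poly (along f w b) s"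
      using degree_along[OF assms(1), of w b] by (simp add: poly_eq_sum_le)
    also have "\<dots> = f (s *s (b + inverse s *s w))"
      using that by (simp add: poly_along[OF assms(1)] vector_add_ldistrib vector_smult_assoc add.commute)
    also have "\<dots> = s ^ d * poly (along f b w) (inverse s)"
      by (simp only: homog_smult[OF assms(1)] poly_along[OF assms(1)])
    also have "\<dots> = s ^ d * (\<Sum>i\<le>d. coeff (along f b w) i * inverse s ^ i)"
      using degree_along[OF assms(1), of b w] by (simp add: poly_eq_sum_le)
    also have "\<dots> = (\<Sum>i\<le>d. coeff (along f b w) i * s ^ (d - i))"
      unfolding sum_distrib_left using that
      by (intro sum.cong) (auto simp: power_diff field_simps)
    also have "\<dots> = (\<Sum>i\<le>d. coeff (along f b w) (d - i) * s ^ i)"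
      by (rule sum.reindex_bij_witness[of _ "\<lambda>i. d - i" "\<lambda>i. d - i"]) auto
    finally show ?thesis .
  qed
  have "(\<Sum>i\<le>d. monom (coeff (along f w b) i) i) = (\<Sum>i\<le>d. monom (coeff (along f b w) (d - i)) i)" (is "?p = ?q")
  proof (rule ccontr)
    assume "?p \<noteq> ?q"
    then have "finite {s. poly (?p - ?q) s = 0}" by (intro poly_roots_finite) simp
    moreover have "UNIV - {0} \<subseteq> {s. poly (?p - ?q) s = 0}"
      using eq by (auto simp: poly_sum poly_monom)
    moreover have "infinite (UNIV - {0::complex})" by (simp add: infinite_UNIV_char_0)
    ultimately show False using finite_subset by blast
  qed
  then have "coeff ?p i = coeff ?q i" by simp
  then show ?thesis using assms(2) by (simp add: coeff_sum)
qed

abbreviation D1 :: "(complex^'n \<Rightarrow> complex) \<Rightarrow> complex^'n \<Rightarrow> complex^'n \<Rightarrow> complex" where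
  "D1 f b w \<equiv> coeff (along f b w) (Suc 0)"

lemma D1_mult: "homog d f \<Longrightarrow> homog e g \<Longrightarrow> D1 (\<lambda>v. f v * g v) b w = f b * D1 g b w + D1 f b w * g b"
  by (simp add: along_mult coeff_mult coeff_along_0)

lemma D1_linear:
  assumes "homog d f"
  shows "D1 f b (c *s w + c' *s w') = c * D1 f b w + c' * D1 f b w'"
  using assms
proof induction
  case (const c) then show ?case by (simp add: along_const)
next
  case (coord i) then show ?case by (simp add: along_coord)
next
  case (add d f g) then show ?case by (simp add: along_add[OF add.hyps] algebra_simps)
next
  case (mult d f e g) then show ?case by (simp add: D1_mult[OF mult.hyps, simplified] algebra_simps)
qed

lemma D1_self: "homog d f \<Longrightarrow> D1 f b b = of_nat d * f b"
proof (induction rule: homog.induct)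
  case (const c) then show ?case by (simp add: along_const)
next
  case (coord i) then show ?case by (simp add: along_coord)
next
  case (add d f g) then show ?case by (simp add: along_add[OF add.hyps] algebra_simps)
next
  case (mult d f e g) then show ?case by (simp add: D1_mult[OF mult.hyps, simplified] algebra_simps)
qed

text \<open>An affine chart: on the plane \<open>h + x e + y b\<close> a form is a polynomial in \<open>x\<close> and \<open>y\<close>. Substituting a
  polynomial for \<open>y\<close> covers the restrictions to all graphs \<open>y = p x\<close> at the same time.\<close>

lemma homog_bivariate:
  assumes "homog d f"
  shows "\<exists>P :: complex poly poly. (\<forall>p x. poly (poly P p) x = f (x *s e + poly p x *s b + h)) \<and>
           (\<forall>i. coeff P i \<noteq> 0 \<longrightarrow> degree (coeff P i) + i \<le> d)"
  using assms
proof induction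
  case (const c) then show ?case
    by (intro exI[of _ "[:[:c:]:]"]) (auto simp: coeff_pCons split: nat.splits)
next
  case (coord i) then show ?case
    by (intro exI[of _ "[:[:h $ i, e $ i:], [:b $ i:]:]"])
       (auto simp: coeff_pCons algebra_simps split: nat.splits)
next
  case (add d f g)
  then obtain P Q where P: "\<forall>p x. poly (poly P p) x = f (x *s e + poly p x *s b + h)"
      "\<forall>i. coeff P i \<noteq> 0 \<longrightarrow> degree (coeff P i) + i \<le> d" 
    and Q: "\<forall>p x. poly (poly Q p) x = g (x *s e + poly p x *s b + h)"
      "\<forall>i. coeff Q i \<noteq> 0 \<longrightarrow> degree (coeff Q i) + i \<le> d" by auto
  have "degree (coeff (P + Q) i) + i \<le> d" if "coeff (P + Q) i \<noteq> 0" for i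
  proof -
    have "degree (coeff P i + coeff Q i) \<le> max (degree (coeff P i)) (degree (coeff Q i))" by (rule degree_add_le_max)
    moreover have "coeff P i \<noteq> 0 \<or> coeff Q i \<noteq> 0" using that by auto
    ultimately show ?thesis using P(2)[rule_format, of i] Q(2)[rule_format, of i]
      by (cases "coeff P i = 0"; cases "coeff Q i = 0") auto
  qed
  with P(1) Q(1) show ?case by (intro exI[of _ "P + Q"]) auto
next
  case (mult d f e' g)
  then obtain P Q where P: "\<forall>p x. poly (poly P p) x = f (x *s e + poly p x *s b + h)"
      "\<And>i. coeff P i \<noteq> 0 \<Longrightarrow> degree (coeff P i) + i \<le> d" 
    and Q: "\<forall>p x. poly (poly Q p) x = g (x *s e + poly p x *s b + h)"
      "\<And>i. coeff Q i \<noteq> 0 \<Longrightarrow> degree (coeff Q i) + i \<le> e'" by blast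
  have "degree (coeff (P * Q) i) + i \<le> d + e'" if nz: "coeff (P * Q) i \<noteq> 0" for i
  proof -
    have "\<exists>j\<le>i. coeff P j * coeff Q (i - j) \<noteq> 0"
      using nz unfolding coeff_mult by (meson atMost_iff sum.neutral)
    then obtain j where "j \<le> i" "coeff P j \<noteq> 0" "coeff Q (i - j) \<noteq> 0" by auto
    then have i: "i \<le> d + e'" using P(2)[of j] Q(2)[of "i - j"] by linarith
    have "degree (coeff P j * coeff Q (i - j)) \<le> d + e' - i" if "j \<le> i" for j
    proof (cases "coeff P j = 0 \<or> coeff Q (i - j) = 0")
      case False
      then show ?thesis using P(2)[of j] Q(2)[of "i - j"] degree_mult_le[of "coeff P j" "coeff Q (i - j)"] that
        by linarith
    qed auto
    then have "degree (coeff (P * Q) i) \<le> d + e' - i"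
      unfolding coeff_mult by (intro degree_sum_le) auto
    then show ?thesis using i by simp
  qed
  with P(1) Q(1) show ?case by (intro exI[of _ "P * Q"]) auto
qed

text \<open>The expansion in powers of the coordinate along \<open>p\<close>: its coefficients are
  forms in the remaining coordinates. For a double point \<open>p\<close> of a quartic only three of
  them survive.\<close>

lemma homog_pencil_expand:
  assumes "homog d f"
  shows "\<exists>g. (\<forall>k\<le>d. homog (d - k) (g k)) \<and> (\<forall>v t. f (A *v v + t *s p) = (\<Sum>k\<le>d. g k v * t ^ k))"
  using assms
proof induction
  case (const c) then show ?case by (intro exI[of _ "\<lambda>_ _. c"]) (auto intro: homog.const)
next
  case (coord i)
  show ?case
    by (rule exI[of _ "\<lambda>k v. if k = 0 then (A *v v) $ i else p $ i"])
       (auto simp: le_Suc_eq algebra_simps intro: homog.const homog_matrix homog.coord[simplified])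
next
  case (add d f g)
  then obtain f' g' where "(\<forall>k\<le>d. homog (d - k) (f' k)) \<and> (\<forall>v t. f (A *v v + t *s p) = (\<Sum>k\<le>d. f' k v * t ^ k))"
    "(\<forall>k\<le>d. homog (d - k) (g' k)) \<and> (\<forall>v t. g (A *v v + t *s p) = (\<Sum>k\<le>d. g' k v * t ^ k))" by auto
  then show ?case
    by (intro exI[of _ "\<lambda>k v. f' k v + g' k v"]) (auto simp: algebra_simps sum.distrib intro: homog.add)
next
  case (mult d f e g)
  then obtain f' g' where f': "\<forall>k\<le>d. homog (d - k) (f' k)" "\<forall>v t. f (A *v v + t *s p) = (\<Sum>k\<le>d. f' k v * t ^ k)"
    and g': "\<forall>k\<le>e. homog (e - k) (g' k)" "\<forall>v t. g (A *v v + t *s p) = (\<Sum>k\<le>e. g' k v * t ^ k)" by auto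
  let ?h = "\<lambda>k v. \<Sum>ij\<in>{(i,j). i \<le> d \<and> j \<le> e \<and> i + j = k}. f' (fst ij) v * g' (snd ij) v"
  have "homog (d + e - k) (?h k)" if "k \<le> d + e" for k
  proof (rule homog_sum)
    fix ij assume "ij \<in> {(i,j). i \<le> d \<and> j \<le> e \<and> i + j = k}"
    then have "homog ((d - fst ij) + (e - snd ij)) (\<lambda>v. f' (fst ij) v * g' (snd ij) v)" "(d - fst ij) + (e - snd ij) = d + e - k"
      using f' g' by (auto intro!: homog.mult)
    then show "homog (d + e - k) (\<lambda>v. f' (fst ij) v * g' (snd ij) v)" by simp
  qed
  moreover have "f (A *v v + t *s p) * g (A *v v + t *s p) = (\<Sum>k\<le>d+e. ?h k v * t ^ k)" for v t
  proof -
    have "f (A *v v + t *s p) * g (A *v v + t *s p) = (\<Sum>ij\<in>{..d}\<times>{..e}. f' (fst ij) v * g' (snd ij) v * t ^ (fst ij + snd ij))"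
      by (simp add: f' g' sum_product sum.cartesian_product power_add algebra_simps case_prod_unfold)
    also have "\<dots> = (\<Sum>k\<le>d+e. \<Sum>ij\<in>{ij\<in>{..d}\<times>{..e}. fst ij + snd ij = k}. f' (fst ij) v * g' (snd ij) v * t ^ (fst ij + snd ij))"
      by (rule sum.group[symmetric]) auto
    also have "\<dots> = (\<Sum>k\<le>d+e. ?h k v * t ^ k)"
      unfolding sum_distrib_right
      by (intro sum.cong) auto
    finally show ?thesis .
  qed
  ultimately show ?case by (intro exI[of _ ?h]) blast
qed

text \<open>The factor theorem for a hyperplane: sliding a point along \<open>e\<close> by a multiple of the linear form \<open>l\<close>
  changes the value of a form by a multiple of \<open>l\<close>; with the right \<open>e\<close> the new point lies on \<open>l = 0\<close>.\<close>

lemma homog_shift_diff: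
  assumes "homog d f"
  shows "\<exists>g. homog (d - 1) g \<and> (\<forall>v. f v - f (v - (\<Sum>i\<in>UNIV. l $ i * v $ i) *s e) = (\<Sum>i\<in>UNIV. l $ i * v $ i) * g v)"
  using assms
proof induction
  case (const c) then show ?case by (intro exI[of _ "\<lambda>_. 0"]) (auto intro: homog.const)
next
  case (coord i) then show ?case by (intro exI[of _ "\<lambda>_. e $ i"]) (auto intro: homog.const)
next
  case (add d f g)
  then obtain f' g' where "homog (d - 1) f' \<and> (\<forall>v. f v - f (v - (\<Sum>i\<in>UNIV. l $ i * v $ i) *s e) = (\<Sum>i\<in>UNIV. l $ i * v $ i) * f' v)"
    "homog (d - 1) g' \<and> (\<forall>v. g v - g (v - (\<Sum>i\<in>UNIV. l $ i * v $ i) *s e) = (\<Sum>i\<in>UNIV. l $ i * v $ i) * g' v)" by auto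
  moreover have "f v + g v - (x + y) = (f v - x) + (g v - y)" for v x y by simp
  ultimately show ?case
    by (intro exI[of _ "\<lambda>v. f' v + g' v"] conjI allI homog.add) (simp_all only: distrib_left)
next
  case (mult d f d' g)
  let ?l = "\<lambda>v. \<Sum>i\<in>UNIV. l $ i * v $ i"
  define A :: "complex^'a^'a" where "A = mat 1 - (\<chi> i j. e $ i * l $ j)"
  have A: "A *v v = v - ?l v *s e" for v
  proof -
    have "(A *v v) $ k = (v - ?l v *s e) $ k" for k
    proof -
      have "(A *v v) $ k = (mat 1 *v v) $ k - (\<Sum>j\<in>UNIV. e $ k * l $ j * v $ j)"
        unfolding A_def matrix_vector_mult_diff_rdistrib by (simp add: matrix_vector_mult_def)
      then show ?thesis by (simp add: sum_distrib_left mult.assoc)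
         (simp add: mult.commute sum_distrib_left mult.left_commute)
    qed
    then show ?thesis by (simp add: vec_eq_iff)
  qed
  obtain f' g' where f': "homog (d - 1) f'" "\<forall>v. f v - f (v - ?l v *s e) = ?l v * f' v"
    and g': "homog (d' - 1) g'" "\<forall>v. g v - g (v - ?l v *s e) = ?l v * g' v" using mult by auto
  have hs: "homog d' (\<lambda>v. g (v - ?l v *s e))" using homog_matrix[OF mult.hyps(2), of A] by (simp add: A)
  have eq: "f v * g v - f (v - ?l v *s e) * g (v - ?l v *s e) = ?l v * (f v * g' v + f' v * g (v - ?l v *s e))" for v
  proof -
    have "f v * g v - f (v - ?l v *s e) * g (v - ?l v *s e) = f v * (g v - g (v - ?l v *s e)) + (f v - f (v - ?l v *s e)) * g (v - ?l v *s e)"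
      by (simp add: algebra_simps)
    also have "\<dots> = f v * (?l v * g' v) + (?l v * f' v) * g (v - ?l v *s e)"
      by (simp only: f'(2)[rule_format] g'(2)[rule_format])
    finally show ?thesis by (simp only: ac_simps distrib_left)
  qed
  consider "d = 0" | "d' = 0" | "d > 0" "d' > 0" by linarith
  then show ?case
  proof cases
    case 1
    then obtain k where k: "f = (\<lambda>_. k)" using mult.hyps homog_zero_const by blast
    have "k * g v - k * g (v - ?l v *s e) = ?l v * (k * g' v)" for v
      unfolding right_diff_distrib[symmetric] g'(2)[rule_format] by (simp only: ac_simps)
    then show ?thesis using 1 homog_scaleC[OF g'(1), of k]
      by (intro exI[of _ "\<lambda>v. k * g' v"]) (simp add: k)
  next
    case 2
    then obtain k where k: "g = (\<lambda>_. k)" using mult.hyps homog_zero_const by blast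
    have "f v * k - f (v - ?l v *s e) * k = ?l v * (k * f' v)" for v
      unfolding left_diff_distrib[symmetric] f'(2)[rule_format] by (simp only: ac_simps)
    then show ?thesis using 2 homog_scaleC[OF f'(1), of k]
      by (intro exI[of _ "\<lambda>v. k * f' v"]) (simp add: k)
  next
    case 3
    have "homog (d + d' - 1) (\<lambda>v. f v * g' v)" using homog.mult[OF mult.hyps(1) g'(1)] 3 by simp
    moreover have "homog (d + d' - 1) (\<lambda>v. f' v * g (v - ?l v *s e))" using homog.mult[OF f'(1) hs] 3 by simp
    ultimately have "homog (d + d' - 1) (\<lambda>v. f v * g' v + f' v * g (v - ?l v *s e))" by (rule homog.add)
    then show ?thesis using eq by blast
  qed
qed

lemma homog_factor:
  assumes "homog d f" "l \<noteq> 0" "\<And>v. (\<Sum>i\<in>UNIV. l $ i * v $ i) = 0 \<Longrightarrow> f v = 0"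
  shows "\<exists>g. homog (d - 1) g \<and> (\<forall>v. f v = (\<Sum>i\<in>UNIV. l $ i * v $ i) * g v)"
proof -
  let ?l = "\<lambda>v. \<Sum>i\<in>UNIV. l $ i * v $ i"
  obtain j where j: "l $ j \<noteq> 0" using assms(2) by (auto simp: vec_eq_iff)
  define e where "e = axis j (inverse (l $ j))"
  have e: "?l e = 1" using j by (simp add: e_def axis_def if_distrib[of "\<lambda>x. _ * x"] cong: if_cong)
  obtain g where g: "homog (d - 1) g" "\<forall>v. f v - f (v - ?l v *s e) = ?l v * g v"
    using homog_shift_diff[OF assms(1), of l e] by auto
  have "?l (v - c *s e) = ?l v - c * ?l e" for v c
    by (simp add: algebra_simps sum_subtractf sum_distrib_left)
  then have "?l (v - ?l v *s e) = 0" for v using e by simp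
  then have "f v = ?l v * g v" for v using g(2) assms(3)[of "v - ?l v *s e"] by (metis diff_zero)
  with g(1) show ?thesis by blast
qed

section \<open>Formal partial derivatives and Taylor coefficients\<close>

lemma mpoly_eval_superset:
  "finite S \<Longrightarrow> Poly_Mapping.keys p \<subseteq> S \<Longrightarrow>
     mpoly_eval x p = (\<Sum>m\<in>S. Poly_Mapping.lookup p m * (\<Prod>i\<in>Poly_Mapping.keys m. x i ^ Poly_Mapping.lookup m i))"
  unfolding mpoly_eval_def by (rule sum.mono_neutral_left) (auto simp: in_keys_iff)

lemma mpoly_eval_add: "mpoly_eval x (p + q) = mpoly_eval x p + mpoly_eval x q"
proof -
  let ?S = "Poly_Mapping.keys p \<union> Poly_Mapping.keys q"
  have "mpoly_eval x (p + q) = (\<Sum>m\<in>?S. Poly_Mapping.lookup (p + q) m * (\<Prod>i\<in>Poly_Mapping.keys m. x i ^ Poly_Mapping.lookup m i))"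
    by (rule mpoly_eval_superset) (use Poly_Mapping.keys_add[of p q] in auto)
  also have "\<dots> = mpoly_eval x p + mpoly_eval x q"
    using mpoly_eval_superset[of ?S p x] mpoly_eval_superset[of ?S q x]
    by (simp add: lookup_add distrib_right sum.distrib)
  finally show ?thesis .
qed

lemma mpoly_eval_zero: "mpoly_eval x 0 = 0"
  by (simp add: mpoly_eval_def)

lemma mpoly_eval_sum: "mpoly_eval x (\<Sum>i\<in>S. p i) = (\<Sum>i\<in>S. mpoly_eval x (p i))"
  by (induction S rule: infinite_finite_induct) (auto simp: mpoly_eval_add mpoly_eval_zero)

lemma mpoly_eval_single:
  "mpoly_eval x (Poly_Mapping.single m c) = c * (\<Prod>i\<in>UNIV. x i ^ Poly_Mapping.lookup m i)" 
  for m :: "'v::finite \<Rightarrow>\<^sub>0 nat"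
proof -
  have "(\<Prod>i\<in>Poly_Mapping.keys m. x i ^ Poly_Mapping.lookup m i) = (\<Prod>i\<in>UNIV. x i ^ Poly_Mapping.lookup m i)"
    by (rule prod.mono_neutral_left) (auto simp: in_keys_iff)
  then show ?thesis by (cases "c = 0") (auto simp: mpoly_eval_def)
qed

lemma form_at_keys:
  "form_at p v = (\<Sum>m\<in>Poly_Mapping.keys p. Poly_Mapping.lookup p m * (\<Prod>i\<in>UNIV. v $ i ^ Poly_Mapping.lookup m i))"
proof -
  have "(\<Prod>i\<in>Poly_Mapping.keys m. v $ i ^ Poly_Mapping.lookup m i) = (\<Prod>i\<in>UNIV. v $ i ^ Poly_Mapping.lookup m i)" for m
    by (rule prod.mono_neutral_left) (auto simp: in_keys_iff)
  then show ?thesis by (simp add: form_at_def mpoly_eval_def)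
qed

lemma homog_form_at:
  assumes "F \<in> forms d" shows "homog d (form_at F)"
proof -
  have "homog d (\<lambda>v. Poly_Mapping.lookup F m * (\<Prod>i\<in>UNIV. v $ i ^ Poly_Mapping.lookup m i))"
    if "m \<in> Poly_Mapping.keys F" for m
  proof -
    have "homog (\<Sum>i\<in>UNIV. Poly_Mapping.lookup m i) (\<lambda>v::complex^'a. \<Prod>i\<in>UNIV. v $ i ^ Poly_Mapping.lookup m i)"
      by (rule homog_prod) (auto intro: homog_power[OF homog.coord, simplified])
    moreover have "(\<Sum>i\<in>UNIV. Poly_Mapping.lookup m i) = d" using assms that by (auto simp: forms_def)
    ultimately show ?thesis by (auto intro: homog_scaleC)
  qed
  then have "homog d (\<lambda>v. \<Sum>m\<in>Poly_Mapping.keys F. Poly_Mapping.lookup F m * (\<Prod>i\<in>UNIV. v $ i ^ Poly_Mapping.lookup m i))"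
    by (rule homog_sum)
  then show ?thesis by (simp add: form_at_keys[abs_def])
qed

lemma form_at_pderiv:
  "form_at (mpoly_pderiv i p) v = (\<Sum>m\<in>Poly_Mapping.keys p. of_nat (Poly_Mapping.lookup m i) * Poly_Mapping.lookup p m *
      (\<Prod>j\<in>UNIV. v $ j ^ (Poly_Mapping.lookup m j - (if i = j then 1 else 0))))"
  unfolding form_at_def mpoly_pderiv_def mpoly_eval_sum
  by (intro sum.cong refl) (auto simp: mpoly_eval_single lookup_minus lookup_single when_def intro!: prod.cong)

lemma along_form_at:
  "along (form_at p) v w = (\<Sum>m\<in>Poly_Mapping.keys p. smult (Poly_Mapping.lookup p m) (\<Prod>i\<in>UNIV. [:v $ i, w $ i:] ^ Poly_Mapping.lookup m i))"
  by (rule alongI) (simp add: form_at_keys poly_sum poly_prod algebra_simps)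

lemma pderiv_prod_powers:
  fixes f :: "'n::finite \<Rightarrow> complex poly"
  shows "pderiv (\<Prod>i\<in>UNIV. f i ^ k i) = (\<Sum>i\<in>UNIV. smult (of_nat (k i)) (pderiv (f i) * (\<Prod>j\<in>UNIV. f j ^ (k j - (if i = j then 1 else 0)))))"
proof -
  have "(\<Prod>j\<in>UNIV - {i}. f j ^ k j) * pderiv (f i ^ k i) = smult (of_nat (k i)) (pderiv (f i) * (\<Prod>j\<in>UNIV. f j ^ (k j - (if i = j then 1 else 0))))" for i
  proof -
    have "(\<Prod>j\<in>UNIV. f j ^ (k j - (if i = j then 1 else 0))) = f i ^ (k i - 1) * (\<Prod>j\<in>UNIV - {i}. f j ^ (k j - (if i = j then 1 else 0)))"
      by (subst prod.remove[of UNIV i]) auto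
    also have "(\<Prod>j\<in>UNIV - {i}. f j ^ (k j - (if i = j then 1 else 0))) = (\<Prod>j\<in>UNIV - {i}. f j ^ k j)"
      by (rule prod.cong) auto
    finally show ?thesis by (cases "k i") (simp_all add: pderiv_power_Suc mult_ac del: power_Suc)
  qed
  then show ?thesis by (simp add: pderiv_prod)
qed

lemma pderiv_sum: "pderiv (\<Sum>i\<in>S. f i) = (\<Sum>i\<in>S. pderiv (f i :: complex poly))"
  by (induction S rule: infinite_finite_induct) (auto simp: pderiv_add)

lemma smult_sum2: "smult c (\<Sum>i\<in>S. f i) = (\<Sum>i\<in>S. smult c (f i))"
  by (induction S rule: infinite_finite_induct) (auto simp: smult_add_right)

lemma pderiv_along_form_at:
  "pderiv (along (form_at p) v w) = (\<Sum>i\<in>UNIV. smult (w $ i) (along (form_at (mpoly_pderiv i p)) v w))"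
proof -
  have *: "along (form_at (mpoly_pderiv i p)) v w = (\<Sum>m\<in>Poly_Mapping.keys p. smult (of_nat (Poly_Mapping.lookup m i) * Poly_Mapping.lookup p m)
      (\<Prod>j\<in>UNIV. [:v $ j, w $ j:] ^ (Poly_Mapping.lookup m j - (if i = j then 1 else 0))))" for i
    by (rule alongI) (simp add: form_at_pderiv poly_sum poly_prod algebra_simps)
  have "pderiv (along (form_at p) v w) = (\<Sum>m\<in>Poly_Mapping.keys p. \<Sum>i\<in>UNIV. smult (w $ i) (smult (of_nat (Poly_Mapping.lookup m i) * Poly_Mapping.lookup p m)
      (\<Prod>j\<in>UNIV. [:v $ j, w $ j:] ^ (Poly_Mapping.lookup m j - (if i = j then 1 else 0)))))"
    by (simp add: along_form_at pderiv_sum pderiv_smult pderiv_prod_powers pderiv_pCons smult_sum2 mult_ac)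
  then show ?thesis
    by (simp add: * smult_sum2) (rule sum.swap)
qed

lemma D1_form_at: "D1 (form_at p) v w = (\<Sum>i\<in>UNIV. w $ i * form_at (mpoly_pderiv i p) v)"
proof -
  have "D1 (form_at p) v w = coeff (pderiv (along (form_at p) v w)) 0" by (simp add: coeff_pderiv)
  also have "\<dots> = (\<Sum>i\<in>UNIV. w $ i * coeff (along (form_at (mpoly_pderiv i p)) v w) 0)"
    by (simp add: pderiv_along_form_at coeff_sum)
  finally have *: "D1 (form_at p) v w = (\<Sum>i\<in>UNIV. w $ i * coeff (along (form_at (mpoly_pderiv i p)) v w) 0)" .
  have "coeff (along (form_at q) v w) 0 = form_at q v" for q
    by (simp add: poly_0_coeff_0[symmetric] along_form_at poly_sum poly_prod form_at_keys)
  with * show ?thesis by simp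
qed

lemma along2_form_at:
  "2 * coeff (along (form_at p) v w) 2 = (\<Sum>j\<in>UNIV. \<Sum>i\<in>UNIV. w $ i * w $ j * hessian p v $ i $ j)"
proof -
  have "2 * coeff (along (form_at p) v w) 2 = coeff (pderiv (along (form_at p) v w)) 1" by (simp add: coeff_pderiv numeral_2_eq_2)
  also have "\<dots> = (\<Sum>j\<in>UNIV. w $ j * D1 (form_at (mpoly_pderiv j p)) v w)"
    by (simp add: pderiv_along_form_at coeff_sum)
  finally show ?thesis by (simp add: D1_form_at hessian_def sum_distrib_left mult_ac)
qed

lemma lookup_mpoly_pderiv:
  "Poly_Mapping.lookup (mpoly_pderiv i p) m = of_nat (Poly_Mapping.lookup m i + 1) * Poly_Mapping.lookup p (m + Poly_Mapping.single i 1)"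
proof -
  have "Poly_Mapping.lookup (mpoly_pderiv i p) m =
     (\<Sum>n\<in>Poly_Mapping.keys p. (of_nat (Poly_Mapping.lookup n i) * Poly_Mapping.lookup p n when n - Poly_Mapping.single i 1 = m))"
    by (simp add: mpoly_pderiv_def lookup_sum lookup_single)
  also have "\<dots> = (\<Sum>n\<in>Poly_Mapping.keys p. (of_nat (Poly_Mapping.lookup n i) * Poly_Mapping.lookup p n when n = m + Poly_Mapping.single i 1))"
  proof (rule sum.cong[OF refl])
    fix n assume "n \<in> Poly_Mapping.keys p"
    have "n - Poly_Mapping.single i 1 = m \<longleftrightarrow> n = m + Poly_Mapping.single i 1" if "Poly_Mapping.lookup n i \<noteq> 0"
    proof
      assume e: "n - Poly_Mapping.single i 1 = m"
      show "n = m + Poly_Mapping.single i 1"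
        by (rule poly_mapping_eqI) (use that in \<open>auto simp: e[symmetric] lookup_add lookup_minus lookup_single when_def\<close>)
    qed simp
    then show "(of_nat (Poly_Mapping.lookup n i) * Poly_Mapping.lookup p n when n - Poly_Mapping.single i 1 = m) =
      (of_nat (Poly_Mapping.lookup n i) * Poly_Mapping.lookup p n when n = m + Poly_Mapping.single i 1)"
      by (cases "Poly_Mapping.lookup n i = 0") auto
  qed
  also have "\<dots> = of_nat (Poly_Mapping.lookup m i + 1) * Poly_Mapping.lookup p (m + Poly_Mapping.single i 1)"
    by (cases "m + Poly_Mapping.single i 1 \<in> Poly_Mapping.keys p")
       (auto simp: when_def lookup_add in_keys_iff)
  finally show ?thesis .
qed

text \<open>Formal partial derivatives commute, so the Hessian is the matrix of a quadratic
  form.\<close>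

lemma hessian_symmetric: "hessian p v $ i $ j = hessian p v $ j $ i"
proof -
  have "mpoly_pderiv i (mpoly_pderiv j p) = mpoly_pderiv j (mpoly_pderiv i p)"
    by (rule poly_mapping_eqI) (auto simp: lookup_mpoly_pderiv lookup_add lookup_single when_def ac_simps)
  then show ?thesis by (simp add: hessian_def)
qed

text \<open>The Hessian form is twice the second Taylor coefficient. A translation that leaves this
  coefficient unchanged lies in the radical of the form, and at a node the radical is spanned by the
  node itself.\<close>

lemma node_radical:
  assumes "node_at F v" and rad: "\<And>w'. coeff (along (form_at F) v (w + w')) 2 = coeff (along (form_at F) v w') 2"
  shows "w \<in> vec.span {v}"
proof -
  let ?H = "hessian F v"
  define b where "b x y = (\<Sum>j\<in>UNIV. \<Sum>i\<in>UNIV. x $ i * y $ j * ?H $ i $ j)" for x y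
  have b2: "b x x = 2 * coeff (along (form_at F) v x) 2" for x by (simp add: along2_form_at b_def)
  have badd: "b (x + x') y = b x y + b x' y" "b y (x + x') = b y x + b y x'" for x x' y
    by (simp_all add: b_def algebra_simps sum.distrib)
  have bsym: "b x y = b y x" for x y
    unfolding b_def by (subst sum.swap) (simp add: hessian_symmetric[of F v] mult_ac)
  have w0: "b w w = 0"
    using rad[of 0] b2[of w] b2[of 0] by (simp add: b_def[of 0 0])
  have bw: "b w' w = 0" for w'
  proof -
    have "b (w + w') (w + w') = b w' w'" using rad[of w'] by (simp add: b2)
    then show ?thesis using w0 bsym[of w w'] by (simp add: badd)
  qed
  have "(?H *v w) $ k = 0" for k
  proof -
    have "b (axis k 1) w = (\<Sum>j\<in>UNIV. \<Sum>i\<in>UNIV. if i = k then w $ j * ?H $ k $ j else 0)"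
      unfolding b_def by (intro sum.cong refl) (auto simp: axis_def)
    also have "\<dots> = (?H *v w) $ k" by (simp add: matrix_vector_mult_def mult.commute)
    finally show ?thesis using bw by simp
  qed
  then have "?H *v w = 0" by (simp add: vec_eq_iff)
  then show ?thesis using assms(1) by (auto simp: node_at_def)
qed

lemma singular_at_iff:
  "singular_at F v \<longleftrightarrow> v \<noteq> 0 \<and> form_at F v = 0 \<and> (\<forall>w. D1 (form_at F) v w = 0)"
proof -
  have "form_at (mpoly_pderiv i F) v = D1 (form_at F) v (axis i 1)" for i
    by (simp add: D1_form_at axis_def if_distrib[of "\<lambda>x. x * _"] cong: if_cong)
  then show ?thesis by (auto simp: singular_at_def) (simp add: D1_form_at)
qed

section \<open>The discriminant of a binary quartic\<close>

definition quartic_I :: "'a::idom \<Rightarrow> 'a \<Rightarrow> 'a \<Rightarrow> 'a \<Rightarrow> 'a \<Rightarrow> 'a" where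
  "quartic_I a b c d e = 12 * a * e - 3 * b * d + c\<^sup>2"

definition quartic_J :: "'a::idom \<Rightarrow> 'a \<Rightarrow> 'a \<Rightarrow> 'a \<Rightarrow> 'a \<Rightarrow> 'a" where
  "quartic_J a b c d e = 72 * a * c * e + 9 * b * c * d - 27 * a * d\<^sup>2 - 27 * b\<^sup>2 * e - 2 * c ^ 3"

definition quartic_disc :: "'a::idom \<Rightarrow> 'a \<Rightarrow> 'a \<Rightarrow> 'a \<Rightarrow> 'a \<Rightarrow> 'a" where
  "quartic_disc a b c d e = 4 * quartic_I a b c d e ^ 3 - (quartic_J a b c d e)\<^sup>2"

lemma quartic_disc_translate:
  "quartic_disc (a + b * x + c * x\<^sup>2 + d * x ^ 3 + e * x ^ 4) (b + 2 * c * x + 3 * d * x\<^sup>2 + 4 * e * x ^ 3)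
     (c + 3 * d * x + 6 * e * x\<^sup>2) (d + 4 * e * x) e = quartic_disc a b c d (e :: 'a::idom)"
proof -
  have "quartic_I (a + b * x + c * x\<^sup>2 + d * x ^ 3 + e * x ^ 4) (b + 2 * c * x + 3 * d * x\<^sup>2 + 4 * e * x ^ 3)
     (c + 3 * d * x + 6 * e * x\<^sup>2) (d + 4 * e * x) e = quartic_I a b c d e"
    unfolding quartic_I_def by algebra
  moreover have "quartic_J (a + b * x + c * x\<^sup>2 + d * x ^ 3 + e * x ^ 4) (b + 2 * c * x + 3 * d * x\<^sup>2 + 4 * e * x ^ 3)
     (c + 3 * d * x + 6 * e * x\<^sup>2) (d + 4 * e * x) e = quartic_J a b c d e"
    unfolding quartic_J_def by algebra
  ultimately show ?thesis by (simp add: quartic_disc_def)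
qed

lemma quartic_disc_reverse: "quartic_disc a b c d e = quartic_disc e d c b a"
  by (simp add: quartic_disc_def quartic_I_def quartic_J_def algebra_simps)

lemma quartic_disc_scale: "quartic_disc a (x * b) (x\<^sup>2 * c) (x ^ 3 * d) (x ^ 4 * e) = x ^ 12 * quartic_disc a b c d e"
proof -
  have "quartic_I a (x * b) (x\<^sup>2 * c) (x ^ 3 * d) (x ^ 4 * e) = x ^ 4 * quartic_I a b c d e"
    unfolding quartic_I_def by algebra
  moreover have "quartic_J a (x * b) (x\<^sup>2 * c) (x ^ 3 * d) (x ^ 4 * e) = x ^ 6 * quartic_J a b c d e"
    unfolding quartic_J_def by algebra
  ultimately show ?thesis by (simp add: quartic_disc_def power_mult_distrib right_diff_distrib flip: power_mult)
qed

lemma quartic_disc_bigraded: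
  "quartic_disc (P\<^sup>2 * a) (P * b) c (Q * d) (Q\<^sup>2 * e) = P\<^sup>2 * Q\<^sup>2 * (27 *
     (256 * P^4 * Q^4 * e^3 * a^3 - 192 * P^3 * Q^3 * e^2 * d * b * a^2 - 128 * P^2 * Q^2 * e^2 * c^2 * a^2
      + 144 * P^2 * Q^2 * e^2 * c * b^2 * a - 27 * P^2 * Q^2 * e^2 * b^4 + 144 * P^2 * Q^2 * e * d^2 * c * a^2
      - 6 * P^2 * Q^2 * e * d^2 * b^2 * a - 80 * P * Q * e * d * c^2 * b * a + 18 * P * Q * e * d * c * b^3
      + 16 * e * c^4 * a - 4 * e * c^3 * b^2 - 27 * P^2 * Q^2 * d^4 * a^2 + 18 * P * Q * d^3 * c * b * a
      - 4 * P * Q * d^3 * b^3 - 4 * d^2 * c^3 * a + d^2 * c^2 * b^2))"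
  unfolding quartic_disc_def quartic_I_def quartic_J_def by algebra

lemma quartic_disc_one_centre:
  fixes a :: "'a::idom"
  assumes "P\<^sup>2 dvd a + b * x + c * x\<^sup>2 + d * x ^ 3 + e * x ^ 4" "P dvd b + 2 * c * x + 3 * d * x\<^sup>2 + 4 * e * x ^ 3"
    "Q dvd d" "Q\<^sup>2 dvd e"
  shows "P\<^sup>2 * Q\<^sup>2 dvd quartic_disc a b c d e"
proof -
  obtain a' where a': "a + b * x + c * x\<^sup>2 + d * x ^ 3 + e * x ^ 4 = P\<^sup>2 * a'" using assms(1) by (auto elim: dvdE)
  obtain b' where b': "b + 2 * c * x + 3 * d * x\<^sup>2 + 4 * e * x ^ 3 = P * b'" using assms(2) by (auto elim: dvdE)
  obtain e' where e': "e = Q\<^sup>2 * e'" using assms(4) by (auto elim: dvdE)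
  have "Q dvd d + 4 * e * x" using assms(3) e' by (simp add: power2_eq_square)
  then obtain d' where d': "d + 4 * e * x = Q * d'" by (auto elim: dvdE)
  have "quartic_disc a b c d e = quartic_disc (P\<^sup>2 * a') (P * b') (c + 3 * d * x + 6 * e * x\<^sup>2) (Q * d') (Q\<^sup>2 * e')"
    using quartic_disc_translate[of a b x c d e] unfolding a' b' d' by (simp flip: e')
  then show ?thesis unfolding quartic_disc_bigraded by simp
qed

lemma quartic_disc_two_centres:
  fixes a :: "'a::idom"
  assumes "P\<^sup>2 dvd a + b * x + c * x\<^sup>2 + d * x ^ 3 + e * x ^ 4" "P dvd b + 2 * c * x + 3 * d * x\<^sup>2 + 4 * e * x ^ 3"
    "Q\<^sup>2 dvd a + b * y + c * y\<^sup>2 + d * y ^ 3 + e * y ^ 4" "Q dvd b + 2 * c * y + 3 * d * y\<^sup>2 + 4 * e * y ^ 3"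
  shows "P\<^sup>2 * Q\<^sup>2 dvd (x - y) ^ 12 * quartic_disc a b c d e"
proof -
  define z where "z = x - y"
  define f0 where "f0 = a + b * y + c * y\<^sup>2 + d * y ^ 3 + e * y ^ 4"
  define f1 where "f1 = b + 2 * c * y + 3 * d * y\<^sup>2 + 4 * e * y ^ 3"
  define f2 where "f2 = c + 3 * d * y + 6 * e * y\<^sup>2"
  define f3 where "f3 = d + 4 * e * y"
  have v: "z ^ 4 * e + z ^ 3 * f3 * 1 + z\<^sup>2 * f2 * 1\<^sup>2 + z * f1 * 1 ^ 3 + f0 * 1 ^ 4 = a + b * x + c * x\<^sup>2 + d * x ^ 3 + e * x ^ 4"
    unfolding f0_def f1_def f2_def f3_def z_def power_one mult_1_right by algebra
  have w: "z ^ 3 * f3 + 2 * (z\<^sup>2 * f2) * 1 + 3 * (z * f1) * 1\<^sup>2 + 4 * f0 * 1 ^ 3 = 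
     4 * (a + b * x + c * x\<^sup>2 + d * x ^ 3 + e * x ^ 4) - z * (b + 2 * c * x + 3 * d * x\<^sup>2 + 4 * e * x ^ 3)"
    unfolding f0_def f1_def f2_def f3_def z_def power_one mult_1_right by algebra
  have "P\<^sup>2 * Q\<^sup>2 dvd quartic_disc (z ^ 4 * e) (z ^ 3 * f3) (z\<^sup>2 * f2) (z * f1) f0"
  proof (rule quartic_disc_one_centre[of _ _ _ 1])
    show "P dvd z ^ 3 * f3 + 2 * (z\<^sup>2 * f2) * 1 + 3 * (z * f1) * 1\<^sup>2 + 4 * f0 * 1 ^ 3"
      unfolding w using assms(2) dvd_mult_left[of P P] assms(1) by (intro dvd_diff dvd_mult) (auto simp: power2_eq_square)
    show "P\<^sup>2 dvd z ^ 4 * e + z ^ 3 * f3 * 1 + z\<^sup>2 * f2 * 1\<^sup>2 + z * f1 * 1 ^ 3 + f0 * 1 ^ 4"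
      unfolding v by (rule assms(1))
  qed (use assms in \<open>auto simp: f0_def f1_def\<close>)
  also have "quartic_disc (z ^ 4 * e) (z ^ 3 * f3) (z\<^sup>2 * f2) (z * f1) f0 = z ^ 12 * quartic_disc a b c d e"
    using quartic_disc_scale[of f0 z f1 f2 f3 e] quartic_disc_translate[of a b y c d e]
    unfolding f0_def[symmetric] f1_def[symmetric] f2_def[symmetric] f3_def[symmetric]
    by (subst quartic_disc_reverse) simp
  finally show ?thesis by (simp add: z_def)
qed

lemma quartic_disc_vertical:
  fixes a :: "'a::idom"
  assumes "P\<^sup>2 dvd a + b * x + c * x\<^sup>2 + d * x ^ 3 + e * x ^ 4" "P\<^sup>2 dvd b + 2 * c * x + 3 * d * x\<^sup>2 + 4 * e * x ^ 3"
    "P dvd c + 3 * d * x + 6 * e * x\<^sup>2" "P dvd d + 4 * e * x"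
  shows "P ^ 4 dvd quartic_disc a b c d e"
proof -
  obtain a' where a': "a + b * x + c * x\<^sup>2 + d * x ^ 3 + e * x ^ 4 = P\<^sup>2 * a'" using assms(1) by (auto elim: dvdE)
  obtain b' where b': "b + 2 * c * x + 3 * d * x\<^sup>2 + 4 * e * x ^ 3 = P\<^sup>2 * b'" using assms(2) by (auto elim: dvdE)
  obtain c' where c': "c + 3 * d * x + 6 * e * x\<^sup>2 = P * c'" using assms(3) by (auto elim: dvdE)
  obtain d' where d': "d + 4 * e * x = P * d'" using assms(4) by (auto elim: dvdE)
  have "quartic_disc a b c d e = quartic_disc (P\<^sup>2 * a') (P\<^sup>2 * b') (P * c') (P * d') e"
    using quartic_disc_translate[of a b x c d e] unfolding a' b' c' d' by simp
  also have "\<dots> = P ^ 4 * (P\<^sup>2 * (4 * (12 * a' * e - 3 * P * b' * d' + c'\<^sup>2) ^ 3 -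
     (72 * a' * c' * e + 9 * P * b' * c' * d' - 27 * P * a' * d'\<^sup>2 - 27 * P * b'\<^sup>2 * e - 2 * c' ^ 3)\<^sup>2))"
    unfolding quartic_disc_def quartic_I_def quartic_J_def by algebra
  finally show ?thesis by (metis dvd_triv_left)
qed

lemma poly_ring_1_pCons_simp: "poly [:a, b, c, d, e:] y = a + b * y + c * y\<^sup>2 + d * y ^ 3 + e * y ^ 4"
  for y :: "'a::idom"
  by (simp add: algebra_simps power2_eq_square power3_eq_cube power4_eq_xxxx)

lemma quartic_disc_zero_imp_multiple_root:
  fixes a b c d e :: complex
  assumes "e \<noteq> 0" "quartic_disc a b c d e = 0"
  shows "\<exists>y. a + b * y + c * y\<^sup>2 + d * y ^ 3 + e * y ^ 4 = 0 \<and> b + 2 * c * y + 3 * d * y\<^sup>2 + 4 * e * y ^ 3 = 0"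
proof -
  have "\<not> constant (poly [:a, b, c, d, e:])" using assms(1) by (simp add: constant_degree)
  then obtain r where "poly [:a, b, c, d, e:] r = 0" using fundamental_theorem_of_algebra by blast
  then have r: "a + b * r + c * r\<^sup>2 + d * r ^ 3 + e * r ^ 4 = 0" by (simp only: poly_ring_1_pCons_simp)
  define f1 where "f1 = b + 2 * c * r + 3 * d * r\<^sup>2 + 4 * e * r ^ 3"
  define f2 where "f2 = c + 3 * d * r + 6 * e * r\<^sup>2"
  define f3 where "f3 = d + 4 * e * r"
  have "\<not> constant (poly [:f1, f2, f3, e:])" using assms(1) by (simp add: constant_degree)
  then obtain p where p: "poly [:f1, f2, f3, e:] p = 0" using fundamental_theorem_of_algebra by blast
  have "\<not> constant (poly [:f2 + p * (f3 + p * e), f3 + p * e, e:])" using assms(1) by (simp add: constant_degree)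
  then obtain q where q: "poly [:f2 + p * (f3 + p * e), f3 + p * e, e:] q = 0" using fundamental_theorem_of_algebra by blast
  define t where "t = - f3 / e - p - q"
  have f3: "f3 = - e * (p + q + t)" using assms(1) by (simp add: t_def field_simps)
  have f2: "f2 = e * (p * q + p * t + q * t)" using q unfolding f3 by (simp add: algebra_simps eq_neg_iff_add_eq_0)
  have f1: "f1 = - e * p * q * t" using p unfolding f2 f3 by (simp add: algebra_simps eq_neg_iff_add_eq_0)
  have "quartic_disc 0 f1 f2 f3 e = 0"
    using quartic_disc_translate[of a b r c d e] assms(2) unfolding r f1_def f2_def f3_def by simp
  moreover have "quartic_disc 0 f1 f2 f3 e = 27 * e ^ 6 * (p * q * t * (p - q) * (p - t) * (q - t))\<^sup>2"
    unfolding quartic_disc_def quartic_I_def quartic_J_def f1 f2 f3 by algebra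
  ultimately have "f1 = 0 \<or> p = q \<or> p = t \<or> q = t" using assms(1) by (auto simp: f1)
  moreover have val: "a + b * (r + y) + c * (r + y)\<^sup>2 + d * (r + y) ^ 3 + e * (r + y) ^ 4 = y * (f1 + f2 * y + f3 * y\<^sup>2 + e * y ^ 3)" for y
    using r unfolding f1_def f2_def f3_def by algebra
  moreover have der: "b + 2 * c * (r + y) + 3 * d * (r + y)\<^sup>2 + 4 * e * (r + y) ^ 3 = f1 + 2 * f2 * y + 3 * f3 * y\<^sup>2 + 4 * e * y ^ 3" for y
    unfolding f1_def f2_def f3_def by algebra
  ultimately consider "f1 = 0" | "p = q" | "p = t" | "q = t" by blast
  then show ?thesis
  proof cases
    case 1 then show ?thesis using r by (auto simp: f1_def)
  next
    case 2
    show ?thesis by (rule exI[of _ "r + p"]) (unfold val der f1 f2 f3 2, algebra)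
  next
    case 3
    show ?thesis by (rule exI[of _ "r + t"]) (unfold val der f1 f2 f3 3, algebra)
  next
    case 4
    show ?thesis by (rule exI[of _ "r + t"]) (unfold val der f1 f2 f3 4, algebra)
  qed
qed

section \<open>Repeated factors of bivariate polynomials\<close>

lemma prime_factor_of_positive_degree:
  fixes p :: "'a::{factorial_ring_gcd,semiring_gcd_mult_normalize} poly"
  assumes "degree p \<ge> 1"
  shows "\<exists>D. prime_elem D \<and> degree D \<ge> 1 \<and> D dvd p"
proof (rule ccontr)
  assume *: "\<not> ?thesis"
  have "p \<noteq> 0" using assms by auto
  then obtain A where A: "\<forall>x. x \<in># A \<longrightarrow> prime_elem x" "normalize (prod_mset A) = normalize p"
    using prime_factorization_exists by blast
  have "x dvd p" if "x \<in># A" for x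
  proof -
    have "x dvd prod_mset A" using that by (rule dvd_prod_mset)
    also have "prod_mset A dvd p" using A(2) by (metis dvd_normalize_iff dvd_refl normalize_dvd_iff)
    finally show ?thesis .
  qed
  then have "degree x = 0" if "x \<in># A" for x using * A that by fastforce
  then have "degree (prod_mset A) = 0"
  proof (induction A)
    case (add x A)
    then show ?case using degree_mult_le[of x "prod_mset A"] by simp
  qed auto
  moreover have "p dvd prod_mset A" using A(2) by (metis dvd_normalize_iff dvd_refl normalize_dvd_iff)
  moreover have "prod_mset A \<noteq> 0" using A(1) by (auto simp: prod_mset_zero_iff)
  ultimately show False using assms dvd_imp_degree_le[of p "prod_mset A"] by simp
qed

text \<open>Without a common factor of positive degree the two polynomials are coprime over the
  field of fractions of the coefficients; clearing denominators leaves a nonzero constant.\<close>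

lemma bezout_up_to_constant:
  fixes f h :: "'a::{factorial_ring_gcd,semiring_gcd_mult_normalize} poly"
  assumes "f \<noteq> 0" "\<And>D. prime_elem D \<Longrightarrow> degree D \<ge> 1 \<Longrightarrow> D dvd f \<Longrightarrow> D dvd h \<Longrightarrow> False"
  shows "\<exists>U V r. r \<noteq> 0 \<and> U * f + V * h = [:r:]"
  using assms
proof (induction "if h = 0 then 0 else Suc (degree h)" arbitrary: f h rule: less_induct)
  case less
  show ?case
  proof (cases "h = 0")
    case True
    then have "degree f = 0" using prime_factor_of_positive_degree[of f] less.prems by (metis dvd_0_right less_one not_less)
    then obtain r where "f = [:r:]" by (rule degree_eq_zeroE)
    then show ?thesis using less.prems(1) by (intro exI[of _ 1] exI[of _ 0] exI[of _ r]) auto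
  next
    case False
    obtain q \<rho> where *: "pseudo_divmod f h = (q, \<rho>)" by fastforce
    define c where "c = coeff h (degree h) ^ (Suc (degree f) - degree h)"
    have c: "c \<noteq> 0" using False by (simp add: c_def)
    have eq: "smult c f = h * q + \<rho>" and deg: "\<rho> = 0 \<or> degree \<rho> < degree h"
      using pseudo_divmod[OF False *] by (auto simp: c_def)
    have "\<exists>U V r. r \<noteq> 0 \<and> U * h + V * \<rho> = [:r:]"
    proof (rule less.hyps)
      show "(if \<rho> = 0 then 0 else Suc (degree \<rho>)) < (if h = 0 then 0 else Suc (degree h))"
        using deg False by auto
      fix D :: "'a poly" assume D: "prime_elem D" "degree D \<ge> 1" "D dvd h" "D dvd \<rho>"
      then have "D dvd [:c:] * f" using eq by simp
      then have "D dvd [:c:] \<or> D dvd f" using D(1) prime_elem_dvd_mult_iff by blast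
      moreover have "\<not> D dvd [:c:]" using dvd_imp_degree_le[of D "[:c:]"] c D(2) by auto
      ultimately show False using less.prems(2) D by blast
    qed fact
    then obtain U V r where r: "r \<noteq> 0" "U * h + V * \<rho> = [:r:]" by blast
    have "(V * [:c:]) * f + (U - V * q) * h = U * h + V * ([:c:] * f - h * q)" by (simp only: algebra_simps)
    also have "[:c:] * f - h * q = \<rho>" using eq by simp
    finally have "(V * [:c:]) * f + (U - V * q) * h = [:r:]" using r(2) by simp
    then show ?thesis using r(1) by blast
  qed
qed

lemma poly_quartic: "poly [:a, b, c, d, e:] y = a + b * y + c * y\<^sup>2 + d * y ^ 3 + e * y ^ 4"
  for y :: "'a::idom"
  by (simp add: algebra_simps power2_eq_square power3_eq_cube power4_eq_xxxx)

lemma poly_pderiv_quartic: "poly (pderiv [:a, b, c, d, e:]) y = b + 2 * c * y + 3 * d * y\<^sup>2 + 4 * e * y ^ 3"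
  for y :: "'a::idom"
  by (simp add: pderiv_pCons algebra_simps power2_eq_square power3_eq_cube)

lemma poly_quartic_disc:
  "poly (quartic_disc a b c d e) x = quartic_disc (poly a x) (poly b x) (poly c x) (poly d x) (poly e x)"
  for a :: "complex poly"
  by (simp add: quartic_disc_def quartic_I_def quartic_J_def)

lemma quartic_disc_zero_imp_square_factor:
  fixes a b c d e :: "complex poly"
  assumes "e \<noteq> 0" "quartic_disc a b c d e = 0"
  shows "\<exists>D. degree D \<ge> 1 \<and> D\<^sup>2 dvd [:a, b, c, d, e:]"
proof (rule ccontr)
  assume *: "\<not> ?thesis"
  define f where "f = [:a, b, c, d, e:]"
  have f0: "f \<noteq> 0" using assms(1) by (simp add: f_def)
  have "\<exists>U V r. r \<noteq> 0 \<and> U * f + V * pderiv f = [:r:]"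
  proof (rule bezout_up_to_constant)
    fix D assume D: "prime_elem D" "degree D \<ge> 1" "D dvd f" "D dvd pderiv f"
    then obtain E where E: "f = D * E" by (auto elim: dvdE)
    have "D dvd E * pderiv D" using D(4) unfolding E pderiv_mult by (simp add: dvd_add_right_iff)
    then have "D dvd E \<or> D dvd pderiv D" using D(1) prime_elem_dvd_mult_iff by blast
    moreover have "\<not> D dvd pderiv D"
      using dvd_imp_degree_le[of D "pderiv D"] D(2) degree_pderiv[of D] pderiv_eq_0_iff[of D] by auto
    ultimately have "D * D dvd f" unfolding E by (intro mult_dvd_mono) auto
    then show False using * D(2) by (auto simp: f_def power2_eq_square)
  qed fact
  then obtain U V r where r: "r \<noteq> 0" "U * f + V * pderiv f = [:r:]" by blast
  have "finite {x. poly (r * e) x = 0}" using r(1) assms(1) by (intro poly_roots_finite) simp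
  then obtain x where "poly (r * e) x \<noteq> 0" by (metis (mono_tags, lifting) UNIV_eq_I infinite_UNIV_char_0 mem_Collect_eq)
  then have x: "poly r x \<noteq> 0" "poly e x \<noteq> 0" by auto
  have "quartic_disc (poly a x) (poly b x) (poly c x) (poly d x) (poly e x) = 0"
    using assms(2) by (simp flip: poly_quartic_disc)
  from quartic_disc_zero_imp_multiple_root[OF x(2) this] obtain y where y:
    "poly a x + poly b x * y + poly c x * y\<^sup>2 + poly d x * y ^ 3 + poly e x * y ^ 4 = 0"
    "poly b x + 2 * poly c x * y + 3 * poly d x * y\<^sup>2 + 4 * poly e x * y ^ 3 = 0" by blast
  have "poly (poly f [:y:]) x = 0" "poly (poly (pderiv f) [:y:]) x = 0"
    using y unfolding f_def poly_quartic poly_pderiv_quartic by (simp_all add: mult.commute mult.left_commute)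
  moreover have "poly (poly (U * f + V * pderiv f) [:y:]) x = poly r x" unfolding r(2) by simp
  ultimately show False using x(1) by simp
qed

lemma card_double_roots:
  fixes g :: "complex poly"
  assumes "g \<noteq> 0" "finite Y" "\<And>y. y \<in> Y \<Longrightarrow> poly g y = 0 \<and> poly (pderiv g) y = 0"
  shows "2 * card Y \<le> degree g"
proof -
  have "2 \<le> order y g" if "y \<in> Y" for y
  proof (rule ccontr)
    assume "\<not> 2 \<le> order y g"
    moreover have o: "order y g \<noteq> 0" using assms that order_root by blast
    moreover have pd: "pderiv g \<noteq> 0"
    proof
      assume "pderiv g = 0"
      then obtain k where "g = [:k:]" by (metis pderiv_eq_0_iff degree_eq_zeroE)
      then show False using assms that by auto
    qed
    ultimately have "order y (pderiv g) = 0" using order_pderiv[OF assms(1), of y] assms(3)[OF that] \<open>\<not> 2 \<le> order y g\<close> by simp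
    then show False using assms(3)[OF that] order_root pd by blast
  qed
  then have "(\<Sum>y\<in>Y. 2) \<le> (\<Sum>y\<in>Y. order y g)" by (intro sum_mono) auto
  also have "\<dots> \<le> (\<Sum>y | poly g y = 0. order y g)"
    using assms by (intro sum_mono2 poly_roots_finite) auto
  also have "\<dots> \<le> degree g" by (rule sum_order_le_degree[OF assms(1)])
  finally show ?thesis by simp
qed

section \<open>How often the discriminant of a family of quartics vanishes\<close>

text \<open>A centre of order \<open>n\<close> is a double point of the curve \<open>f = 0\<close>
  with \<open>n - 1\<close> further double points infinitely near to it on the graph of a polynomial
  \<open>c\<close>. The vertical case covers two infinitely near double points in the direction of
  the fibre, where no such graph exists.\<close>

definition centre :: "complex poly poly \<Rightarrow> complex \<Rightarrow> complex \<Rightarrow> nat \<Rightarrow> bool" where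
  "centre f x0 y n \<longleftrightarrow> (\<exists>c. poly c x0 = y \<and> [:-x0, 1:] ^ (2 * n) dvd poly f c \<and> [:-x0, 1:] ^ n dvd poly (pderiv f) c)"

definition vertical_centre :: "complex poly poly \<Rightarrow> complex \<Rightarrow> complex \<Rightarrow> bool" where
  "vertical_centre f x0 y \<longleftrightarrow> (let g = pcompose f [:[:y:], 1:] in
     (\<forall>i<2. [:-x0, 1:]\<^sup>2 dvd coeff g i) \<and> (\<forall>i<4. [:-x0, 1:] dvd coeff g i))"

lemma pcompose_quartic:
  "pcompose [:a, b, c, d, e:] [:x, 1:] = [:a + b * x + c * x\<^sup>2 + d * x ^ 3 + e * x ^ 4, b + 2 * c * x + 3 * d * x\<^sup>2 + 4 * e * x ^ 3,
     c + 3 * d * x + 6 * e * x\<^sup>2, d + 4 * e * x, e:]" for x :: "'a::idom"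
  by (simp add: pcompose_pCons algebra_simps power2_eq_square power3_eq_cube power4_eq_xxxx)

lemma all_less_numerals: "(\<forall>i<2. P i) \<longleftrightarrow> P 0 \<and> P (Suc 0)" "(\<forall>i<4. P i) \<longleftrightarrow> P 0 \<and> P (Suc 0) \<and> P (Suc (Suc 0)) \<and> P (Suc (Suc (Suc 0)))"
  by (auto simp: less_Suc_eq numeral_eq_Suc)

lemma vertical_centreD:
  assumes "vertical_centre [:a, b, c, d, e:] x0 y"
  shows "[:-x0, 1:] ^ 4 dvd quartic_disc a b c d e"
    and "poly e x0 = 0 \<Longrightarrow> poly a x0 = 0 \<and> poly b x0 = 0 \<and> poly c x0 = 0 \<and> poly d x0 = 0"
    and "poly a x0 + poly b x0 * z + poly c x0 * z\<^sup>2 + poly d x0 * z ^ 3 + poly e x0 * z ^ 4 = poly e x0 * (z - y) ^ 4"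
proof -
  note v = assms[unfolded vertical_centre_def pcompose_quartic Let_def all_less_numerals, simplified coeff_pCons_0 coeff_pCons_Suc]
  show "[:-x0, 1:] ^ 4 dvd quartic_disc a b c d e"
    by (rule quartic_disc_vertical[of _ _ _ "[:y:]"]) (use v in \<open>auto simp: numeral_eq_Suc\<close>)
  have "[:-x0, 1:] dvd a + b * [:y:] + c * [:y:]\<^sup>2 + d * [:y:] ^ 3 + e * [:y:] ^ 4" using v by (simp add: numeral_eq_Suc)
  then have 0: "poly a x0 + poly b x0 * y + poly c x0 * y\<^sup>2 + poly d x0 * y ^ 3 + poly e x0 * y ^ 4 = 0"
    unfolding poly_eq_0_iff_dvd[symmetric] by (simp add: mult.commute mult.left_commute)
  have "[:-x0, 1:] dvd b + 2 * c * [:y:] + 3 * d * [:y:]\<^sup>2 + 4 * e * [:y:] ^ 3" using v by (simp add: numeral_eq_Suc)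
  then have 1: "poly b x0 + 2 * poly c x0 * y + 3 * poly d x0 * y\<^sup>2 + 4 * poly e x0 * y ^ 3 = 0"
    unfolding poly_eq_0_iff_dvd[symmetric] by (simp add: mult.commute mult.left_commute)
  have "[:-x0, 1:] dvd c + 3 * d * [:y:] + 6 * e * [:y:]\<^sup>2" using v by (simp add: numeral_eq_Suc)
  then have 2: "poly c x0 + 3 * poly d x0 * y + 6 * poly e x0 * y\<^sup>2 = 0"
    unfolding poly_eq_0_iff_dvd[symmetric] by (simp add: mult.commute mult.left_commute)
  have "[:-x0, 1:] dvd d + 4 * e * [:y:]" using v by (simp add: numeral_eq_Suc)
  then have 3: "poly d x0 + 4 * poly e x0 * y = 0"
    unfolding poly_eq_0_iff_dvd[symmetric] by (simp add: mult.commute mult.left_commute)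
  show "poly e x0 = 0 \<Longrightarrow> poly a x0 = 0 \<and> poly b x0 = 0 \<and> poly c x0 = 0 \<and> poly d x0 = 0"
    using 0 1 2 3 by auto
  show "poly a x0 + poly b x0 * z + poly c x0 * z\<^sup>2 + poly d x0 * z ^ 3 + poly e x0 * z ^ 4 = poly e x0 * (z - y) ^ 4"
    using 0 1 2 3 by algebra
qed

text \<open>A centre of order \<open>n\<close> makes the discriminant vanish to order \<open>2
  n\<close>, and \<open>m\<close> accounts for a centre at infinity. A quartic that is not zero has
  room for few multiple roots, so only the cases of one and of two centres on a fibre
  matter.\<close>

lemma fibre_bound:
  assumes nz: "poly a x0 \<noteq> 0 \<or> poly b x0 \<noteq> 0 \<or> poly c x0 \<noteq> 0 \<or> poly d x0 \<noteq> 0 \<or> poly e x0 \<noteq> 0"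
    and m: "m \<le> 1" "[:-x0, 1:] ^ m dvd d" "[:-x0, 1:] ^ (2 * m) dvd e"
    and Y: "finite Y" "\<And>y. y \<in> Y \<Longrightarrow> n y \<ge> (1::nat)"
      "\<And>y. y \<in> Y \<Longrightarrow> centre [:a, b, c, d, e:] x0 y (n y) \<or> n y = 2 \<and> vertical_centre [:a, b, c, d, e:] x0 y"
  shows "[:-x0, 1:] ^ (2 * (\<Sum>y\<in>Y. n y) + 2 * m) dvd quartic_disc a b c d e"
proof -
  let ?f = "[:a, b, c, d, e:]" and ?\<pi> = "[:-x0, 1:]"
  define g where "g = [:poly a x0, poly b x0, poly c x0, poly d x0, poly e x0:]"
  have g0: "g \<noteq> 0" using nz by (auto simp: g_def)
  have sq: "(?\<pi> ^ k)\<^sup>2 = ?\<pi> ^ (2 * k)" for k by (simp only: power_mult[symmetric] mult.commute)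
  have root: "poly g y = 0 \<and> poly (pderiv g) y = 0" if "y \<in> Y" for y
    using Y(3)[OF that]
  proof
    assume "centre ?f x0 y (n y)"
    then obtain q where q: "poly q x0 = y" "?\<pi> ^ (2 * n y) dvd poly ?f q" "?\<pi> ^ n y dvd poly (pderiv ?f) q"
      by (auto simp: centre_def)
    have "?\<pi> dvd poly ?f q" "?\<pi> dvd poly (pderiv ?f) q"
      using q(2,3) Y(2)[OF that] by (auto elim!: dvd_trans[rotated] intro!: dvd_power)
    then have "poly (poly ?f q) x0 = 0" "poly (poly (pderiv ?f) q) x0 = 0" by (simp_all only: poly_eq_0_iff_dvd)
    then show ?thesis unfolding poly_quartic poly_pderiv_quartic g_def by (simp add: q(1))
  next
    assume "n y = 2 \<and> vertical_centre ?f x0 y"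
    then have *: "poly g z = poly [:0, 0, 0, 0, poly e x0:] (z - y)" for z
      using vertical_centreD(3)[of a b c d e x0 y z] unfolding g_def poly_quartic by simp
    have "g = pcompose [:0, 0, 0, 0, poly e x0:] [:-y, 1:]"
      by (subst poly_eq_poly_eq_iff[symmetric]) (simp only: fun_eq_iff poly_pcompose *, simp)
    then have "g = [:-y, 1:] ^ 4 * [:poly e x0:]" by (simp add: pcompose_pCons power4_eq_xxxx)
    then show ?thesis by (simp add: pderiv_smult pderiv_power)
  qed
  have degg: "degree g \<le> 4 - 2 * m"
  proof (cases "m = 0")
    case True then show ?thesis by (simp add: g_def)
  next
    case False
    then have "m = 1" using m by simp
    then have "?\<pi> dvd ?\<pi> ^ m" "?\<pi> dvd ?\<pi> ^ (2 * m)" by (simp_all only: dvd_power) (auto intro!: dvd_power)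
    then have "?\<pi> dvd d" "?\<pi> dvd e" using m dvd_trans by blast+
    then have "poly d x0 = 0" "poly e x0 = 0" by (simp_all only: poly_eq_0_iff_dvd)
    then show ?thesis using \<open>m = 1\<close> by (simp add: g_def)
  qed
  have card: "2 * card Y + 2 * m \<le> 4"
    using card_double_roots[OF g0 Y(1) root] degg m(1) by linarith
  then consider "card Y = 0" | "card Y = 1" | "card Y = 2" "m = 0" by linarith
  then show ?thesis
  proof cases
    case 1
    then have "Y = {}" using Y(1) by simp
    moreover have "1\<^sup>2 * (?\<pi> ^ m)\<^sup>2 dvd quartic_disc a b c d e"
      by (rule quartic_disc_one_centre[of _ _ _ 0]) (use m in \<open>auto simp: power_mult mult.commute[of 2] simp flip: power_mult\<close>)
    ultimately show ?thesis by (simp add: mult.commute flip: power_mult)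
  next
    case 2
    then obtain y where Yy: "Y = {y}" by (auto simp: card_1_singleton_iff)
    from Y(3)[of y] Yy consider "centre ?f x0 y (n y)" | "n y = 2" "vertical_centre ?f x0 y" by auto
    then show ?thesis
    proof cases
      case 1
      then obtain q where q: "?\<pi> ^ (2 * n y) dvd poly ?f q" "?\<pi> ^ n y dvd poly (pderiv ?f) q"
        by (auto simp: centre_def)
      have "?\<pi> ^ (2 * n y) * ?\<pi> ^ (2 * m) dvd quartic_disc a b c d e"
        using quartic_disc_one_centre[of "?\<pi> ^ n y" a b q c d e "?\<pi> ^ m"] q m
        unfolding poly_quartic poly_pderiv_quartic sq by blast
      then show ?thesis by (simp add: Yy power_add)
    next
      case 2
      have "m = 0"
      proof (rule ccontr)
        assume "m \<noteq> 0"
        then have "?\<pi> dvd e" using m by (auto elim!: dvd_trans[rotated] intro!: dvd_power)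
        then have "poly e x0 = 0" by (simp only: poly_eq_0_iff_dvd)
        then show False using vertical_centreD(2)[OF 2(2)] nz by auto
      qed
      then show ?thesis using vertical_centreD(1)[OF 2(2)] 2(1) by (simp add: Yy)
    qed
  next
    case 3
    then obtain y z where Yyz: "Y = {y, z}" "y \<noteq> z" by (auto simp: card_2_iff)
    have nv: "\<not> vertical_centre ?f x0 u" if u: "u \<in> Y" for u
    proof
      assume v: "vertical_centre ?f x0 u"
      obtain u' where u': "u' \<in> Y" "u' \<noteq> u" using Yyz by auto
      have "poly e x0 * (u' - u) ^ 4 = 0"
        using vertical_centreD(3)[OF v, of u'] root[OF u'(1)] unfolding g_def poly_quartic by simp
      then have "poly e x0 = 0" using u' by simp
      then show False using vertical_centreD(2)[OF v] nz by auto
    qed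
    have "centre ?f x0 y (n y)" "centre ?f x0 z (n z)" using Y(3) nv Yyz by auto
    then obtain p q where q: "poly q x0 = z" "?\<pi> ^ (2 * n z) dvd poly ?f q" "?\<pi> ^ n z dvd poly (pderiv ?f) q"
      and p: "poly p x0 = y" "?\<pi> ^ (2 * n y) dvd poly ?f p" "?\<pi> ^ n y dvd poly (pderiv ?f) p"
        by (auto simp: centre_def)
    have "?\<pi> ^ (2 * n y) * ?\<pi> ^ (2 * n z) dvd (p - q) ^ 12 * quartic_disc a b c d e"
      using quartic_disc_two_centres[of "?\<pi> ^ n y" a b p c d e "?\<pi> ^ n z" q] p q
      unfolding poly_quartic poly_pderiv_quartic sq by blast
    then have "?\<pi> ^ (2 * (n y + n z)) dvd (p - q) ^ 12 * quartic_disc a b c d e"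
      unfolding distrib_left power_add .
    moreover have "\<not> ?\<pi> dvd p - q" unfolding poly_eq_0_iff_dvd[symmetric] using p q Yyz by simp
    then have "coprime ?\<pi> (p - q)" by (intro prime_elem_imp_coprime prime_elem_linear_field_poly) auto
    then have "coprime (?\<pi> ^ (2 * (n y + n z))) ((p - q) ^ 12)" by simp
    ultimately have "?\<pi> ^ (2 * (n y + n z)) dvd quartic_disc a b c d e"
      using coprime_dvd_mult_right_iff by blast
    then show ?thesis using 3 Yyz by simp
  qed
qed

section \<open>The conic\<close>

text \<open>The form of the tangent cone at the chosen node, in coordinates in which this cone is a
  sum of three squares; it is bilinear and not Hermitian.\<close>

definition vdot :: "complex^3 \<Rightarrow> complex^3 \<Rightarrow> complex" where
  "vdot v w = (\<Sum>i\<in>UNIV. v $ i * w $ i)"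

lemma vdot_3: "vdot v w = v $ 1 * w $ 1 + v $ 2 * w $ 2 + v $ 3 * w $ 3"
  by (simp add: vdot_def sum_3)

lemma vec3_eq_iff: "v = w \<longleftrightarrow> v $ 1 = w $ 1 \<and> v $ 2 = w $ 2 \<and> v $ 3 = w $ 3" for v w :: "complex^3"
  by (simp add: vec_eq_iff forall_3)

lemma vdot_simps:
  "vdot (v + w) u = vdot v u + vdot w u" "vdot u (v + w) = vdot u v + vdot u w"
  "vdot (c *s v) u = c * vdot v u" "vdot u (c *s v) = c * vdot u v"
  "vdot (v - w) u = vdot v u - vdot w u" "vdot u (v - w) = vdot u v - vdot u w"
  "vdot 0 u = 0" "vdot u 0 = 0" "vdot (- v) u = - vdot v u" "vdot u (- v) = - vdot u v"
  by (simp_all add: vdot_3 algebra_simps)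

lemma vdot_commute: "vdot v w = vdot w v"
  by (simp add: vdot_3 mult.commute)

lemma homog_vdot: "homog (Suc 0) (vdot l)"
  using homog_linear[of l] by (simp add: vdot_def[abs_def])

lemma homog_vdot_self: "homog 2 (\<lambda>v. vdot v v)"
proof -
  have "homog 2 (\<lambda>v::complex^3. v $ i * v $ i)" for i
    using homog.mult[OF homog.coord[of i] homog.coord[of i]] by (simp add: numeral_2_eq_2)
  then show ?thesis unfolding vdot_def by (intro homog_sum)
qed

lemma along_vdot: "along (vdot l) b w = [:vdot l b, vdot l w:]"
  by (rule alongI) (simp add: vdot_simps algebra_simps)

lemma along_vdot_self: "along (\<lambda>v. vdot v v) b w = [:vdot b b, 2 * vdot b w, vdot w w:]"
  by (rule alongI) (simp add: vdot_simps vdot_commute[of w b] algebra_simps power2_eq_square)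

lemma vdot_axis: "vdot b (axis i 1) = b $ i"
  by (simp add: vdot_def axis_def if_distrib[of "\<lambda>x. _ * x"] cong: if_cong)

lemma vdot_nondegenerate: "(\<And>w. vdot b w = 0) \<Longrightarrow> b = 0"
  by (subst vec_eq_iff) (metis vdot_axis zero_index)

lemma homog_domain:
  assumes "homog d f" "homog e h" "\<And>v. f v * h v = 0" "h u \<noteq> 0"
  shows "f v = 0"
proof -
  have "coeff (along h v u) e = h u"
    using along_swap[OF assms(2), of e v u] coeff_along_0[OF assms(2), of u v] by simp
  then have "along h v u \<noteq> 0" using assms(4) by auto
  moreover have "along f v u * along h v u = 0"
    using along_mult[OF assms(1,2), of v u] assms(3) along_const[of 0 v u] by simp
  ultimately have "along f v u = 0" by simp
  then show ?thesis using coeff_along_0[OF assms(1), of v u] by simp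
qed

definition conic_point :: "complex \<Rightarrow> complex^3" where
  "conic_point s = vector [s\<^sup>2 - 1, \<i> * (s\<^sup>2 + 1), 2 * s]"

lemma conic_point_nth [simp]:
  "conic_point s $ 1 = s\<^sup>2 - 1" "conic_point s $ 2 = \<i> * (s\<^sup>2 + 1)" "conic_point s $ 3 = 2 * s"
  by (simp_all add: conic_point_def)

lemma conic_point_isotropic: "vdot (conic_point s) (conic_point s) = 0"
proof -
  have "vdot (conic_point s) (conic_point s) = (s\<^sup>2 - 1)\<^sup>2 + \<i>\<^sup>2 * (s\<^sup>2 + 1)\<^sup>2 + 4 * s\<^sup>2"
    by (simp add: vdot_3 power2_eq_square mult_ac)
  also have "\<dots> = 0" unfolding power2_i by algebra
  finally show ?thesis .
qed

lemma conic_point_inj: "conic_point s = c *s conic_point s' \<Longrightarrow> s = s'"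
proof -
  assume "conic_point s = c *s conic_point s'"
  then have e: "s\<^sup>2 - 1 = c * (s'\<^sup>2 - 1)" "s\<^sup>2 + 1 = c * (s'\<^sup>2 + 1)" "s = c * s'"
    by (simp_all only: vec3_eq_iff conic_point_nth vector_smult_component mult.left_commute[of c] mult_cancel_left complex_i_not_zero) auto
  then have "(s\<^sup>2 + 1) - (s\<^sup>2 - 1) = c * 2" by (simp only: e) (simp add: algebra_simps)
  then show ?thesis using e by simp
qed

lemma conic_point_nonzero: "conic_point s \<noteq> 0"
  using conic_point_inj[of s 0 "s + 1"] by auto

lemma isotropic_cases:
  assumes "vdot v v = 0" "v $ 1 + \<i> * v $ 2 \<noteq> 0"
  shows "\<exists>c s. c \<noteq> 0 \<and> v = c *s conic_point s"
proof -
  obtain x y z where xyz: "v $ 1 = x" "v $ 2 = y" "v $ 3 = z" by blast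
  define a where "a = x + \<i> * y"
  have a: "a \<noteq> 0" using assms(2) by (simp add: a_def xyz)
  have iso: "x * x + y * y + z * z = 0" using assms(1) by (simp only: vdot_3 xyz)
  define c s where "c = - a / 2" and "s = - z / a"
  have cs: "c * s = z / 2" using a by (simp add: c_def s_def)
  have i2: "\<i> * \<i> + 1 = 0" by simp
  have "2 * a * (c * s\<^sup>2) = 2 * (a * s) * (c * s)" by (simp add: power2_eq_square)
  also have "\<dots> = - z * z" using a unfolding cs by (simp add: s_def)
  also have "\<dots> = x * x + y * y" using minus_unique[of "z * z" "x * x + y * y"] iso by (simp add: add.commute)
  also have "\<dots> = a * (x - \<i> * y)"
  proof -
    have "a * (x - \<i> * y) = x * x - \<i> * \<i> * (y * y)" unfolding a_def by (simp only: ring_distribs right_diff_distrib left_diff_distrib ac_simps) simp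
    then show ?thesis by simp
  qed
  finally have "a * (2 * (c * s\<^sup>2)) = a * (x - \<i> * y)" by (simp only: ac_simps)
  then have css: "2 * (c * s\<^sup>2) = x - \<i> * y" using a by simp
  have 1: "c * (s\<^sup>2 - 1) = x"
  proof -
    have "2 * (c * (s\<^sup>2 - 1)) = 2 * (c * s\<^sup>2) - 2 * c" by (simp add: right_diff_distrib)
    also have "\<dots> = 2 * x" unfolding css by (simp add: c_def a_def)
    finally show ?thesis by simp
  qed
  have 2: "c * (\<i> * (s\<^sup>2 + 1)) = y"
  proof -
    have "2 * (c * (\<i> * (s\<^sup>2 + 1))) = \<i> * (2 * (c * s\<^sup>2) + 2 * c)" by (simp add: distrib_left mult.left_commute)
    also have "\<dots> = \<i> * (- 2 * (\<i> * y))" unfolding css by (simp add: c_def a_def)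
    also have "\<dots> = 2 * y" by simp
    finally show ?thesis by simp
  qed
  have 3: "c * (2 * s) = z" 
  proof -
    have "c * (2 * s) = 2 * (c * s)" by (simp only: ac_simps)
    then show ?thesis by (simp add: cs)
  qed
  have "v = c *s conic_point s"
    by (simp only: vec3_eq_iff vector_smult_component conic_point_nth xyz 1 2 3 simp_thms)
  moreover have "c \<noteq> 0" using a by (simp add: c_def)
  ultimately show ?thesis by blast
qed

lemma isotropic_at_infinity:
  assumes "vdot v v = 0" "v $ 1 + \<i> * v $ 2 = 0"
  shows "v = v $ 1 *s vector [1, \<i>, 0]"
proof -
  have "\<i> * (v $ 1 + \<i> * v $ 2) = \<i> * v $ 1 - v $ 2" by (simp add: distrib_left)
  then have 1: "v $ 2 = \<i> * v $ 1" using assms(2) by simp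
  have "v $ 1 * v $ 1 + (\<i> * \<i>) * (v $ 1 * v $ 1) + v $ 3 * v $ 3 = 0"
    using assms(1) unfolding vdot_3 1 by (simp only: ac_simps)
  then have "v $ 3 = 0" by simp
  then show ?thesis using 1 by (simp add: vec3_eq_iff)
qed

definition homog_int :: "int \<Rightarrow> (complex^'n \<Rightarrow> complex) \<Rightarrow> bool" where
  "homog_int d f \<longleftrightarrow> (if d < 0 then f = (\<lambda>_. 0) else homog (nat d) f)"

lemma homog_int_add: "homog_int d f \<Longrightarrow> homog_int d g \<Longrightarrow> homog_int d (\<lambda>v. f v + g v)"
  by (auto simp: homog_int_def intro: homog.add split: if_splits)

lemma homog_int_diff: "homog_int d f \<Longrightarrow> homog_int d g \<Longrightarrow> homog_int d (\<lambda>v. f v - g v)"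
  by (auto simp: homog_int_def intro: homog_diff split: if_splits)

lemma homog_int_mult: "homog_int d f \<Longrightarrow> homog_int e g \<Longrightarrow> k = d + e \<Longrightarrow> homog_int k (\<lambda>v. f v * g v)"
  using homog.mult[of "nat d" f "nat e" g]
  by (auto simp: homog_int_def nat_add_distrib intro: homog_zero split: if_splits)

lemma homog_int_of_nat: "homog_int (int d) f \<longleftrightarrow> homog d f"
  by (simp add: homog_int_def)

lemma homog_intI: "homog d f \<Longrightarrow> k = int d \<Longrightarrow> homog_int k f"
  by (simp add: homog_int_def)

text \<open>Division by the equation of the conic leaves a remainder of degree at most one in the
  third coordinate. Degrees are integers here because the quotient and the second part of the
  remainder are zero when their degree is negative.\<close>

lemma conic_division:
  assumes "homog d f"
  shows "\<exists>g f0 f1. homog_int (int d - 2) g \<and> homog_int (int d) f0 \<and> homog_int (int d - 1) f1 \<and>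
     (\<forall>v. f v = vdot v v * g v + f0 v + v $ 3 * f1 v) \<and>
     (\<forall>v w. v $ 1 = w $ 1 \<and> v $ 2 = w $ 2 \<longrightarrow> f0 v = f0 w \<and> f1 v = f1 w)"
  using assms
proof induction
  case (const c)
  show ?case
    by (rule exI[of _ "\<lambda>_. 0"], rule exI[of _ "\<lambda>_. c"], rule exI[of _ "\<lambda>_. 0"])
       (auto simp: homog_int_def intro: homog.const)
next
  case (coord i)
  show ?case
  proof (cases "i = 3")
    case True
    then show ?thesis
      by (intro exI[of _ "\<lambda>_. 0"] exI[of _ "\<lambda>_. 1"]) (auto simp: homog_int_def intro: homog.const homog_zero)
  next
    case False
    then have "i = 1 \<or> i = 2" using exhaust_3 by blast
    then show ?thesis
      by (intro exI[of _ "\<lambda>_. 0"] exI[of _ "\<lambda>v. v $ i"]) (auto simp: homog_int_def intro: homog.const homog_zero homog.coord[simplified])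
  qed
next
  case (add d f f')
  then obtain g f0 f1 g' f0' f1' where *: 
    "homog_int (int d - 2) g" "homog_int (int d) f0" "homog_int (int d - 1) f1"
    "\<forall>v. f v = vdot v v * g v + f0 v + v $ 3 * f1 v" "\<forall>v w. v $ 1 = w $ 1 \<and> v $ 2 = w $ 2 \<longrightarrow> f0 v = f0 w \<and> f1 v = f1 w"
    "homog_int (int d - 2) g'" "homog_int (int d) f0'" "homog_int (int d - 1) f1'"
    "\<forall>v. f' v = vdot v v * g' v + f0' v + v $ 3 * f1' v" "\<forall>v w. v $ 1 = w $ 1 \<and> v $ 2 = w $ 2 \<longrightarrow> f0' v = f0' w \<and> f1' v = f1' w"
    by blast
  show ?case
  proof (intro exI conjI)
    show "homog_int (int d - 2) (\<lambda>v. g v + g' v)" "homog_int (int d) (\<lambda>v. f0 v + f0' v)" "homog_int (int d - 1) (\<lambda>v. f1 v + f1' v)"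
      using *(1-3,6-8) by (auto intro: homog_int_add)
    show "\<forall>v. f v + f' v = vdot v v * (g v + g' v) + (f0 v + f0' v) + v $ 3 * (f1 v + f1' v)"
      by (simp only: *(4)[rule_format] *(9)[rule_format]) (simp add: algebra_simps)
    show "\<forall>v w. v $ 1 = w $ 1 \<and> v $ 2 = w $ 2 \<longrightarrow> f0 v + f0' v = f0 w + f0' w \<and> f1 v + f1' v = f1 w + f1' w"
      using *(5,10) by metis
  qed
next
  case (mult d f e f')
  then obtain g f0 f1 g' f0' f1' where *: 
    "homog_int (int d - 2) g" "homog_int (int d) f0" "homog_int (int d - 1) f1"
    "\<forall>v. f v = vdot v v * g v + f0 v + v $ 3 * f1 v" "\<forall>v w. v $ 1 = w $ 1 \<and> v $ 2 = w $ 2 \<longrightarrow> f0 v = f0 w \<and> f1 v = f1 w"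
    "homog_int (int e - 2) g'" "homog_int (int e) f0'" "homog_int (int e - 1) f1'"
    "\<forall>v. f' v = vdot v v * g' v + f0' v + v $ 3 * f1' v" "\<forall>v w. v $ 1 = w $ 1 \<and> v $ 2 = w $ 2 \<longrightarrow> f0' v = f0' w \<and> f1' v = f1' w"
    by blast
  have coord: "homog_int 1 (\<lambda>v::complex^3. v $ i)" for i by (rule homog_intI[OF homog.coord]) simp
  have sq: "homog_int 2 (\<lambda>v::complex^3. v $ 1 * v $ 1 + v $ 2 * v $ 2)"
    by (intro homog_int_add homog_int_mult[OF coord coord]) auto
  have hf': "homog_int (int e) f'" using mult.hyps by (simp add: homog_int_of_nat)
  have deg: "int (d + e) = int d + int e" by simp
  show ?case
  proof (intro exI conjI)
    have A: "homog_int (int d) (\<lambda>v. f0 v + v $ 3 * f1 v)"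
      by (rule homog_int_add[OF *(2) homog_int_mult[OF coord *(3)]]) simp
    have B: "homog_int (int (d + e) - 2) (\<lambda>v. f1 v * f1' v)" by (rule homog_int_mult[OF *(3) *(8)]) simp
    have C: "homog_int (int (d + e) - 2) (\<lambda>v. g v * f' v)" by (rule homog_int_mult[OF *(1) hf']) simp
    have D: "homog_int (int (d + e) - 2) (\<lambda>v. (f0 v + v $ 3 * f1 v) * g' v)" by (rule homog_int_mult[OF A *(6)]) simp
    show "homog_int (int (d + e) - 2) (\<lambda>v. (g v * f' v + (f0 v + v $ 3 * f1 v) * g' v) + f1 v * f1' v)"
      by (rule homog_int_add[OF homog_int_add[OF C D] B])
    have E: "homog_int (int (d + e)) (\<lambda>v. (v $ 1 * v $ 1 + v $ 2 * v $ 2) * (f1 v * f1' v))" 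
      by (rule homog_int_mult[OF sq B]) simp
    have F: "homog_int (int (d + e)) (\<lambda>v. f0 v * f0' v)" by (rule homog_int_mult[OF *(2) *(7)]) simp
    show "homog_int (int (d + e)) (\<lambda>v. f0 v * f0' v - (v $ 1 * v $ 1 + v $ 2 * v $ 2) * (f1 v * f1' v))"
      by (rule homog_int_diff[OF F E])
    have G: "homog_int (int (d + e) - 1) (\<lambda>v. f0 v * f1' v)" by (rule homog_int_mult[OF *(2) *(8)]) simp
    have H: "homog_int (int (d + e) - 1) (\<lambda>v. f1 v * f0' v)" by (rule homog_int_mult[OF *(3) *(7)]) simp
    show "homog_int (int (d + e) - 1) (\<lambda>v. f0 v * f1' v + f1 v * f0' v)"
      by (rule homog_int_add[OF G H])
    show "\<forall>v. f v * f' v = vdot v v * ((g v * f' v + (f0 v + v $ 3 * f1 v) * g' v) + f1 v * f1' v) +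
        (f0 v * f0' v - (v $ 1 * v $ 1 + v $ 2 * v $ 2) * (f1 v * f1' v)) + v $ 3 * (f0 v * f1' v + f1 v * f0' v)"
    proof
      fix v
      have z: "v $ 3 * v $ 3 = vdot v v - (v $ 1 * v $ 1 + v $ 2 * v $ 2)" by (simp add: vdot_3)
      show "f v * f' v = vdot v v * ((g v * f' v + (f0 v + v $ 3 * f1 v) * g' v) + f1 v * f1' v) +
        (f0 v * f0' v - (v $ 1 * v $ 1 + v $ 2 * v $ 2) * (f1 v * f1' v)) + v $ 3 * (f0 v * f1' v + f1 v * f0' v)"
      proof -
        have "f v * f' v = vdot v v * (g v * f' v) + (f0 v + v $ 3 * f1 v) * f' v"
          unfolding *(4)[rule_format, of v] by (simp only: distrib_right mult.assoc add.assoc)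
        also have "(f0 v + v $ 3 * f1 v) * f' v = (f0 v + v $ 3 * f1 v) * (vdot v v * g' v + f0' v + v $ 3 * f1' v)"
          by (simp only: *(9)[rule_format, of v])
        also have "\<dots> = vdot v v * ((f0 v + v $ 3 * f1 v) * g' v) + f0 v * f0' v + v $ 3 * (f0 v * f1' v + f1 v * f0' v)
            + (v $ 3 * v $ 3) * (f1 v * f1' v)"
          by (simp add: algebra_simps)
        finally show ?thesis unfolding z by (simp add: algebra_simps)
      qed
    qed
    show "\<forall>v w. v $ 1 = w $ 1 \<and> v $ 2 = w $ 2 \<longrightarrow> f0 v * f0' v - (v $ 1 * v $ 1 + v $ 2 * v $ 2) * (f1 v * f1' v) =
         f0 w * f0' w - (w $ 1 * w $ 1 + w $ 2 * w $ 2) * (f1 w * f1' w) \<and> f0 v * f1' v + f1 v * f0' v = f0 w * f1' w + f1 w * f0' w"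
      using *(5,10) by metis
  qed
qed

lemma homog_vanishing_on_conic:
  assumes f: "homog d f" and z: "\<And>s. f (conic_point s) = 0"
  shows "\<exists>g. homog (d - 2) g \<and> (\<forall>v. f v = vdot v v * g v)"
proof -
  obtain g f0 f1 where *: 
    "homog_int (int d - 2) g" "homog_int (int d) f0" "homog_int (int d - 1) f1"
    "\<And>v. f v = vdot v v * g v + f0 v + v $ 3 * f1 v" "\<And>v w. v $ 1 = w $ 1 \<Longrightarrow> v $ 2 = w $ 2 \<Longrightarrow> f0 v = f0 w \<and> f1 v = f1 w"
    using conic_division[OF f] by metis
  have fz: "f v = 0" if "vdot v v = 0" "v $ 1 + \<i> * v $ 2 \<noteq> 0" for v
    using isotropic_cases[OF that] z by (auto simp: homog_smult[OF f])
  have key: "f0 v = 0 \<and> (v $ 1 * v $ 1 + v $ 2 * v $ 2) * f1 v = 0" if v: "v $ 1 + \<i> * v $ 2 \<noteq> 0" for v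
  proof -
    define r where "r = csqrt (- (v $ 1 * v $ 1 + v $ 2 * v $ 2))"
    have r: "r * r = - (v $ 1 * v $ 1 + v $ 2 * v $ 2)"
      using power2_csqrt[of "- (v $ 1 * v $ 1 + v $ 2 * v $ 2)"] by (simp add: r_def power2_eq_square)
    define p m :: "complex^3" where "p = vector [v $ 1, v $ 2, r]" and "m = vector [v $ 1, v $ 2, - r]"
    have pm: "p $ 1 = v $ 1" "p $ 2 = v $ 2" "p $ 3 = r" "m $ 1 = v $ 1" "m $ 2 = v $ 2" "m $ 3 = - r"
      by (simp_all add: p_def m_def)
    have iso: "vdot p p = 0" "vdot m m = 0" using r by (simp_all add: vdot_3 pm)
    have "f p = 0" "f m = 0" using fz[OF iso(1)] fz[OF iso(2)] v by (simp_all add: pm)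
    then have "f0 v + r * f1 v = 0" "f0 v - r * f1 v = 0"
      using *(4)[of p] *(4)[of m] *(5)[of p v] *(5)[of m v] iso \<open>f p = 0\<close> \<open>f m = 0\<close> by (simp_all add: pm)
    moreover have "2 * f0 v = (f0 v + r * f1 v) + (f0 v - r * f1 v)" by simp
    ultimately have "f0 v = 0" by simp
    moreover have "r * f1 v = 0" using \<open>f0 v + r * f1 v = 0\<close> \<open>f0 v = 0\<close> by simp
    moreover have "(v $ 1 * v $ 1 + v $ 2 * v $ 2) * f1 v = - (r * (r * f1 v))"
      by (simp only: mult.assoc[symmetric] r) (simp add: algebra_simps)
    ultimately show ?thesis by simp
  qed
  have hl: "homog 1 (\<lambda>v::complex^3. v $ 1 + \<i> * v $ 2)" by (intro homog.add homog_scaleC homog.coord)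
  have "homog 2 (\<lambda>v::complex^3. v $ i * v $ i)" for i
    using homog.mult[OF homog.coord[of i] homog.coord[of i]] by (simp add: numeral_2_eq_2)
  then have hs: "homog 2 (\<lambda>v::complex^3. v $ 1 * v $ 1 + v $ 2 * v $ 2)" by (intro homog.add)
  define u :: "complex^3" where "u = vector [1, 0, 0]"
  have u: "u $ 1 = 1" "u $ 2 = 0" by (simp_all add: u_def)
  have f0: "f0 v = 0" for v
  proof (rule homog_domain[OF _ hl])
    show "homog d f0" using *(2) by (simp add: homog_int_of_nat)
    show "f0 v * (v $ 1 + \<i> * v $ 2) = 0" for v using key[of v] by auto
    show "u $ 1 + \<i> * u $ 2 \<noteq> 0" by (simp add: u)
  qed
  have f1: "f1 v = 0" for v
  proof (cases "d = 0")
    case False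
    show ?thesis
    proof (rule homog_domain[OF _ homog.mult[OF hl hs]])
      show "homog (d - 1) f1" using *(3) False by (simp add: homog_int_def nat_diff_distrib split: if_splits)
      show "f1 v * ((v $ 1 + \<i> * v $ 2) * (v $ 1 * v $ 1 + v $ 2 * v $ 2)) = 0" for v using key[of v] by auto
      show "(u $ 1 + \<i> * u $ 2) * (u $ 1 * u $ 1 + u $ 2 * u $ 2) \<noteq> 0" by (simp add: u)
    qed
  qed (use *(3) in \<open>simp add: homog_int_def\<close>)
  have "homog (d - 2) g"
    using *(1) by (cases "d \<ge> 2") (auto simp: homog_int_def nat_diff_distrib intro: homog_zero split: if_splits)
  then show ?thesis using *(4) f0 f1 by auto
qed

lemma homog_infinite_zeros_on_conic:
  assumes "homog d f" "infinite {s. f (conic_point s) = 0}"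
  shows "f (conic_point s) = 0"
proof -
  have "\<exists>p. \<forall>s. poly p s = f (conic_point s)"
    using assms(1)
  proof induction
    case (const c) then show ?case by (intro exI[of _ "[:c:]"]) simp
  next
    case (coord i)
    consider "i = 1" | "i = 2" | "i = 3" using exhaust_3 by blast
    then show ?case
    proof cases
      case 1 then show ?thesis by (intro exI[of _ "[:-1, 0, 1:]"]) (simp add: power2_eq_square)
    next
      case 2 then show ?thesis by (intro exI[of _ "[:\<i>, 0, \<i>:]"]) (simp add: power2_eq_square algebra_simps)
    next
      case 3 then show ?thesis by (intro exI[of _ "[:0, 2:]"]) simp
    qed
  next
    case (add d f g) then show ?case by (metis poly_add)
  next
    case (mult d f e g) then show ?case by (metis poly_mult)
  qed
  then obtain p where p: "\<forall>s. poly p s = f (conic_point s)" by blast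
  then have "infinite {s. poly p s = 0}" using assms(2) by simp
  then have "p = 0" using poly_roots_finite by blast
  then show ?thesis using p by (metis poly_0)
qed

section \<open>A quartic projected from one of its nodes\<close>

text \<open>Projection from a node. In suitable coordinates the quartic is \<open>q2 t\<^sup>2 + 2
  q3 t + q4\<close>, where \<open>q2\<close> is the tangent cone at the node; the projection is a
  double cover of the plane, branched along the sextic \<open>q3\<^sup>2 - q2 q4\<close>. The other
  singular points lie over double points of the sextic.\<close>

locale projected_quartic =
  fixes q3 q4 :: "complex^3 \<Rightarrow> complex"
  assumes hq3: "homog 3 q3" and hq4: "homog 4 q4"
begin

definition q2 :: "complex^3 \<Rightarrow> complex" where "q2 v = vdot v v"

definition quartic :: "complex^3 \<Rightarrow> complex \<Rightarrow> complex" where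
  "quartic v t = q2 v * t\<^sup>2 + 2 * q3 v * t + q4 v"

definition branch :: "complex^3 \<Rightarrow> complex" where
  "branch v = q3 v * q3 v - q2 v * q4 v"

definition sing :: "complex^3 \<Rightarrow> complex \<Rightarrow> bool" where
  "sing v t \<longleftrightarrow> quartic v t = 0 \<and> q2 v * t + q3 v = 0 \<and>
     (\<forall>w. t\<^sup>2 * D1 q2 v w + 2 * t * D1 q3 v w + D1 q4 v w = 0)"

definition double_at :: "(complex^3 \<Rightarrow> complex) \<Rightarrow> complex^3 \<Rightarrow> bool" where
  "double_at f v \<longleftrightarrow> f v = 0 \<and> (\<forall>w. D1 f v w = 0)"

lemma hq2: "homog 2 q2"
  using homog_vdot_self by (simp add: q2_def[abs_def])

lemma along_q2: "along q2 b w = [:vdot b b, 2 * vdot b w, vdot w w:]"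
  using along_vdot_self by (simp add: q2_def[abs_def])

lemma D1_q2: "D1 q2 b w = 2 * vdot b w"
  by (simp add: along_q2)

lemma homog_branch: "homog 6 branch"
  unfolding branch_def[abs_def]
  using homog_diff[OF homog.mult[OF hq3 hq3], of "\<lambda>v. q2 v * q4 v"] homog.mult[OF hq2 hq4] by simp

lemma along_branch: "along branch b w = along q3 b w * along q3 b w - along q2 b w * along q4 b w"
  unfolding branch_def[abs_def]
  by (simp add: along_diff[OF homog.mult[OF hq3 hq3] homog.mult[OF hq2 hq4]] along_mult[OF hq3 hq3] along_mult[OF hq2 hq4])

lemma D1_branch: "D1 branch b w = 2 * q3 b * D1 q3 b w - q2 b * D1 q4 b w - D1 q2 b w * q4 b"
  by (simp add: along_branch coeff_mult coeff_along_0[OF hq2] coeff_along_0[OF hq3] coeff_along_0[OF hq4])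

lemma double_at_iff_dvd:
  assumes "homog d f"
  shows "double_at f v \<longleftrightarrow> (\<forall>w. [:0, 1:]\<^sup>2 dvd along f v w)"
proof -
  have "[:0, 1:]\<^sup>2 dvd p \<longleftrightarrow> coeff p 0 = 0 \<and> coeff p (Suc 0) = 0" for p :: "complex poly"
  proof -
    have "[:0, 1:]\<^sup>2 dvd p \<longleftrightarrow> monom 1 2 dvd p" by (simp add: monom_altdef)
    then show ?thesis by (auto simp: monom_1_dvd_iff' less_Suc_eq numeral_2_eq_2)
  qed
  then show ?thesis by (auto simp: double_at_def coeff_along_0[OF assms])
qed

lemma sing_scale:
  assumes "sing v t" "c \<noteq> 0" shows "sing (c *s v) (c * t)"
proof -
  have D: "D1 f (c *s v) w = c ^ (d - 1) * D1 f v w" if "homog d f" "d \<ge> 1" for d f w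
  proof -
    have "along f (c *s v) w = smult (c ^ d) (pcompose (along f v w) [:0, inverse c:])"
    proof (rule alongI)
      fix s
      have "poly (smult (c ^ d) (pcompose (along f v w) [:0, inverse c:])) s = c ^ d * f (v + (s * inverse c) *s w)"
        by (simp add: poly_pcompose poly_along[OF that(1)] mult.commute)
      also have "\<dots> = f (c *s (v + (s * inverse c) *s w))" by (simp only: homog_smult[OF that(1)])
      also have "c *s (v + (s * inverse c) *s w) = c *s v + s *s w"
        using assms(2) by (simp add: vector_add_ldistrib vector_smult_assoc mult.left_commute)
      finally show "poly (smult (c ^ d) (pcompose (along f v w) [:0, inverse c:])) s = f (c *s v + s *s w)" .
    qed
    then have "D1 f (c *s v) w = c ^ d * (inverse c * D1 f v w)" by (simp add: coeff_pcompose_linear)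
    then show ?thesis using assms(2) that(2) by (cases d) auto
  qed
  have "quartic (c *s v) (c * t) = c ^ 4 * quartic v t"
    unfolding quartic_def homog_smult[OF hq2] homog_smult[OF hq3] homog_smult[OF hq4] by algebra
  moreover have "q2 (c *s v) * (c * t) + q3 (c *s v) = c ^ 3 * (q2 v * t + q3 v)"
    unfolding homog_smult[OF hq2] homog_smult[OF hq3] by algebra
  moreover have "(c * t)\<^sup>2 * D1 q2 (c *s v) w + 2 * (c * t) * D1 q3 (c *s v) w + D1 q4 (c *s v) w =
      c ^ 3 * (t\<^sup>2 * D1 q2 v w + 2 * t * D1 q3 v w + D1 q4 v w)" for w
    unfolding D[OF hq2, simplified] D[OF hq3, simplified] D[OF hq4, simplified] by (simp add: algebra_simps power2_eq_square power3_eq_cube)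
  ultimately show ?thesis using assms(1) by (simp add: sing_def)
qed

lemma sing_double: assumes "sing v t" shows "double_at branch v"
proof -
  have 3: "q3 v = - (q2 v * t)" using assms unfolding sing_def by (simp add: eq_neg_iff_add_eq_0 add.commute)
  then have 4: "q4 v = q2 v * t\<^sup>2" using assms unfolding sing_def quartic_def by (simp add: power2_eq_square algebra_simps)
  have "D1 branch v w = - (q2 v * (t\<^sup>2 * D1 q2 v w + 2 * t * D1 q3 v w + D1 q4 v w))" for w
    unfolding D1_branch 3 4 by algebra
  moreover have "branch v = 0" unfolding branch_def 3 4 by algebra
  ultimately show ?thesis using assms by (simp add: double_at_def sing_def)
qed

lemma sing_unique_off_conic: "sing v t \<Longrightarrow> sing v t' \<Longrightarrow> q2 v \<noteq> 0 \<Longrightarrow> t = t'"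
  unfolding sing_def by (metis add_right_cancel mult_cancel_left)

lemma sing_on_conic: "sing v t \<Longrightarrow> q2 v = 0 \<Longrightarrow> q3 v = 0 \<and> q4 v = 0"
  by (auto simp: sing_def quartic_def)

lemma two_sing_tangent:
  assumes "sing v t" "sing v t'" "t \<noteq> t'"
  shows "q2 v = 0" "D1 q3 v w = - ((t + t') / 2) * D1 q2 v w" "D1 q4 v w = t * t' * D1 q2 v w"
proof -
  show "q2 v = 0" using assms sing_unique_off_conic by blast
  have 1: "t\<^sup>2 * D1 q2 v w + 2 * t * D1 q3 v w + D1 q4 v w = 0" "t'\<^sup>2 * D1 q2 v w + 2 * t' * D1 q3 v w + D1 q4 v w = 0"
    using assms by (auto simp: sing_def)
  have "(t - t') * ((t + t') * D1 q2 v w + 2 * D1 q3 v w) = 0" using 1 by algebra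
  then have 2: "(t + t') * D1 q2 v w + 2 * D1 q3 v w = 0" using assms(3) by simp
  have "D1 q3 v w = ((t + t') * D1 q2 v w + 2 * D1 q3 v w) / 2 - ((t + t') / 2) * D1 q2 v w"
    by (simp add: add_divide_distrib)
  then show "D1 q3 v w = - ((t + t') / 2) * D1 q2 v w" unfolding 2 by simp
  have "D1 q4 v w - t * t' * D1 q2 v w = 0" using 1 2 by algebra
  then show "D1 q4 v w = t * t' * D1 q2 v w" by simp
qed

lemma three_sing_False:
  assumes "sing v t" "sing v t'" "sing v t''" "t \<noteq> t'" "t \<noteq> t''" "t' \<noteq> t''" "v \<noteq> 0"
  shows False
proof -
  have "vdot v w = 0" for w
  proof -
    have "(t + t') / 2 * D1 q2 v w = (t + t'') / 2 * D1 q2 v w"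
      using trans[OF two_sing_tangent(2)[OF assms(1,2,4), of w, symmetric] two_sing_tangent(2)[OF assms(1,3,5), of w]]
      unfolding mult_minus_left neg_equal_iff_equal .
    then have "((t + t') / 2 - (t + t'') / 2) * D1 q2 v w = 0" by (simp only: left_diff_distrib) simp
    moreover have "(t + t') / 2 - (t + t'') / 2 = (t' - t'') / 2" by (simp add: field_simps)
    ultimately have "D1 q2 v w = 0" using assms(6) by simp
    then show ?thesis by (simp add: D1_q2)
  qed
  then show False using vdot_nondegenerate assms(7) by blast
qed

lemma card_sing_le_2: "v \<noteq> 0 \<Longrightarrow> finite {t. sing v t} \<and> card {t. sing v t} \<le> 2"
proof (rule ccontr)
  assume v: "v \<noteq> 0" and *: "\<not> (finite {t. sing v t} \<and> card {t. sing v t} \<le> 2)"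
  then have "\<exists>T. T \<subseteq> {t. sing v t} \<and> card T = 3"
  proof (cases "finite {t. sing v t}")
    case True then show ?thesis using * obtain_subset_with_card_n[of 3 "{t. sing v t}"] by auto
  next
    case False then show ?thesis using infinite_arbitrarily_large[of "{t. sing v t}" 3] by blast
  qed
  then show False using three_sing_False v by (auto simp: card_3_iff)
qed

lemma double_off_conic:
  assumes "double_at branch v" "q2 v \<noteq> 0" shows "sing v (- q3 v / q2 v)"
proof -
  let ?t = "- q3 v / q2 v"
  have t: "q2 v * ?t = - q3 v" using assms(2) by simp
  have b: "q3 v * q3 v = q2 v * q4 v" using assms(1) by (simp add: double_at_def branch_def)
  have "q2 v * quartic v ?t = (q2 v * ?t)\<^sup>2 + 2 * q3 v * (q2 v * ?t) + q2 v * q4 v" unfolding quartic_def by algebra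
  also have "\<dots> = 0" unfolding t b[symmetric] by algebra
  finally have 1: "quartic v ?t = 0" using assms(2) by simp
  have "q2 v * (?t\<^sup>2 * D1 q2 v w + 2 * ?t * D1 q3 v w + D1 q4 v w) = 0" for w
  proof -
    have d: "2 * q3 v * D1 q3 v w - q2 v * D1 q4 v w - D1 q2 v w * q4 v = 0"
      using assms(1) by (simp add: double_at_def D1_branch[symmetric])
    have "q2 v * (q2 v * (?t\<^sup>2 * D1 q2 v w + 2 * ?t * D1 q3 v w + D1 q4 v w)) =
       (q2 v * ?t)\<^sup>2 * D1 q2 v w + q2 v * (2 * (q2 v * ?t) * D1 q3 v w + q2 v * D1 q4 v w)" by algebra
    also have "\<dots> = (q3 v * q3 v) * D1 q2 v w - q2 v * (2 * q3 v * D1 q3 v w - q2 v * D1 q4 v w)" unfolding t by algebra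
    also have "\<dots> = - q2 v * (2 * q3 v * D1 q3 v w - q2 v * D1 q4 v w - D1 q2 v w * q4 v)" unfolding b by algebra
    finally show ?thesis using assms(2) unfolding d by simp
  qed
  then show ?thesis using 1 t assms(2) by (auto simp: sing_def)
qed

lemma double_on_conic:
  assumes "double_at branch v" "q2 v = 0" "v \<noteq> 0" shows "q3 v = 0" "q4 v = 0"
proof -
  show 3: "q3 v = 0" using assms by (simp add: double_at_def branch_def)
  obtain w where "vdot v w \<noteq> 0" using vdot_nondegenerate assms(3) by blast
  then show "q4 v = 0" using assms(1,2) 3 by (auto simp: double_at_def D1_branch D1_q2)
qed

end

text \<open>The remaining fourteen nodes, represented by vectors that are normalised by one linear
  form \<open>\<theta>\<close>, so that different nodes are different pairs in
  \<open>N\<close>.\<close>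

locale nodes15 = projected_quartic +
  fixes N :: "((complex^3) \<times> complex) set" and \<theta> :: "complex^3"
  assumes finN: "finite N" and cardN: "card N = 14"
    and nodeN: "(b, t) \<in> N \<Longrightarrow> sing b t \<and> vdot \<theta> b = 1"
    and quadN: "(b, t) \<in> N \<Longrightarrow> \<exists>w. coeff (along branch b w) 2 \<noteq> 0"
    and completeN: "sing b t \<Longrightarrow> b \<noteq> 0 \<Longrightarrow> \<exists>c b0 t0. c \<noteq> 0 \<and> (b0, t0) \<in> N \<and> b = c *s b0 \<and> t = c * t0"
begin

lemma nodeN_nonzero: "(b, t) \<in> N \<Longrightarrow> b \<noteq> 0"
  using nodeN[of b t] by (auto simp: vdot_simps)

lemma proportional_nodes: "(b, t) \<in> N \<Longrightarrow> (b', t') \<in> N \<Longrightarrow> b' = c *s b \<Longrightarrow> c = 1 \<and> b' = b"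
  using nodeN[of b t] nodeN[of b' t'] by (auto simp: vdot_simps)

lemma not_all_common:
  "finite {s. q3 (conic_point s) = 0 \<and> q4 (conic_point s) = 0}"
proof (rule ccontr)
  assume inf: "infinite {s. q3 (conic_point s) = 0 \<and> q4 (conic_point s) = 0}"
  have 3: "q3 (conic_point s) = 0" and 4: "q4 (conic_point s) = 0" for s
  proof -
    have "infinite {s. q3 (conic_point s) = 0}" "infinite {s. q4 (conic_point s) = 0}"
      by (rule infinite_super[OF _ inf], blast)+
    then show "q3 (conic_point s) = 0" "q4 (conic_point s) = 0"
      using homog_infinite_zeros_on_conic[OF hq3] homog_infinite_zeros_on_conic[OF hq4] by blast+
  qed
  obtain n where n: "homog 1 n" "\<And>v. q3 v = vdot v v * n v" using homog_vanishing_on_conic[OF hq3 3] by auto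
  obtain k where k: "homog 2 k" "\<And>v. q4 v = vdot v v * k v" using homog_vanishing_on_conic[OF hq4 4] by auto
  define t where "t s = - n (conic_point s) + csqrt ((n (conic_point s))\<^sup>2 - k (conic_point s))" for s
  have t: "(t s)\<^sup>2 + 2 * t s * n (conic_point s) + k (conic_point s) = 0" for s
  proof -
    have "(t s)\<^sup>2 + 2 * t s * n (conic_point s) + k (conic_point s) =
       (t s + n (conic_point s))\<^sup>2 - ((n (conic_point s))\<^sup>2 - k (conic_point s))" by algebra
    also have "t s + n (conic_point s) = csqrt ((n (conic_point s))\<^sup>2 - k (conic_point s))" by (simp add: t_def)
    finally show ?thesis by (simp only: power2_csqrt) simp
  qed
  have q2z: "q2 (conic_point s) = 0" for s by (simp add: q2_def conic_point_isotropic)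
  have sing: "sing (conic_point s) (t s)" for s
  proof -
    have e3: "q3 = (\<lambda>v. q2 v * n v)" and e4: "q4 = (\<lambda>v. q2 v * k v)" using n k by (auto simp: q2_def)
    have "D1 q3 (conic_point s) w = D1 q2 (conic_point s) w * n (conic_point s)"
         "D1 q4 (conic_point s) w = D1 q2 (conic_point s) w * k (conic_point s)" for w
      unfolding e3 e4 by (simp_all only: D1_mult[OF hq2 n(1)] D1_mult[OF hq2 k(1)] q2z) simp_all
    then have "(t s)\<^sup>2 * D1 q2 (conic_point s) w + 2 * t s * D1 q3 (conic_point s) w + D1 q4 (conic_point s) w =
       D1 q2 (conic_point s) w * ((t s)\<^sup>2 + 2 * t s * n (conic_point s) + k (conic_point s))" for w
      by (simp add: algebra_simps)
    then show ?thesis using 3[of s] 4[of s] q2z[of s] t by (simp add: sing_def quartic_def)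
  qed
  have "\<exists>b0. b0 \<in> fst ` N \<and> (\<exists>c. c \<noteq> 0 \<and> conic_point s = c *s b0)" for s
  proof -
    obtain c b0 t0 where c: "c \<noteq> 0" "(b0, t0) \<in> N" "conic_point s = c *s b0"
      using completeN[OF sing conic_point_nonzero, of s] by blast
    then have "b0 \<in> fst ` N" by (metis fst_conv imageI)
    with c show ?thesis by blast
  qed
  then have "\<exists>g. \<forall>s. g s \<in> fst ` N \<and> (\<exists>c. c \<noteq> 0 \<and> conic_point s = c *s g s)" by (intro choice allI)
  then obtain g where g: "\<And>s. g s \<in> fst ` N" "\<And>s. \<exists>c. c \<noteq> 0 \<and> conic_point s = c *s g s" by blast
  have "inj g"
  proof (rule injI)
    fix s s' assume "g s = g s'"
    obtain c where c1: "c \<noteq> 0" "conic_point s = c *s g s" using g(2) by blast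
    obtain c' where c2: "c' \<noteq> 0" "conic_point s' = c' *s g s'" using g(2) by blast
    note c = c1 c2[folded \<open>g s = g s'\<close>]
    then have "conic_point s = (c / c') *s conic_point s'" by (simp add: vector_smult_assoc)
    then show "s = s'" by (rule conic_point_inj)
  qed
  moreover have "finite (range g)" using g finN by (auto intro: finite_subset[of _ "fst ` N"])
  ultimately show False using finite_imageD infinite_UNIV_char_0 by blast
qed

text \<open>Off the conic a double point of the branch curve is the image of a node; on the conic it
  is a common zero of \<open>q3\<close> and \<open>q4\<close>.\<close>

lemma finitely_many_double:
  "\<exists>S. finite S \<and> (\<forall>v. v \<noteq> 0 \<and> double_at branch v \<longrightarrow> (\<exists>s\<in>S. \<exists>c. c \<noteq> 0 \<and> v = c *s s))"
proof (intro exI conjI allI impI)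
  let ?S = "fst ` N \<union> conic_point ` {s. q3 (conic_point s) = 0 \<and> q4 (conic_point s) = 0} \<union> {vector [1, \<i>, 0]}"
  show "finite ?S" using finN not_all_common by auto
  fix v assume v: "v \<noteq> 0 \<and> double_at branch v"
  show "\<exists>s\<in>?S. \<exists>c. c \<noteq> 0 \<and> v = c *s s"
  proof (cases "q2 v = 0")
    case False
    then obtain c b0 t0 where "c \<noteq> 0" "(b0, t0) \<in> N" "v = c *s b0" using double_off_conic[of v] completeN v by blast
    then show ?thesis by (intro bexI[of _ b0]) (auto intro!: rev_image_eqI)
  next
    case True
    then have iso: "vdot v v = 0" by (simp add: q2_def)
    show ?thesis
    proof (cases "v $ 1 + \<i> * v $ 2 = 0")
      case True
      have *: "v = v $ 1 *s vector [1, \<i>, 0]" by (rule isotropic_at_infinity[OF iso True])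
      moreover have "v $ 1 \<noteq> 0" using v * by auto
      ultimately show ?thesis by blast
    next
      case False
      then obtain c s where cs: "c \<noteq> 0" "v = c *s conic_point s" using isotropic_cases[OF iso] by blast
      have "q3 v = 0" "q4 v = 0" using double_on_conic True v by auto
      then have "q3 (conic_point s) = 0" "q4 (conic_point s) = 0" using cs by (auto simp: homog_smult[OF hq3] homog_smult[OF hq4])
      then show ?thesis using cs by blast
    qed
  qed
qed

lemma double_family_finite:
  fixes f :: "complex \<Rightarrow> complex^3"
  assumes "\<And>x. x \<in> X \<Longrightarrow> f x \<noteq> 0 \<and> double_at branch (f x)"
    and "\<And>x y c. x \<in> X \<Longrightarrow> y \<in> X \<Longrightarrow> f x = c *s f y \<Longrightarrow> x = y"
  shows "finite X"
proof -
  obtain S where S: "finite S" "\<And>v. v \<noteq> 0 \<Longrightarrow> double_at branch v \<Longrightarrow> \<exists>s\<in>S. \<exists>c. c \<noteq> 0 \<and> v = c *s s"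
    using finitely_many_double by blast
  then have "\<forall>x\<in>X. \<exists>s. s \<in> S \<and> (\<exists>c. c \<noteq> 0 \<and> f x = c *s s)" using assms(1) by blast
  then have "\<exists>g. \<forall>x\<in>X. g x \<in> S \<and> (\<exists>c. c \<noteq> 0 \<and> f x = c *s g x)" by (rule bchoice)
  then obtain g where g: "\<And>x. x \<in> X \<Longrightarrow> g x \<in> S" "\<And>x. x \<in> X \<Longrightarrow> \<exists>c. c \<noteq> 0 \<and> f x = c *s g x" by blast
  have "inj_on g X"
  proof (rule inj_onI)
    fix x y assume xy: "x \<in> X" "y \<in> X" "g x = g y"
    obtain c where c1: "c \<noteq> 0" "f x = c *s g x" using g(2) xy by blast
    obtain c' where c2: "c' \<noteq> 0" "f y = c' *s g y" using g(2) xy by blast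
    note c = c1 c2[folded xy(3)]
    then have "f x = (c / c') *s f y" by (simp add: vector_smult_assoc)
    then show "x = y" using assms(2) xy by blast
  qed
  moreover have "finite (g ` X)" using g S by (auto intro: finite_subset)
  ultimately show ?thesis by (rule finite_imageD[rotated])
qed

end

section \<open>Every node lies over a line of the branch sextic\<close>

definition vcross :: "complex^3 \<Rightarrow> complex^3 \<Rightarrow> complex^3" where
  "vcross a b = vector [a $ 2 * b $ 3 - a $ 3 * b $ 2, a $ 3 * b $ 1 - a $ 1 * b $ 3, a $ 1 * b $ 2 - a $ 2 * b $ 1]"

definition vdet :: "complex^3 \<Rightarrow> complex^3 \<Rightarrow> complex^3 \<Rightarrow> complex" where
  "vdet a b c = vdot a (vcross b c)"

lemma vcross_nth [simp]:
  "vcross a b $ 1 = a $ 2 * b $ 3 - a $ 3 * b $ 2" "vcross a b $ 2 = a $ 3 * b $ 1 - a $ 1 * b $ 3"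
  "vcross a b $ 3 = a $ 1 * b $ 2 - a $ 2 * b $ 1"
  by (simp_all add: vcross_def)

lemma vdet_cramer: "vdet a b c *s v = vdet v b c *s a + vdet a v c *s b + vdet a b v *s c"
  unfolding vec3_eq_iff vdet_def vdot_3 vcross_nth vector_smult_component vector_add_component
  by (simp add: algebra_simps)

lemma vdet_linear:
  "vdet (a + a') b c = vdet a b c + vdet a' b c" "vdet a (b + b') c = vdet a b c + vdet a b' c" "vdet a b (c + c') = vdet a b c + vdet a b c'"
  "vdet (k *s a) b c = k * vdet a b c" "vdet a (k *s b) c = k * vdet a b c" "vdet a b (k *s c) = k * vdet a b c"
  by (simp_all add: vdet_def vdot_3 algebra_simps)

lemma vdet_swap: "vdet b a c = - vdet a b c" "vdet a c b = - vdet a b c" "vdet c b a = - vdet a b c"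
  by (simp_all add: vdet_def vdot_3 algebra_simps)

lemma vdet_repeat: "vdet a a c = 0" "vdet a b a = 0" "vdet a b b = 0"
  by (simp_all add: vdet_def vdot_3 algebra_simps)

lemma vcross_eq_0_imp_proportional:
  assumes "vcross a b = 0" "a \<noteq> 0" shows "\<exists>c. b = c *s a"
proof -
  have "vcross a b $ 1 = 0" "vcross a b $ 2 = 0" "vcross a b $ 3 = 0" using assms(1) by simp_all
  then have E: "a $ 2 * b $ 3 = a $ 3 * b $ 2" "a $ 3 * b $ 1 = a $ 1 * b $ 3" "a $ 1 * b $ 2 = a $ 2 * b $ 1"
    unfolding vcross_nth right_minus_eq .
  have e: "a $ 2 * b $ 3 = b $ 2 * a $ 3" "a $ 3 * b $ 2 = b $ 3 * a $ 2" "a $ 3 * b $ 1 = b $ 3 * a $ 1"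
    "a $ 1 * b $ 3 = b $ 1 * a $ 3" "a $ 1 * b $ 2 = b $ 1 * a $ 2" "a $ 2 * b $ 1 = b $ 2 * a $ 1"
    "a $ 1 * b $ 1 = b $ 1 * a $ 1" "a $ 2 * b $ 2 = b $ 2 * a $ 2" "a $ 3 * b $ 3 = b $ 3 * a $ 3"
    by (rule trans[OF E(1) mult.commute] trans[OF E(1)[symmetric] mult.commute] trans[OF E(2) mult.commute]
      trans[OF E(2)[symmetric] mult.commute] trans[OF E(3) mult.commute] trans[OF E(3)[symmetric] mult.commute] mult.commute)+
  obtain i where i: "a $ i \<noteq> 0" using assms(2) by (auto simp: vec_eq_iff)
  have ab: "a $ i * b $ j = b $ i * a $ j" for j
    using exhaust_3[of i] exhaust_3[of j] by (elim disjE; simp only: e)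
  have "b $ j = b $ i / a $ i * a $ j" for j
  proof -
    have "b $ j = (a $ i * b $ j) / a $ i" using i by simp
    also have "\<dots> = b $ i / a $ i * a $ j" unfolding ab by simp
    finally show ?thesis .
  qed
  then have "b = (b $ i / a $ i) *s a" unfolding vec_eq_iff vector_smult_component by blast
  then show ?thesis ..
qed

lemma bivariate_eqI:
  fixes P Q :: "complex poly poly"
  assumes "\<And>x y. poly (poly P [:y:]) x = poly (poly Q [:y:]) x"
  shows "P = Q"
proof (rule ccontr)
  assume "P \<noteq> Q"
  then have "finite {z. poly (P - Q) z = 0}" by (intro poly_roots_finite) simp
  moreover have "range (\<lambda>y. [:y:]) \<subseteq> {z. poly (P - Q) z = 0}"
    using assms by (auto simp: poly_eq_poly_eq_iff[symmetric] fun_eq_iff)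
  moreover have "infinite (range (\<lambda>y::complex. [:y:]))"
  proof -
    have "inj (\<lambda>y::complex. [:y:])" by (rule injI) simp
    then show ?thesis using finite_imageD[of "\<lambda>y::complex. [:y:]" UNIV] infinite_UNIV_char_0[where ?'a = complex] by blast
  qed
  ultimately show False using finite_subset by blast
qed

definition specialize :: "complex \<Rightarrow> complex poly poly \<Rightarrow> complex poly" where
  "specialize x P = map_poly (\<lambda>p. poly p x) P"

lemma coeff_specialize: "coeff (specialize x P) i = poly (coeff P i) x"
  by (simp add: specialize_def coeff_map_poly)

lemma specialize_mult: "specialize x (P * Q) = specialize x P * specialize x Q"
  by (rule poly_eqI) (simp add: coeff_specialize coeff_mult poly_sum)

lemma pderiv_specialize: "pderiv (specialize x P) = specialize x (pderiv P)"
  by (rule poly_eqI) (simp add: coeff_specialize coeff_pderiv)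

lemma poly_specialize: "poly (specialize x P) y = poly (poly P [:y:]) x"
proof (induction P)
  case (pCons a P)
  have "specialize x (pCons a P) = pCons (poly a x) (specialize x P)"
    by (rule poly_eqI) (simp add: coeff_specialize coeff_pCons split: nat.splits)
  then show ?case using pCons by simp
qed (simp add: specialize_def)

lemma pcompose_shift_coeff:
  fixes p :: "'a::idom poly"
  shows "coeff (pcompose p [:a, 1:]) 0 = poly p a" "coeff (pcompose p [:a, 1:]) (Suc 0) = poly (pderiv p) a"
proof -
  show "coeff (pcompose p [:a, 1:]) 0 = poly p a" for p :: "'a poly"
    by (simp add: poly_0_coeff_0[symmetric] poly_pcompose)
  note this[of "pderiv p"]
  moreover have "coeff (pcompose p [:a, 1:]) (Suc 0) = coeff (pderiv (pcompose p [:a, 1:])) 0" by (simp add: coeff_pderiv)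
  moreover have "pderiv (pcompose p [:a, 1:]) = pcompose (pderiv p) [:a, 1:]" by (simp add: pderiv_pcompose pderiv_pCons)
  ultimately show "coeff (pcompose p [:a, 1:]) (Suc 0) = poly (pderiv p) a" by simp
qed

lemma D1_eq_pderiv:
  assumes "homog d f" "\<And>s. poly p s = f (v + (s - s0) *s w)"
  shows "D1 f v w = poly (pderiv p) s0"
proof -
  have "along f v w = pcompose p [:s0, 1:]" by (rule alongI) (simp add: poly_pcompose assms(2))
  then show ?thesis by (simp only: pcompose_shift_coeff)
qed

lemma shift_power_dvd:
  fixes p :: "complex poly"
  assumes "[:0, 1:] ^ k dvd p" shows "[:- x, 1:] ^ k dvd pcompose p [:- x, 1:]"
proof -
  from assms obtain q where "p = [:0, 1:] ^ k * q" by (auto elim: dvdE)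
  moreover have "pcompose ([:0, 1:] ^ k) [:- x, 1:] = [:- x, 1:] ^ k"
  proof (induction k)
    case 0
    then show ?case by (metis one_pCons pcompose_const power_0)
  next
    case (Suc k)
    have "pcompose [:0, 1:] [:- x, 1:] = [:- x, 1:]" by (simp add: pcompose_pCons)
    then show ?case using Suc by (simp only: power_Suc pcompose_mult)
  qed
  ultimately show ?thesis by (simp add: pcompose_mult)
qed

lemma X_squared_dvd_iff: "[:0, 1:]\<^sup>2 dvd p \<longleftrightarrow> coeff p 0 = 0 \<and> coeff p (Suc 0) = 0" for p :: "complex poly"
proof -
  have "[:0, 1:]\<^sup>2 dvd p \<longleftrightarrow> monom 1 2 dvd p" by (simp add: monom_altdef)
  then show ?thesis by (auto simp: monom_1_dvd_iff' less_Suc_eq numeral_2_eq_2)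
qed

lemma sum_of_orders_le_degree:
  fixes p :: "complex poly"
  assumes "p \<noteq> 0" "finite S" "\<And>x. x \<in> S \<Longrightarrow> [:-x, 1:] ^ k x dvd p"
  shows "sum k S \<le> degree p"
proof -
  have "sum k S \<le> (\<Sum>x\<in>S. order x p)"
    using assms by (intro sum_mono) (auto simp: order_divides)
  also have "\<dots> = (\<Sum>x\<in>{x\<in>S. poly p x = 0}. order x p)"
    using assms by (intro sum.mono_neutral_right) (auto simp: order_root)
  also have "\<dots> \<le> (\<Sum>x | poly p x = 0. order x p)"
    using assms by (intro sum_mono2 poly_roots_finite) auto
  also have "\<dots> \<le> degree p" by (rule sum_order_le_degree[OF assms(1)])
  finally show ?thesis .
qed

lemma finite_affine_zero:
  assumes "A \<noteq> 0 \<or> B \<noteq> 0" shows "finite {k::complex. A + k * B = 0}"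
proof -
  have "finite {k. poly [:A, B:] k = 0}" using assms by (intro poly_roots_finite) auto
  then show ?thesis by simp
qed

lemma card_eq_sum_slices: "finite M \<Longrightarrow> card M = (\<Sum>x\<in>fst ` M. card (M `` {x}))"
proof -
  assume f: "finite M"
  have "M = Sigma (fst ` M) (\<lambda>x. M `` {x})"
  proof (rule set_eqI)
    fix z show "z \<in> M \<longleftrightarrow> z \<in> Sigma (fst ` M) (\<lambda>x. M `` {x})"
      by (cases z) (simp add: mem_Sigma_iff Image_singleton_iff, metis fst_conv imageI)
  qed
  moreover have "card (Sigma (fst ` M) (\<lambda>x. M `` {x})) = (\<Sum>x\<in>fst ` M. card (M `` {x}))"
    using f by (intro card_SigmaI ballI finite_Image finite_imageI)
  ultimately show ?thesis by (rule ssubst[of _ _ "\<lambda>A. card A = _"])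
qed

lemma degree_quartic_disc_le:
  fixes a :: "complex poly"
  assumes "degree a \<le> 6" "degree b \<le> 5" "degree c \<le> 4" "degree d \<le> 3" "degree e \<le> 2"
  shows "degree (quartic_disc a b c d e) \<le> 24"
proof -
  have m: "degree (p * q) \<le> i + j" if "degree p \<le> i" "degree q \<le> j" for p q :: "complex poly" and i j
    using degree_mult_le[of p q] that by linarith
  have num: "degree (numeral n :: complex poly) \<le> 0" for n by simp
  have 1: "degree (quartic_I a b c d e) \<le> 8"
    unfolding quartic_I_def power2_eq_square
    using m[OF m[OF num assms(1)] assms(5)] m[OF m[OF num assms(2)] assms(4)] m[OF assms(3) assms(3)]
    by (intro degree_add_le degree_diff_le) simp_all
  have 2: "degree (quartic_J a b c d e) \<le> 12"
    unfolding quartic_J_def power2_eq_square power3_eq_cube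
    using m[OF m[OF m[OF num assms(1)] assms(3)] assms(5)] m[OF m[OF m[OF num assms(2)] assms(3)] assms(4)]
      m[OF m[OF num assms(1)] m[OF assms(4) assms(4)]] m[OF m[OF num m[OF assms(2) assms(2)]] assms(5)]
      m[OF num m[OF m[OF assms(3) assms(3)] assms(3)]]
    by (intro degree_add_le degree_diff_le) simp_all
  show ?thesis
    unfolding quartic_disc_def power2_eq_square power3_eq_cube
    using m[OF num m[OF m[OF 1 1] 1]] m[OF 2 2] by (intro degree_diff_le) simp_all
qed

text \<open>An affine chart of the plane adapted to the pencil of lines through \<open>b'\<close>:
  \<open>x\<close> parametrises the lines and \<open>y\<close> the points on them. If
  \<open>b'\<close> is the image of a node, the equation of the branch sextic has degree four in
  \<open>y\<close>.\<close>

locale pencil_frame = nodes15 +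
  fixes b' e h :: "complex^3"
  assumes frame: "vdet e b' h \<noteq> 0"
begin

definition pt :: "complex \<Rightarrow> complex \<Rightarrow> complex^3" where
  "pt x y = x *s e + y *s b' + h"

lemma pt_shift: "pt (x + s) (y + s * r) = pt x y + s *s (e + r *s b')"
  by (simp add: pt_def vec_eq_iff algebra_simps)

lemma vdet_pt: "vdet e b' (pt x y) = vdet e b' h" "vdet (pt x y) b' h = x * vdet e b' h" 
  by (simp_all add: pt_def vdet_linear vdet_repeat)

lemma pt_nonzero: "pt x y \<noteq> 0"
proof
  assume "pt x y = 0"
  then have "vdet e b' (pt x y) = 0" by (simp add: vdet_def vdot_3)
  then show False using frame vdet_pt by simp
qed

definition represents :: "complex poly poly \<Rightarrow> (complex^3 \<Rightarrow> complex) \<Rightarrow> bool" where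
  "represents P f \<longleftrightarrow> (\<forall>p x. poly (poly P p) x = f (pt x (poly p x)))"

lemma represents_line:
  assumes "represents P f" "homog d f"
  shows "poly P [:y - r * x, r:] = pcompose (along f (pt x y) (e + r *s b')) [:- x, 1:]"
proof -
  have "poly (poly P [:y - r * x, r:]) s = poly (pcompose (along f (pt x y) (e + r *s b')) [:- x, 1:]) s" for s
  proof -
    have "pt s (poly [:y - r * x, r:] s) = pt (x + (s - x)) (y + (s - x) * r)" by (simp add: algebra_simps)
    then have "pt s (poly [:y - r * x, r:] s) = pt x y + (s - x) *s (e + r *s b')" by (simp only: pt_shift)
    then show ?thesis using assms(1) by (simp add: represents_def poly_pcompose poly_along[OF assms(2)])
  qed
  then show ?thesis by (simp add: poly_eq_poly_eq_iff[symmetric] fun_eq_iff)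
qed

lemma represents_dvd_line:
  assumes "represents P f" "homog d f" "f (pt x y) = 0" "D1 f (pt x y) (e + r *s b') = 0"
  shows "[:- x, 1:]\<^sup>2 dvd poly P [:y - r * x, r:]"
  unfolding represents_line[OF assms(1,2)]
  using assms(3,4) by (intro shift_power_dvd) (simp add: X_squared_dvd_iff coeff_along_0[OF assms(2)])

lemma represents_along:
  assumes "represents P f" "homog d f"
  shows "specialize x P = along f (x *s e + h) b'"
  by (rule alongI[symmetric]) (use assms in \<open>simp add: poly_specialize represents_def pt_def add_ac\<close>)

lemma represents_pderiv:
  assumes "represents P f" "homog d f"
  shows "poly (poly (pderiv P) [:y:]) x = D1 f (pt x y) b'"
proof -
  have "D1 f (pt x y) b' = poly (pderiv (specialize x P)) y"
  proof (rule D1_eq_pderiv[OF assms(2)])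
    fix s
    have "poly (specialize x P) s = f (pt x s)" using assms(1) by (simp add: poly_specialize represents_def)
    also have "pt x s = pt x y + (s - y) *s b'" by (simp add: pt_def vec_eq_iff algebra_simps)
    finally show "poly (specialize x P) s = f (pt x y + (s - y) *s b')" .
  qed
  then show ?thesis by (simp add: pderiv_specialize poly_specialize)
qed

lemma D1_pt_e:
  assumes "represents P f" "homog d f"
  shows "D1 f (pt x y) e = poly (pderiv (poly P [:y:])) x"
proof (rule D1_eq_pderiv[OF assms(2)])
  fix s
  have "pt s y = pt x y + (s - x) *s e" by (simp add: pt_def vec_eq_iff algebra_simps)
  then show "poly (poly P [:y:]) s = f (pt x y + (s - x) *s e)" using assms(1) by (simp add: represents_def)
qed

lemma represents_ex:
  assumes "homog d f"
  shows "\<exists>P. represents P f \<and> (\<forall>i. coeff P i \<noteq> 0 \<longrightarrow> degree (coeff P i) + i \<le> d)"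
  using homog_bivariate[OF assms, of e b' h] by (simp add: represents_def pt_def)

lemma represents_branch:
  assumes "represents P2 q2" "represents P3 q3" "represents P4 q4" "represents P branch"
  shows "P = P3 * P3 - P2 * P4"
  by (rule bivariate_eqI) (use assms in \<open>simp add: represents_def branch_def\<close>)

text \<open>A double point of the branch curve is a centre of order one. If two nodes lie over it, the curve has
  two infinitely near double points there, and the order is two.\<close>

lemma centre_simple:
  assumes "represents P branch" "double_at branch (pt x y)"
  shows "centre P x y 1"
proof -
  have "[:- x, 1:]\<^sup>2 dvd poly P [:y - 0 * x, 0:]"
    by (rule represents_dvd_line[OF assms(1) homog_branch]) (use assms(2) in \<open>auto simp: double_at_def\<close>)
  moreover have "poly (poly (pderiv P) [:y:]) x = 0"
    using represents_pderiv[OF assms(1) homog_branch] assms(2) by (simp add: double_at_def)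
  then have "[:- x, 1:] dvd poly (pderiv P) [:y:]" by (simp only: poly_eq_0_iff_dvd)
  ultimately show ?thesis by (auto simp: centre_def intro!: exI[of _ "[:y:]"])
qed

lemma centre_tangent:
  assumes P: "represents P branch" and t: "sing (pt x y) t" "sing (pt x y) t'" "t \<noteq> t'"
  shows "centre P x y 2 \<or> vertical_centre P x y"
proof -
  let ?b = "pt x y" and ?\<pi> = "[:- x, 1:]"
  obtain P2 P3 P4 where R: "represents P2 q2" "represents P3 q3" "represents P4 q4"
    using represents_ex[OF hq2] represents_ex[OF hq3] represents_ex[OF hq4] by blast
  have eq: "P = P3 * P3 - P2 * P4" by (rule represents_branch[OF R P])
  have z: "q2 ?b = 0" "q3 ?b = 0" "q4 ?b = 0"
    using two_sing_tangent(1)[OF t] sing_on_conic[OF t(1)] by auto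
  have flat: "D1 q3 ?b w = 0" "D1 q4 ?b w = 0" if "D1 q2 ?b w = 0" for w
    using two_sing_tangent(2,3)[OF t, of w] that by auto
  show ?thesis
  proof (cases "vdot ?b b' = 0")
    case False
    define r where "r = - vdot ?b e / vdot ?b b'"
    define c where "c = [:y - r * x, r:]"
    have d2: "D1 q2 ?b (e + r *s b') = 0" using False by (simp add: D1_q2 vdot_simps r_def)
    have d: "?\<pi>\<^sup>2 dvd poly P2 c" "?\<pi>\<^sup>2 dvd poly P3 c" "?\<pi>\<^sup>2 dvd poly P4 c"
      unfolding c_def
      by (intro represents_dvd_line[OF R(1) hq2] represents_dvd_line[OF R(2) hq3] represents_dvd_line[OF R(3) hq4] z d2 flat[OF d2])+
    have four: "?\<pi> ^ (2 * 2) = ?\<pi>\<^sup>2 * ?\<pi>\<^sup>2" by (simp only: power_add[symmetric]) simp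
    have "?\<pi> ^ (2 * 2) dvd poly P c" unfolding eq four poly_diff poly_mult by (intro dvd_diff mult_dvd_mono d)
    moreover have "?\<pi>\<^sup>2 dvd poly (pderiv P) c"
      unfolding eq using d by (auto simp: pderiv_diff pderiv_mult intro!: dvd_diff dvd_add)
    moreover have "poly c x = y" by (simp add: c_def)
    ultimately show ?thesis by (auto simp: centre_def)
  next
    case True
    then have d2: "D1 q2 ?b b' = 0" by (simp add: D1_q2)
    define S where "S Q = pcompose Q [:[:y:], 1:]" for Q :: "complex poly poly"
    have low: "?\<pi> dvd coeff (S Q) i" if "represents Q f" "homog d f" "f ?b = 0" "D1 f ?b b' = 0" "i < 2" for Q f d i
    proof -
      have "poly (coeff (S Q) 0) x = 0" using that by (simp add: S_def pcompose_shift_coeff represents_def)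
      moreover have "poly (coeff (S Q) (Suc 0)) x = 0" using represents_pderiv[OF that(1,2)] that(4) by (simp add: S_def pcompose_shift_coeff)
      moreover have "i = 0 \<or> i = Suc 0" using that(5) by auto
      ultimately have "poly (coeff (S Q) i) x = 0" by auto
      then show ?thesis by (simp only: poly_eq_0_iff_dvd)
    qed
    have L: "?\<pi> dvd coeff (S P2) i" "?\<pi> dvd coeff (S P3) i" "?\<pi> dvd coeff (S P4) i" if "i < 2" for i
      using that by (auto intro: low[OF R(1) hq2 z(1) d2] low[OF R(2) hq3 z(2) flat(1)[OF d2]] low[OF R(3) hq4 z(3) flat(2)[OF d2]])
    have SP: "S P = S P3 * S P3 - S P2 * S P4" by (simp add: eq S_def pcompose_diff pcompose_mult)
    have two: "?\<pi>\<^sup>2 dvd coeff (A * B) i" if "\<And>j. j < 2 \<Longrightarrow> ?\<pi> dvd coeff A j" "\<And>j. j < 2 \<Longrightarrow> ?\<pi> dvd coeff B j" "i < 2" for A B i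
      unfolding coeff_mult power2_eq_square using that by (intro dvd_sum mult_dvd_mono) auto
    have one: "?\<pi> dvd coeff (A * B) i" if "\<And>j. j < 2 \<Longrightarrow> ?\<pi> dvd coeff A j" "\<And>j. j < 2 \<Longrightarrow> ?\<pi> dvd coeff B j" "i < 4" for A B i
      unfolding coeff_mult
    proof (rule dvd_sum)
      fix j assume "j \<in> {..i}"
      then have "j < 2 \<or> i - j < 2" using that(3) by auto
      then show "?\<pi> dvd coeff A j * coeff B (i - j)" using that by (auto intro: dvd_mult dvd_mult2)
    qed
    have "vertical_centre P x y"
      unfolding vertical_centre_def Let_def S_def[symmetric] SP coeff_diff
      using L by (auto intro!: dvd_diff two one)
    then show ?thesis ..
  qed
qed

end

context pencil_frame
begin

lemma frame_coordinates: "\<exists>X Y Z. v = X *s e + Y *s b' + Z *s h \<and> Z = vdet e b' v / vdet e b' h \<and> X = vdet v b' h / vdet e b' h"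
proof -
  let ?d = "vdet e b' h"
  have "?d *s v = vdet v b' h *s e + vdet e v h *s b' + vdet e b' v *s h" by (rule vdet_cramer)
  then have "inverse ?d *s (?d *s v) = inverse ?d *s (vdet v b' h *s e + vdet e v h *s b' + vdet e b' v *s h)" by (rule arg_cong)
  then have "v = (vdet v b' h / ?d) *s e + (vdet e v h / ?d) *s b' + (vdet e b' v / ?d) *s h"
    using frame by (simp add: vector_smult_assoc vector_add_ldistrib divide_inverse mult.commute)
  then show ?thesis by blast
qed

text \<open>Every point on a square factor is a double point of the branch curve, and there are only
  finitely many of them.\<close>

lemma no_square_factor:
  assumes P: "represents P branch" and D: "degree D \<ge> 1" "D\<^sup>2 dvd P"
  shows False
proof -
  obtain E where E: "P = D * D * E" using D(2) by (auto elim: dvdE simp: power2_eq_square)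
  define X where "X = {x. poly (lead_coeff D) x \<noteq> 0}"
  have "lead_coeff D \<noteq> 0" using D(1) by auto
  then have "finite {x. poly (lead_coeff D) x = 0}" by (rule poly_roots_finite)
  moreover have "X = UNIV - {x. poly (lead_coeff D) x = 0}" by (auto simp: X_def)
  ultimately have infX: "infinite X" by (simp add: infinite_UNIV_char_0 Diff_infinite_finite)
  have "\<exists>y. poly (poly D [:y:]) x = 0" if "x \<in> X" for x
  proof -
    have "coeff (specialize x D) (degree D) \<noteq> 0" using that by (simp add: coeff_specialize X_def)
    then have "degree (specialize x D) \<noteq> 0" using le_degree D(1) by fastforce
    then have "\<not> constant (poly (specialize x D))" by (simp add: constant_degree)
    then obtain y where "poly (specialize x D) y = 0" using fundamental_theorem_of_algebra by blast
    then show ?thesis unfolding poly_specialize by blast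
  qed
  then have "\<exists>y. \<forall>x\<in>X. poly (poly D [:y x:]) x = 0" by (intro bchoice) blast
  then obtain y where y: "\<And>x. x \<in> X \<Longrightarrow> poly (poly D [:y x:]) x = 0" by blast
  have "finite X"
  proof (rule double_family_finite)
    fix x assume x: "x \<in> X"
    let ?v = "pt x (y x)"
    have "branch ?v = poly (poly P [:y x:]) x"
      using P[unfolded represents_def, rule_format, of "[:y x:]" x] by simp
    then have z: "branch ?v = 0" unfolding E poly_mult using y[OF x] by simp
    have 1: "D1 branch ?v e = 0"
      unfolding D1_pt_e[OF P homog_branch] E poly_mult pderiv_mult by (simp add: y[OF x])
    have 2: "D1 branch ?v b' = 0"
      unfolding represents_pderiv[OF P homog_branch, symmetric] E poly_mult pderiv_mult poly_add by (simp add: y[OF x])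
    have 3: "D1 branch ?v ?v = 0" using D1_self[OF homog_branch, of ?v] z by simp
    have 4: "D1 branch ?v h = 0"
    proof -
      have h: "h = 1 *s ?v + (-1) *s (x *s e + y x *s b')" by (simp add: pt_def)
      show ?thesis by (subst h) (simp only: D1_linear[OF homog_branch] 1 2 3 mult_zero_right add_0_left)
    qed
    have "D1 branch ?v w = 0" for w
    proof -
      obtain X Y Z where w: "w = X *s e + Y *s b' + Z *s h" using frame_coordinates by blast
      have w: "w = 1 *s (X *s e + Y *s b') + Z *s h" using w by simp
      show ?thesis by (subst w) (simp only: D1_linear[OF homog_branch] 1 2 4 mult_zero_right add_0_left)
    qed
    then show "?v \<noteq> 0 \<and> double_at branch ?v" using z pt_nonzero by (simp add: double_at_def)
  next
    fix x x' c assume eq: "pt x (y x) = c *s pt x' (y x')"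
    have "vdet e b' (pt x (y x)) = c * vdet e b' (pt x' (y x'))" by (simp only: eq vdet_linear)
    then have "c = 1" using frame by (simp add: vdet_pt)
    moreover have "vdet (pt x (y x)) b' h = c * vdet (pt x' (y x')) b' h" by (simp only: eq vdet_linear)
    ultimately show "x = x'" using frame by (simp add: vdet_pt)
  qed
  then show False using infX by simp
qed

lemma zero_fibre_gives_line:
  assumes P: "represents P branch" "specialize x P = 0" and b: "branch b' = 0"
  shows "\<exists>l. l \<noteq> 0 \<and> vdot l b' = 0 \<and> (\<forall>v. vdot l v = 0 \<longrightarrow> branch v = 0)"
proof (intro exI conjI allI impI)
  define l where "l = vcross b' h - x *s vcross e b'"
  have l: "vdot l v = vdet v b' h - x * vdet e b' v" for v
    by (simp add: l_def vdot_simps vdet_def vdot_commute[of _ v]) (simp add: vdot_3 algebra_simps)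
  have "vdot l e = vdet e b' h" by (simp add: l vdet_repeat)
  then show "l \<noteq> 0" using frame by (auto simp: vdot_simps)
  show "vdot l b' = 0" by (simp add: l vdet_repeat)
  fix v assume lv: "vdot l v = 0"
  obtain X Y Z where v: "v = X *s e + Y *s b' + Z *s h" "Z = vdet e b' v / vdet e b' h" "X = vdet v b' h / vdet e b' h"
    using frame_coordinates by blast
  have "vdet v b' h = x * vdet e b' v" using lv by (simp add: l)
  then have XZ: "X = x * Z" unfolding v(2,3) by simp
  show "branch v = 0"
  proof (cases "Z = 0")
    case True
    then have "v = Y *s b'" using v(1) XZ by simp
    then show ?thesis using b by (simp add: homog_smult[OF homog_branch])
  next
    case False
    then have "v = Z *s pt x (Y / Z)" unfolding v(1) XZ by (simp add: pt_def vec_eq_iff algebra_simps)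
    moreover have "branch (pt x (Y / Z)) = 0"
      using P(1)[unfolded represents_def, rule_format, of "[:Y / Z:]" x] by (simp add: P(2) flip: poly_specialize)
    ultimately show ?thesis by (simp add: homog_smult[OF homog_branch])
  qed
qed

lemma line_through_node_in_frame:
  assumes node: "(b', t') \<in> N" and h2: "coeff (along branch b' h) 2 \<noteq> 0"
    and avoid: "\<And>b t. (b, t) \<in> N \<Longrightarrow> b \<noteq> b' \<Longrightarrow> vdet e b' b \<noteq> 0"
    and tangent: "q2 b' = 0 \<Longrightarrow> vdot b' e \<noteq> 0"
  shows "\<exists>l. l \<noteq> 0 \<and> vdot l b' = 0 \<and> (\<forall>v. vdot l v = 0 \<longrightarrow> branch v = 0)"
proof (rule ccontr)
  assume no_line: "\<not> ?thesis"
  have dbl: "double_at branch b'" using nodeN[OF node] sing_double by blast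
  then have bz: "branch b' = 0" by (simp add: double_at_def)
  obtain P where P: "represents P branch" and deg: "\<And>i. coeff P i \<noteq> 0 \<Longrightarrow> degree (coeff P i) + i \<le> 6"
    using represents_ex[OF homog_branch] by blast
  have co: "poly (coeff P i) x = coeff (along branch b' (x *s e + h)) (6 - i)" if "i \<le> 6" for i x
  proof -
    have "poly (coeff P i) x = coeff (along branch (x *s e + h) b') i"
      by (simp flip: coeff_specialize represents_along[OF P homog_branch])
    then show ?thesis using along_swap[OF homog_branch that] by simp
  qed
  have c6: "coeff P 6 = 0" and c5: "coeff P 5 = 0"
    using dbl by (auto simp: poly_eq_poly_eq_iff[symmetric] fun_eq_iff co double_at_def coeff_along_0[OF homog_branch])
  define a0 a1 a2 a3 a4 where "a0 = coeff P 0" and "a1 = coeff P 1" and "a2 = coeff P 2" and "a3 = coeff P 3" and "a4 = coeff P 4"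
  note a_defs = a0_def a1_def a2_def a3_def a4_def
  have Pa: "P = [:a0, a1, a2, a3, a4:]"
  proof (rule poly_eqI)
    fix i :: nat
    consider "i = 0" | "i = 1" | "i = 2" | "i = 3" | "i = 4" | "i = 5" | "i = 6" | "i > 6" by linarith
    then show "coeff P i = coeff [:a0, a1, a2, a3, a4:] i"
    proof cases
      case 8
      then have "coeff P i = 0" using deg[of i] by linarith
      moreover have "coeff [:a0, a1, a2, a3, a4:] i = 0" using 8 by (intro coeff_eq_0) simp
      ultimately show ?thesis by simp
    qed (use c5 c6 in \<open>simp_all add: a_defs numeral_eq_Suc\<close>)
  qed
  have dega: "degree a0 \<le> 6" "degree a1 \<le> 5" "degree a2 \<le> 4" "degree a3 \<le> 3" "degree a4 \<le> 2"
    using deg[of 0] deg[of 1] deg[of 2] deg[of 3] deg[of 4] unfolding a_defs by fastforce+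
  have "poly a4 0 \<noteq> 0" using co[of 4 0] h2 by (simp add: a4_def)
  then have a4: "a4 \<noteq> 0" by auto
  define \<Delta> where "\<Delta> = quartic_disc a0 a1 a2 a3 a4"
  have \<Delta>0: "\<Delta> \<noteq> 0"
  proof
    assume "\<Delta> = 0"
    then obtain D where "degree D \<ge> 1" "D\<^sup>2 dvd P"
      using quartic_disc_zero_imp_square_factor[OF a4, of a0 a1 a2 a3] unfolding \<Delta>_def Pa by blast
    then show False using no_square_factor[OF P] by blast
  qed
  have \<Delta>deg: "degree \<Delta> \<le> 24" unfolding \<Delta>_def by (rule degree_quartic_disc_le[OF dega])
  have nz: "poly a0 x \<noteq> 0 \<or> poly a1 x \<noteq> 0 \<or> poly a2 x \<noteq> 0 \<or> poly a3 x \<noteq> 0 \<or> poly a4 x \<noteq> 0" for x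
  proof (rule ccontr)
    assume "\<not> ?thesis"
    then have "specialize x P = 0"
      by (intro poly_eqI) (auto simp: coeff_specialize Pa coeff_pCons split: nat.splits)
    then show False using zero_fibre_gives_line[OF P _ bz] no_line by blast
  qed

  \<comment> \<open>the nodes that do not lie over \<open>b'\<close>, in affine coordinates\<close>
  define Z where "Z b = vdet e b' b / vdet e b' h" for b
  define X where "X b = vdet b b' h / vdet e b' h" for b
  define Y where "Y b = vdet e b h / vdet e b' h" for b
  define N' where "N' = {p \<in> N. fst p \<noteq> b'}"
  define T where "T = {t. (b', t) \<in> N}"
  define g where "g p = (X (fst p) / Z (fst p), Y (fst p) / Z (fst p), snd p / Z (fst p))" for p
  define M where "M = g ` N'"
  have Z0: "Z b \<noteq> 0" if "(b, t) \<in> N'" for b t using avoid[of b t] frame that by (simp add: Z_def N'_def)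
  have bpt: "b = Z b *s pt (X b / Z b) (Y b / Z b)" if "Z b \<noteq> 0" for b
  proof -
    let ?d = "vdet e b' h"
    have "?d *s b = vdet b b' h *s e + vdet e b h *s b' + vdet e b' b *s h" by (rule vdet_cramer)
    then have "inverse ?d *s (?d *s b) = inverse ?d *s (vdet b b' h *s e + vdet e b h *s b' + vdet e b' b *s h)" by (rule arg_cong)
    then have "b = X b *s e + Y b *s b' + Z b *s h"
      using frame by (simp add: vector_smult_assoc vector_add_ldistrib divide_inverse mult.commute X_def Y_def Z_def)
    also have "\<dots> = Z b *s pt (X b / Z b) (Y b / Z b)" using that by (simp add: pt_def vec_eq_iff algebra_simps)
    finally show ?thesis .
  qed
  have finN': "finite N'" using finN by (simp add: N'_def)
  have finM: "finite M" using finN' by (simp add: M_def)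
  have injg: "inj_on g N'"
  proof (rule inj_onI)
    fix p p' assume p: "p \<in> N'" "p' \<in> N'" "g p = g p'"
    obtain b t c s where pp: "p = (b, t)" "p' = (c, s)" by (cases p, cases p')
    have z: "Z b \<noteq> 0" "Z c \<noteq> 0" using p Z0 pp by auto
    have g: "X b / Z b = X c / Z c" "Y b / Z b = Y c / Z c" "t / Z b = s / Z c" using p(3) by (auto simp: g_def pp)
    define u where "u = pt (X c / Z c) (Y c / Z c)"
    have bc: "b = Z b *s u" "c = Z c *s u" using bpt[OF z(1)] bpt[OF z(2)] unfolding g u_def by auto
    have "c = (Z c / Z b) *s b"
    proof -
      have "(Z c / Z b) *s (Z b *s u) = Z c *s u" using z by (simp add: vector_smult_assoc)
      then show ?thesis using bc by metis
    qed
    moreover have "(b, t) \<in> N" "(c, s) \<in> N" using p pp by (auto simp: N'_def)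
    ultimately have "b = c" using proportional_nodes[of b t c s] by blast
    then show "p = p'" using g(3) z by (simp add: pp)
  qed
  have cardM: "card M = card N'" unfolding M_def by (rule card_image[OF injg])
  have singM: "sing (pt x y) t" if "(x, y, t) \<in> M" for x y t
  proof -
    obtain b s where bs: "(b, s) \<in> N'" "x = X b / Z b" "y = Y b / Z b" "t = s / Z b"
    proof -
      obtain p where p: "p \<in> N'" "(x, y, t) = g p" using \<open>(x, y, t) \<in> M\<close> unfolding M_def by blast
      have "(fst p, snd p) \<in> N'" using p(1) by simp
      with p(2) show thesis using that unfolding g_def by blast
    qed
    have z: "Z b \<noteq> 0" using bs Z0 by blast
    have "sing b s" using bs nodeN by (auto simp: N'_def)
    then have "sing (inverse (Z b) *s b) (inverse (Z b) * s)" using z by (intro sing_scale) auto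
    moreover have "inverse (Z b) *s b = pt x y"
    proof -
      have "inverse (Z b) *s (Z b *s pt x y) = pt x y" using z by (simp add: vector_smult_assoc)
      then show ?thesis using bpt[OF z] bs by metis
    qed
    ultimately show ?thesis using bs by (simp add: divide_inverse mult.commute)
  qed
  have T: "T \<subseteq> {t. sing b' t}" using nodeN by (auto simp: T_def)
  have b'0: "b' \<noteq> 0" using nodeN_nonzero node by blast
  have cardT: "finite T" "card T \<le> 2" "card T \<ge> 1"
  proof -
    show fT: "finite T" using card_sing_le_2[OF b'0] T finite_subset by blast
    have "card T \<le> card {t. sing b' t}" by (rule card_mono[OF conjunct1[OF card_sing_le_2[OF b'0]] T])
    then show "card T \<le> 2" using card_sing_le_2[OF b'0] by linarith
    have "t' \<in> T" using node by (simp add: T_def)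
    then have "card T > 0" using fT card_gt_0_iff by blast
    then show "card T \<ge> 1" by simp
  qed
  have cardN': "card N' + card T = 14"
  proof -
    have "N = N' \<union> Pair b' ` T" by (auto simp: N'_def T_def)
    moreover have "card (N' \<union> Pair b' ` T) = card N' + card (Pair b' ` T)"
      using finN' cardT(1) by (intro card_Un_disjoint) (auto simp: N'_def)
    moreover have "card (Pair b' ` T) = card T" by (rule card_image) (auto intro: inj_onI)
    ultimately show ?thesis using cardN by simp
  qed

  \<comment> \<open>the extra zero of the discriminant when two nodes lie over \<open>b'\<close>\<close>
  define x1 where "x1 = - vdot b' h / vdot b' e"
  define m where "m x = (if card T = 2 \<and> x = x1 then 1 else 0::nat)" for x
  have m: "m x \<le> 1" "[:- x, 1:] ^ m x dvd a3" "[:- x, 1:] ^ (2 * m x) dvd a4" for x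
  proof -
    show "m x \<le> 1" by (simp add: m_def)
    have "[:- x, 1:] ^ m x dvd a3 \<and> [:- x, 1:] ^ (2 * m x) dvd a4"
    proof (cases "card T = 2 \<and> x = x1")
      case True
      then obtain t s where "T = {t, s}" "t \<noteq> s" by (auto simp: card_2_iff)
      then have ts: "sing b' t" "sing b' s" "t \<noteq> s" using T by auto
      have q: "q2 b' = 0" "q3 b' = 0" "q4 b' = 0" using two_sing_tangent(1)[OF ts] sing_on_conic[OF ts(1)] by auto
      note tg = two_sing_tangent(2,3)[OF ts]
      have be: "vdot b' e \<noteq> 0" using tangent q by blast
      have d2: "D1 q2 b' (y *s e + h) = 2 * vdot b' e * (y - x1)" for y
      proof -
        have ex1: "vdot b' e * x1 = - vdot b' h" using be by (simp add: x1_def)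
        have "2 * vdot b' e * (y - x1) = 2 * (y * vdot b' e - vdot b' e * x1)" by algebra
        then show ?thesis unfolding ex1 by (simp add: D1_q2 vdot_simps)
      qed
      have "poly a4 y = poly ([:((t + s) / 2)\<^sup>2 - t * s:] * [:2 * vdot b' e:]\<^sup>2 * [:- x1, 1:]\<^sup>2) y" for y
      proof -
        let ?w = "y *s e + h"
        have "poly a4 y = coeff (along branch b' ?w) 2" using co[of 4 y] by (simp add: a4_def)
        also have "\<dots> = D1 q3 b' ?w * D1 q3 b' ?w - D1 q2 b' ?w * D1 q4 b' ?w"
          using q by (simp add: along_branch coeff_mult numeral_2_eq_2 coeff_along_0[OF hq2] coeff_along_0[OF hq3] coeff_along_0[OF hq4])
        also have "\<dots> = (((t + s) / 2)\<^sup>2 - t * s) * (2 * vdot b' e * (y - x1))\<^sup>2"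
        proof -
          have "- r * d * (- r * d) - d * (k * d) = (r\<^sup>2 - k) * d\<^sup>2" for r d k :: complex by algebra
          then show ?thesis unfolding tg d2 .
        qed
        finally have "poly a4 y = (((t + s) / 2)\<^sup>2 - t * s) * (2 * vdot b' e * (y - x1))\<^sup>2" .
        moreover have "poly ([:k:] * [:c:]\<^sup>2 * [:- x1, 1:]\<^sup>2) y = k * (c * (y - x1))\<^sup>2" for k c
        proof -
          have "poly ([:k:] * [:c:]\<^sup>2 * [:- x1, 1:]\<^sup>2) y = k * c\<^sup>2 * (y - x1)\<^sup>2"
            by (simp only: poly_mult poly_power poly_pCons poly_0) simp
          then show ?thesis by (simp only: power_mult_distrib mult.assoc)
        qed
        ultimately show ?thesis by (simp only:)
      qed
      then have "a4 = [:((t + s) / 2)\<^sup>2 - t * s:] * [:2 * vdot b' e:]\<^sup>2 * [:- x1, 1:]\<^sup>2"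
        unfolding poly_eq_poly_eq_iff[symmetric] fun_eq_iff by blast
      then have 4: "[:- x1, 1:]\<^sup>2 dvd a4" by (metis dvd_triv_right)
      have "poly a3 x1 = 0"
      proof -
        let ?w = "x1 *s e + h"
        have "D1 q2 b' ?w = 0" using d2 by simp
        then have s2: "[:0, 1:]\<^sup>2 dvd along q2 b' ?w" "[:0, 1:]\<^sup>2 dvd along q3 b' ?w" "[:0, 1:]\<^sup>2 dvd along q4 b' ?w"
          using q tg[of ?w] by (simp_all add: X_squared_dvd_iff coeff_along_0[OF hq2] coeff_along_0[OF hq3] coeff_along_0[OF hq4])
        have m4: "monom 1 4 = [:0, 1:]\<^sup>2 * [:0, 1::complex:]\<^sup>2" by (simp add: monom_altdef flip: power_add)
        have "monom 1 4 dvd along branch b' ?w" unfolding along_branch m4 by (intro dvd_diff mult_dvd_mono s2)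
        then have "coeff (along branch b' ?w) 3 = 0" by (simp add: monom_1_dvd_iff')
        then show ?thesis using co[of 3 x1] by (simp add: a3_def)
      qed
      then have 3: "[:- x1, 1:] dvd a3" by (simp only: poly_eq_0_iff_dvd)
      show ?thesis using 3 4 True by (simp add: m_def)
    qed (auto simp: m_def)
    then show "[:- x, 1:] ^ m x dvd a3" "[:- x, 1:] ^ (2 * m x) dvd a4" by auto
  qed

  have fibre: "[:- x, 1:] ^ (2 * card (M `` {x}) + 2 * m x) dvd \<Delta>" for x
  proof -
    define S where "S = M `` {x}"
    have finS: "finite S" using finM by (auto simp: S_def intro: finite_Image)
    have slice: "sing (pt x y) t" if "t \<in> S `` {y}" for y t using that singM by (auto simp: S_def)
    have "[:- x, 1:] ^ (2 * (\<Sum>y\<in>fst ` S. card (S `` {y})) + 2 * m x) dvd quartic_disc a0 a1 a2 a3 a4"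
    proof (rule fibre_bound[OF nz m])
      show "finite (fst ` S)" using finS by simp
      fix y assume "y \<in> fst ` S"
      then obtain t where t: "t \<in> S `` {y}" by auto
      have fin: "finite (S `` {y})" using finS by (auto intro: finite_Image)
      then have "card (S `` {y}) > 0" using t card_gt_0_iff by blast
      then show one: "1 \<le> card (S `` {y})" by simp
      have "S `` {y} \<subseteq> {t. sing (pt x y) t}" using slice by blast
      then have "card (S `` {y}) \<le> card {t. sing (pt x y) t}"
        by (rule card_mono[OF conjunct1[OF card_sing_le_2[OF pt_nonzero]]])
      then have "card (S `` {y}) \<le> 2" using card_sing_le_2[OF pt_nonzero[of x y]] by linarith
      with one consider "card (S `` {y}) = 1" | "card (S `` {y}) = 2" by linarith
      then show "centre [:a0, a1, a2, a3, a4:] x y (card (S `` {y})) \<or>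
         card (S `` {y}) = 2 \<and> vertical_centre [:a0, a1, a2, a3, a4:] x y"
      proof cases
        case 1
        then show ?thesis using centre_simple[OF P sing_double[OF slice[OF t]]] by (simp add: Pa)
      next
        case 2
        then obtain s s' where "S `` {y} = {s, s'}" "s \<noteq> s'" unfolding card_2_iff by blast
        then have "s \<in> S `` {y}" "s' \<in> S `` {y}" "s \<noteq> s'" by blast+
        then have "centre P x y 2 \<or> vertical_centre P x y" using centre_tangent[OF P slice slice] by blast
        then show ?thesis unfolding Pa 2 by blast
      qed
    qed
    then show ?thesis using card_eq_sum_slices[OF finS] by (simp add: \<Delta>_def S_def)
  qed
  define W where "W = fst ` M \<union> (if card T = 2 then {x1} else {})"
  have "(\<Sum>x\<in>W. 2 * card (M `` {x}) + 2 * m x) \<le> degree \<Delta>"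
    by (rule sum_of_orders_le_degree[OF \<Delta>0 _ fibre]) (simp add: W_def finM)
  moreover have "(\<Sum>x\<in>W. 2 * card (M `` {x}) + 2 * m x) = 2 * card M + 2 * (\<Sum>x\<in>W. m x)"
  proof -
    have empty: "M `` {x} = {}" if "x \<notin> fst ` M" for x
      using that by (metis Image_singleton_iff equals0I fst_conv imageI)
    have "(\<Sum>x\<in>W. card (M `` {x})) = (\<Sum>x\<in>fst ` M. card (M `` {x}))"
    proof (rule sum.mono_neutral_right)
      show "finite W" "fst ` M \<subseteq> W" by (auto simp: W_def finM)
      show "\<forall>x\<in>W - fst ` M. card (M `` {x}) = 0" using empty by simp
    qed
    then show ?thesis by (simp add: sum.distrib card_eq_sum_slices[OF finM] flip: sum_distrib_left)
  qed
  moreover have "(\<Sum>x\<in>W. m x) \<ge> (if card T = 2 then 1 else 0)"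
  proof (cases "card T = 2")
    case True
    then have "m x1 \<le> (\<Sum>x\<in>W. m x)" by (intro member_le_sum) (auto simp: W_def finM)
    then show ?thesis using True by (simp add: m_def)
  qed simp
  ultimately show False using \<Delta>deg cardM cardN' cardT by (auto split: if_splits)
qed

end

context nodes15
begin

text \<open>The discriminant of the residual binary quartic on the lines through the image of a node
  has degree at most \<open>24\<close>. The other nodes force more zeros than that, counted with
  multiplicity, so it vanishes identically. A repeated factor of the residual quartic is impossible
  because the branch curve has only finitely many double points. What is left is that the pencil
  contains a component of the branch curve.\<close>

lemma line_through_node:
  assumes node: "(b', t') \<in> N"
  shows "\<exists>l. l \<noteq> 0 \<and> vdot l b' = 0 \<and> (\<forall>v. vdot l v = 0 \<longrightarrow> branch v = 0)"
proof -
  have b'0: "b' \<noteq> 0" using nodeN_nonzero node by blast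
  have bz: "branch b' = 0" using nodeN[OF node] sing_double by (auto simp: double_at_def)
  obtain h where h: "coeff (along branch b' h) 2 \<noteq> 0" using quadN[OF node] by blast
  have "vcross b' h \<noteq> 0"
  proof
    assume "vcross b' h = 0"
    then obtain c where c: "h = c *s b'" using vcross_eq_0_imp_proportional b'0 by blast
    have "along branch b' h = 0"
    proof (rule alongI)
      fix s
      have "b' + s *s h = (1 + s * c) *s b'" by (simp add: c vec_eq_iff algebra_simps)
      then show "poly 0 s = branch (b' + s *s h)" using bz by (simp only: homog_smult[OF homog_branch]) simp
    qed
    then show False using h by simp
  qed
  then obtain h0 where h0: "vdet h0 b' h \<noteq> 0" using vdot_nondegenerate[of "vcross b' h"] by (auto simp: vdet_def vdot_commute)
  define K where "K = (\<Union>p\<in>{p \<in> N. fst p \<noteq> b'}. {k. vdet h0 b' (fst p) + k * vdet h b' (fst p) = 0}) \<union>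
     (if q2 b' = 0 then {k. vdot b' h0 + k * vdot b' h = 0} else {})"
  have "finite K"
    unfolding K_def
  proof (intro finite_UnI finite_UN_I)
    show "finite {p \<in> N. fst p \<noteq> b'}" using finN by simp
    fix p assume p: "p \<in> {p \<in> N. fst p \<noteq> b'}"
    obtain b t where bt: "p = (b, t)" by (cases p)
    have "vdet h0 b' b \<noteq> 0 \<or> vdet h b' b \<noteq> 0"
    proof (rule ccontr)
      assume *: "\<not> ?thesis"
      have "vdet h0 b' h *s b = vdet b b' h *s h0 + vdet h0 b h *s b' + vdet h0 b' b *s h" by (rule vdet_cramer)
      moreover have "vdet b b' h = 0" using * vdet_swap(3)[of b b' h] by simp
      ultimately have "vdet h0 b' h *s b = vdet h0 b h *s b'" using * by simp
      then have "inverse (vdet h0 b' h) *s (vdet h0 b' h *s b) = inverse (vdet h0 b' h) *s (vdet h0 b h *s b')" by (rule arg_cong)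
      then have "b = (inverse (vdet h0 b' h) * vdet h0 b h) *s b'" using h0 by (simp add: vector_smult_assoc)
      then have "b = b'" using proportional_nodes[OF node, of b t] p bt by blast
      then show False using p bt by simp
    qed
    then show "finite {k. vdet h0 b' (fst p) + k * vdet h b' (fst p) = 0}" using bt by (simp add: finite_affine_zero)
  next
    show "finite (if q2 b' = 0 then {k. vdot b' h0 + k * vdot b' h = 0} else {})"
    proof (cases "q2 b' = 0")
      case True
      have "vdot b' h0 \<noteq> 0 \<or> vdot b' h \<noteq> 0"
      proof (rule ccontr)
        assume *: "\<not> ?thesis"
        have "vdot b' w = 0" for w
        proof -
          have "vdet h0 b' h *s w = vdet w b' h *s h0 + vdet h0 w h *s b' + vdet h0 b' w *s h" by (rule vdet_cramer)
          then have "vdot b' (vdet h0 b' h *s w) = vdot b' (vdet w b' h *s h0 + vdet h0 w h *s b' + vdet h0 b' w *s h)" by (rule arg_cong)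
          then have "vdet h0 b' h * vdot b' w = 0" using * True by (simp add: vdot_simps q2_def)
          then show ?thesis using h0 by simp
        qed
        then show False using vdot_nondegenerate b'0 by blast
      qed
      then show ?thesis using True by (simp add: finite_affine_zero)
    qed simp
  qed
  then obtain k where k: "k \<notin> K" using ex_new_if_finite[OF infinite_UNIV_char_0] by blast
  define e where "e = h0 + k *s h"
  have fr: "vdet e b' h \<noteq> 0" using h0 by (simp add: e_def vdet_linear vdet_repeat)
  interpret pencil_frame q3 q4 N \<theta> b' e h
    by unfold_locales (rule fr)
  show ?thesis
  proof (rule line_through_node_in_frame[OF node h])
    fix b t assume bt: "(b, t) \<in> N" "b \<noteq> b'"
    have "k \<notin> {k. vdet h0 b' b + k * vdet h b' b = 0}" using k bt unfolding K_def by force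
    then show "vdet e b' b \<noteq> 0" by (simp add: e_def vdet_linear)
  next
    assume "q2 b' = 0"
    then show "vdot b' e \<noteq> 0" using k by (simp add: K_def e_def vdot_simps)
  qed
qed

end

section \<open>Counting the nodes on the lines of the branch sextic\<close>

lemma vcross_triple: "vcross (vcross a b) w = vdot a w *s b - vdot b w *s a"
  by (simp add: vec3_eq_iff vdot_3 algebra_simps)

lemma vdot_vcross: "vdot a (vcross a b) = 0" "vdot b (vcross a b) = 0"
  by (simp_all add: vdot_3 algebra_simps)

lemma orthogonal_to_two:
  assumes "vcross a b \<noteq> 0" "vdot a w = 0" "vdot b w = 0" shows "\<exists>k. w = k *s vcross a b"
proof (rule vcross_eq_0_imp_proportional[OF _ assms(1)])
  show "vcross (vcross a b) w = 0" by (simp add: vcross_triple assms)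
qed

lemma vcross_norm: "vdot (vcross a b) (vcross a b) = vdot a a * vdot b b - (vdot a b)\<^sup>2"
  by (simp add: vdot_3 power2_eq_square algebra_simps)

lemma ex_vdot_eq_1:
  assumes "l \<noteq> 0" shows "\<exists>w. vdot l w = 1"
proof -
  obtain w where "vdot l w \<noteq> 0" using vdot_nondegenerate assms by blast
  then show ?thesis by (intro exI[of _ "inverse (vdot l w) *s w"]) (simp add: vdot_simps)
qed

lemma isotropic_pair_orthogonal_to:
  assumes "vdot l l \<noteq> 0"
  shows "\<exists>f g. vdot l f = 0 \<and> vdot l g = 0 \<and> vdot f f = 0 \<and> vdot g g = 0 \<and> vdot f g \<noteq> 0"
proof -
  have "\<exists>i. vdot l l - (l $ i)\<^sup>2 \<noteq> 0"
  proof (rule ccontr)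
    assume "\<not> ?thesis"
    then have e: "vdot l l = (l $ i)\<^sup>2" for i by simp
    have "vdot l l = (l $ 1)\<^sup>2 + (l $ 2)\<^sup>2 + (l $ 3)\<^sup>2" by (simp add: vdot_3 power2_eq_square)
    also have "\<dots> = 3 * vdot l l" by (simp only: e[symmetric]) simp
    finally show False using assms by simp
  qed
  then obtain i where i: "vdot l l - (l $ i)\<^sup>2 \<noteq> 0" by blast
  define u where "u = vcross l (axis i 1)"
  define w where "w = vcross l u"
  have "vdot (axis i 1 :: complex^3) (axis i 1) = 1" by (simp add: vdot_axis)
  then have uu: "vdot u u \<noteq> 0" unfolding u_def vcross_norm vdot_axis using i by simp
  have lu: "vdot l u = 0" "vdot l w = 0" "vdot u w = 0" unfolding u_def w_def by (simp_all only: vdot_vcross)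
  have ww: "vdot w w = vdot l l * vdot u u" unfolding w_def vcross_norm lu by simp
  define a c where "a = csqrt (vdot w w)" and "c = \<i> * csqrt (vdot u u)"
  have a2: "a * a = vdot w w" and c2: "c * c = - vdot u u"
    using power2_csqrt[of "vdot w w"] power2_csqrt[of "vdot u u"] by (simp_all add: a_def c_def power2_eq_square mult_ac)
  have wu: "vdot w u = 0" using lu vdot_commute by metis
  have 1: "vdot (a *s u + c *s w) (a *s u + c *s w) = (a * a) * vdot u u + (c * c) * vdot w w"
    by (simp add: vdot_simps lu wu algebra_simps)
  have 2: "vdot (a *s u - c *s w) (a *s u - c *s w) = (a * a) * vdot u u + (c * c) * vdot w w"
    by (simp add: vdot_simps lu wu algebra_simps)
  have 3: "vdot (a *s u + c *s w) (a *s u - c *s w) = (a * a) * vdot u u - (c * c) * vdot w w"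
    by (simp add: vdot_simps lu wu algebra_simps)
  show ?thesis
  proof (intro exI conjI)
    show "vdot l (a *s u + c *s w) = 0" "vdot l (a *s u - c *s w) = 0" by (simp_all add: vdot_simps lu)
    show "vdot (a *s u + c *s w) (a *s u + c *s w) = 0" "vdot (a *s u - c *s w) (a *s u - c *s w) = 0"
      unfolding 1 2 a2 c2 by simp_all
    show "vdot (a *s u + c *s w) (a *s u - c *s w) \<noteq> 0" unfolding 3 a2 c2 using uu ww assms by simp
  qed
qed

context nodes15
begin

lemma branch_nonzero: "\<exists>v. branch v \<noteq> 0"
proof (rule ccontr)
  assume "\<not> ?thesis"
  then have "along branch b w = 0" for b w by (intro alongI) simp
  moreover obtain b t where "(b, t) \<in> N" using cardN by (metis card.empty ex_in_conv surj_pair zero_neq_numeral)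
  ultimately show False using quadN by fastforce
qed

lemma cofactor_zero:
  assumes F: "homog d F" "\<And>v. branch v = vdot l v * F v" and l: "l \<noteq> 0" and b: "vdot l b = 0" "double_at branch b"
  shows "F b = 0"
proof -
  obtain w where w: "vdot l w = 1" using ex_vdot_eq_1[OF l] by blast
  have e: "branch = (\<lambda>v. vdot l v * F v)" using F(2) by blast
  have "D1 branch b w = F b" unfolding e by (simp add: D1_mult[OF homog_vdot F(1)] along_vdot b w)
  then show ?thesis using b(2) by (simp add: double_at_def)
qed

lemma cofactor_tangent:
  assumes F: "homog d F" "\<And>v. branch v = vdot l v * F v" and l: "l \<noteq> 0" and b: "vdot l b = 0"
    and s: "sing b t" "q2 b = 0" and f: "vdot l f = 0"
  shows "D1 F b f = 0"
proof -
  obtain w0 where w0: "vdot l w0 = 1" using ex_vdot_eq_1[OF l] by blast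
  have Fb: "F b = 0" using cofactor_zero[OF F l b sing_double[OF s(1)]] .
  have q: "q3 b = 0" "q4 b = 0" using sing_on_conic[OF s] by auto
  define m where "m w = D1 q3 b w + t * D1 q2 b w" for w
  have e: "branch = (\<lambda>v. vdot l v * F v)" using F(2) by blast
  have key: "vdot l w * D1 F b w = (m w)\<^sup>2" for w
  proof -
    have "coeff (along branch b w) 2 = vdot l w * D1 F b w"
      unfolding e by (simp add: along_mult[OF homog_vdot F(1)] along_vdot b coeff_mult numeral_2_eq_2 coeff_along_0[OF F(1)] Fb)
    moreover have "coeff (along branch b w) 2 = D1 q3 b w * D1 q3 b w - D1 q2 b w * D1 q4 b w"
      using q s(2) by (simp add: along_branch coeff_mult numeral_2_eq_2 coeff_along_0[OF hq2] coeff_along_0[OF hq3] coeff_along_0[OF hq4])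
    moreover have "t\<^sup>2 * D1 q2 b w + 2 * t * D1 q3 b w + D1 q4 b w = 0" using s(1) by (simp add: sing_def)
    ultimately show ?thesis unfolding m_def by algebra
  qed
  have mlin: "m (c *s w + c' *s w') = c * m w + c' * m w'" for c c' w w'
    unfolding m_def D1_linear[OF hq2] D1_linear[OF hq3] by algebra
  have mf: "m f = 0" using key[of f] f by simp
  have 1: "D1 F b w0 + D1 F b f = (m w0)\<^sup>2"
    using key[of "1 *s w0 + 1 *s f"] by (simp only: D1_linear[OF F(1)] mlin mf vdot_simps w0 f) simp
  have 2: "- (- 1 * D1 F b w0 + 1 * D1 F b f) = (m w0)\<^sup>2"
    using key[of "(-1) *s w0 + 1 *s f"] by (simp only: D1_linear[OF F(1)] mlin mf vdot_simps w0 f) simp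
  have "2 * D1 F b f = 0" using 1 2 by algebra
  then show ?thesis by simp
qed

lemma card_nodes_on_line:
  assumes P: "homog p P" and E: "homog d E" and B: "\<And>v. branch v = vdot l v * (P v * E v)" and l: "l \<noteq> 0"
  shows "card {(b, t) \<in> N. vdot l b = 0 \<and> P b \<noteq> 0} \<le> d"
proof (cases "{(b, t) \<in> N. vdot l b = 0 \<and> P b \<noteq> 0} = {}")
  case False
  define A where "A = {(b, t) \<in> N. vdot l b = 0 \<and> P b \<noteq> 0}"
  obtain e1 t1 where e1: "(e1, t1) \<in> N" "vdot l e1 = 0" using False by blast
  define e2 where "e2 = vcross l \<theta>"
  have th1: "vdot \<theta> e1 = 1" using nodeN[OF e1(1)] by simp
  have e20: "e2 \<noteq> 0"
  proof
    assume "e2 = 0"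
    then obtain c where "\<theta> = c *s l" using vcross_eq_0_imp_proportional l by (auto simp: e2_def)
    then show False using th1 e1(2) by (simp add: vdot_simps)
  qed
  have le2: "vdot l e2 = 0" "vdot \<theta> e2 = 0" by (simp_all only: e2_def vdot_vcross)
  have onl: "vdot l (e1 + s *s e2) = 0" for s by (simp add: vdot_simps e1 le2)
  have thl: "vdot \<theta> (e1 + s *s e2) = 1" for s by (simp add: vdot_simps th1 le2)
  have HF: "homog (p + d) (\<lambda>v. P v * E v)" by (rule homog.mult[OF P E])
  define \<beta> where "\<beta> = along E e1 e2"
  have \<beta>: "poly \<beta> s = E (e1 + s *s e2)" for s by (simp add: \<beta>_def poly_along[OF E])
  have \<beta>0: "\<beta> \<noteq> 0"
  proof
    assume "\<beta> = 0"
    then have Ez: "E (e1 + s *s e2) = 0" for s using \<beta>[of s] by simp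
    have Bfun: "branch = (\<lambda>v. vdot l v * (P v * E v))" using B by blast
    have "finite (UNIV :: complex set)"
    proof (rule double_family_finite)
      fix s :: complex
      have "D1 branch (e1 + s *s e2) w = 0" for w
        unfolding Bfun D1_mult[OF homog_vdot HF] by (simp add: onl Ez)
      moreover have "e1 + s *s e2 \<noteq> 0" using thl[of s] by (metis vdot_simps(8) zero_neq_one)
      ultimately show "e1 + s *s e2 \<noteq> 0 \<and> double_at branch (e1 + s *s e2)" by (simp add: double_at_def B onl)
    next
      fix x y c assume eq: "e1 + x *s e2 = c *s (e1 + y *s e2)"
      have "vdot \<theta> (e1 + x *s e2) = c * vdot \<theta> (e1 + y *s e2)" by (simp only: eq vdot_simps)
      then have "c = 1" by (simp add: thl)
      then have "(x - y) *s e2 = 0" using eq by (simp add: vec_eq_iff algebra_simps)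
      then show "x = y" using e20 by simp
    qed
    then show False using infinite_UNIV_char_0 by blast
  qed
  define C where "C = {(s, t). (e1 + s *s e2, t) \<in> A}"
  have inj: "inj_on (\<lambda>(s, t). (e1 + s *s e2, t)) C"
    using e20 by (auto intro!: inj_onI)
  have AC: "A = (\<lambda>(s, t). (e1 + s *s e2, t)) ` C"
  proof
    show "A \<subseteq> (\<lambda>(s, t). (e1 + s *s e2, t)) ` C"
    proof
      fix z assume z: "z \<in> A"
      obtain b t where bt: "z = (b, t)" by (cases z)
      have b: "(b, t) \<in> N" "vdot l b = 0" using z bt by (auto simp: A_def)
      have "vdot l (b - e1) = 0" "vdot \<theta> (b - e1) = 0" using b e1 nodeN[OF b(1)] th1 by (simp_all add: vdot_simps)
      then obtain k where "b - e1 = k *s e2" using orthogonal_to_two[of l \<theta>] e20 by (auto simp: e2_def)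
      then have "b = e1 + k *s e2" by (simp add: algebra_simps)
      then have "(k, t) \<in> C" "z = (\<lambda>(s, t). (e1 + s *s e2, t)) (k, t)" using z bt by (simp_all add: C_def)
      then show "z \<in> (\<lambda>(s, t). (e1 + s *s e2, t)) ` C" by blast
    qed
  qed (auto simp: C_def)
  have finA: "finite A" using finN by (auto simp: A_def intro: finite_subset)
  have finC: "finite C" using finA inj unfolding AC by (rule finite_imageD)
  have "card A = card C" unfolding AC by (rule card_image[OF inj])
  also have "\<dots> = (\<Sum>s\<in>fst ` C. card (C `` {s}))" by (rule card_eq_sum_slices[OF finC])
  also have "\<dots> \<le> degree \<beta>"
  proof (rule sum_of_orders_le_degree[OF \<beta>0])
    show "finite (fst ` C)" using finC by simp
    fix s assume "s \<in> fst ` C"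
    let ?b = "e1 + s *s e2"
    have sl: "sing ?b t \<and> P ?b \<noteq> 0" if "t \<in> C `` {s}" for t using that nodeN by (auto simp: C_def A_def)
    obtain t where t: "t \<in> C `` {s}" using \<open>s \<in> fst ` C\<close> by auto
    have b0: "?b \<noteq> 0" using thl[of s] by (metis vdot_simps(8) zero_neq_one)
    have "C `` {s} \<subseteq> {t. sing ?b t}" using sl by blast
    then have "card (C `` {s}) \<le> card {t. sing ?b t}" by (rule card_mono[OF conjunct1[OF card_sing_le_2[OF b0]]])
    then have c2: "card (C `` {s}) \<le> 2" using card_sing_le_2[OF b0] by linarith
    have Fz: "P ?b * E ?b = 0" by (rule cofactor_zero[OF HF B l onl sing_double]) (use sl[OF t] in blast)
    then have Ez: "E ?b = 0" using sl[OF t] by simp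
    show "[:- s, 1:] ^ card (C `` {s}) dvd \<beta>"
    proof (cases "card (C `` {s}) = 2")
      case True
      then obtain t t' where tt: "C `` {s} = {t, t'}" "t \<noteq> t'" unfolding card_2_iff by blast
      then have st: "sing ?b t" "sing ?b t'" using sl by blast+
      have "D1 (\<lambda>v. P v * E v) ?b e2 = 0"
        by (rule cofactor_tangent[OF HF B l onl st(1) two_sing_tangent(1)[OF st tt(2)] le2(1)])
      then have "D1 E ?b e2 = 0" using sl[OF t] by (simp add: D1_mult[OF P E] Ez)
      then have "[:0, 1:]\<^sup>2 dvd along E ?b e2" by (simp add: X_squared_dvd_iff coeff_along_0[OF E] Ez)
      then have "[:- s, 1:]\<^sup>2 dvd pcompose (along E ?b e2) [:- s, 1:]" by (rule shift_power_dvd)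
      also have "pcompose (along E ?b e2) [:- s, 1:] = \<beta>"
      proof -
        have "poly (pcompose (along E ?b e2) [:- s, 1:]) x = poly \<beta> x" for x
        proof -
          have "?b + (x - s) *s e2 = e1 + x *s e2" by (simp add: vec_eq_iff algebra_simps)
          then show ?thesis by (simp add: poly_pcompose poly_along[OF E] \<beta>)
        qed
        then show ?thesis by (simp add: poly_eq_poly_eq_iff[symmetric] fun_eq_iff)
      qed
      finally show ?thesis using True by simp
    next
      case False
      then have "card (C `` {s}) = 0 \<or> card (C `` {s}) = 1" using c2 by linarith
      moreover have "poly \<beta> s = 0" by (simp add: \<beta> Ez)
      then have "[:- s, 1:] dvd \<beta>" by (simp only: poly_eq_0_iff_dvd)
      ultimately show ?thesis by auto
    qed
  qed
  also have "\<dots> \<le> d" unfolding \<beta>_def by (rule degree_along[OF E])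
  finally show ?thesis by (simp add: A_def)
next
  case True
  then show ?thesis by (simp only: card.empty)
qed

lemma card_nodes_on_secant:
  assumes E: "homog 5 E" and B: "\<And>v. branch v = vdot l v * E v" and ll: "vdot l l \<noteq> 0"
  shows "card {(b, t) \<in> N. vdot l b = 0} \<le> 3"
proof -
  have l: "l \<noteq> 0" using ll by (auto simp: vdot_simps)
  define A where "A = {(b, t) \<in> N. vdot l b = 0}"
  obtain f g where fg: "vdot l f = 0" "vdot l g = 0" "vdot f f = 0" "vdot g g = 0" "vdot f g \<noteq> 0"
    using isotropic_pair_orthogonal_to[OF ll] by blast
  define on where "on f = {(b, t) \<in> A. \<exists>c. b = c *s f}" for f
  have finA: "finite A" using finN by (auto simp: A_def intro: finite_subset)
  have fin_on: "finite (on f)" for f using finA by (auto simp: on_def intro: finite_subset)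

  \<comment> \<open>both points of the line on the conic are double on the branch curve, and carry at most one node\<close>
  have end_pt: "E f = 0 \<and> card (on f) \<le> 1 \<and> (on f \<noteq> {} \<longrightarrow> D1 E f g = 0)"
    if fg: "vdot l f = 0" "vdot l g = 0" "vdot f f = 0" "vdot f g \<noteq> 0" for f g
  proof (intro conjI impI)
    have q2f: "q2 f = 0" by (simp add: q2_def fg)
    have "branch f = 0" by (simp add: B fg)
    then have q3f: "q3 f = 0" by (simp add: branch_def q2f)
    have "along branch f g = 0" by (rule alongI) (simp add: B vdot_simps fg)
    then have "D1 q2 f g * q4 f = 0" using D1_branch[of f g] by (simp add: q2f q3f)
    then have q4f: "q4 f = 0" using fg by (simp add: D1_q2)
    have dbl: "double_at branch f" by (simp add: double_at_def D1_branch branch_def q2f q3f q4f)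
    show "E f = 0" by (rule cofactor_zero[OF E B l fg(1) dbl])
    have f0: "f \<noteq> 0" using fg(4) by (auto simp: vdot_simps)
    have on_sing: "b \<noteq> 0 \<and> (\<exists>c. c \<noteq> 0 \<and> b = c *s f) \<and> sing b t \<and> (b, t) \<in> N" if "(b, t) \<in> on f" for b t
    proof -
      obtain c where c: "b = c *s f" "(b, t) \<in> N" using \<open>(b, t) \<in> on f\<close> by (auto simp: on_def A_def)
      then show ?thesis using nodeN[OF c(2)] nodeN_nonzero[OF c(2)] by auto
    qed
    show "card (on f) \<le> 1"
    proof (rule ccontr)
      assume "\<not> card (on f) \<le> 1"
      then obtain z z' where z: "z \<in> on f" "z' \<in> on f" "z \<noteq> z'" using fin_on card_le_Suc0_iff_eq[OF fin_on] by auto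
      obtain b t b' t' where bt: "z = (b, t)" "z' = (b', t')" by (cases z, cases z')
      obtain c where c: "c \<noteq> 0" "b = c *s f" using on_sing z bt by blast
      obtain c' where c': "c' \<noteq> 0" "b' = c' *s f" using on_sing z bt by blast
      have "b' = (c' / c) *s b" using c c' by (simp add: vector_smult_assoc)
      then have bb: "b' = b" using proportional_nodes on_sing z bt by blast
      then have ts: "sing b t" "sing b t'" "t \<noteq> t'" using z bt on_sing by auto
      have q: "q2 b = 0" "q3 b = 0" "q4 b = 0" using two_sing_tangent(1)[OF ts] sing_on_conic[OF ts(1)] by auto
      have "along branch b g = 0" by (rule alongI) (simp add: B vdot_simps fg c)
      moreover have "coeff (along branch b g) 2 = D1 q3 b g * D1 q3 b g - D1 q2 b g * D1 q4 b g"
        using q by (simp add: along_branch coeff_mult numeral_2_eq_2 coeff_along_0[OF hq2] coeff_along_0[OF hq3] coeff_along_0[OF hq4])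
      ultimately have "D1 q3 b g * D1 q3 b g - D1 q2 b g * D1 q4 b g = 0" by simp
      then have "((t - t') / 2)\<^sup>2 * (D1 q2 b g)\<^sup>2 = 0"
        unfolding two_sing_tangent(2,3)[OF ts] by (simp add: power2_eq_square field_simps)
      then have "D1 q2 b g = 0" using ts by simp
      then show False using c fg by (simp add: D1_q2 vdot_simps)
    qed
    assume "on f \<noteq> {}"
    then obtain b t where bt: "(b, t) \<in> on f" by auto
    then obtain c where c: "c \<noteq> 0" "b = c *s f" and s: "sing b t" using on_sing by blast
    have "sing (inverse c *s b) (inverse c * t)" using sing_scale[OF s, of "inverse c"] c(1) by simp
    then have "sing f (inverse c * t)" using c by (simp add: vector_smult_assoc)
    then show "D1 E f g = 0" by (rule cofactor_tangent[OF E B l fg(1) _ q2f fg(2)])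
  qed
  have F: "E f = 0" "card (on f) \<le> 1" "on f \<noteq> {} \<longrightarrow> D1 E f g = 0"
    using end_pt[OF fg(1,2,3,5)] by auto
  have G: "E g = 0" "card (on g) \<le> 1" "on g \<noteq> {} \<longrightarrow> D1 E g f = 0"
    using end_pt[OF fg(2,1,4)] fg(5) by (auto simp: vdot_commute)
  define \<beta> where "\<beta> = along E f g"
  have \<beta>: "poly \<beta> s = E (f + s *s g)" for s by (simp add: \<beta>_def poly_along[OF E])
  have lfg: "vdot l (f + s *s g) = 0" for s by (simp add: vdot_simps fg)
  have gf: "vdot g f = vdot f g" by (rule vdot_commute)
  have \<beta>0: "\<beta> \<noteq> 0"
  proof
    assume "\<beta> = 0"
    then have Ez: "E (f + s *s g) = 0" for s using \<beta>[of s] by simp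
    have Bfun: "branch = (\<lambda>v. vdot l v * E v)" using B by blast
    have "finite (UNIV :: complex set)"
    proof (rule double_family_finite)
      fix s :: complex
      have "D1 branch (f + s *s g) w = 0" for w
        unfolding Bfun D1_mult[OF homog_vdot E] by (simp add: lfg Ez)
      moreover have "vdot (f + s *s g) g = vdot f g" by (simp add: vdot_simps fg)
      then have "f + s *s g \<noteq> 0" using fg(5) by (metis vdot_simps(7))
      ultimately show "f + s *s g \<noteq> 0 \<and> double_at branch (f + s *s g)" by (simp add: double_at_def B lfg)
    next
      fix x y c assume eq: "f + x *s g = c *s (f + y *s g)"
      have "vdot (f + x *s g) g = c * vdot (f + y *s g) g" by (simp only: eq vdot_simps)
      then have "c = 1" using fg by (simp add: vdot_simps)
      moreover have "vdot (f + x *s g) f = c * vdot (f + y *s g) f" by (simp only: eq vdot_simps)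
      ultimately show "x = y" using fg by (simp add: vdot_simps gf)
    qed
    then show False using infinite_UNIV_char_0 by blast
  qed
  define n1 n2 where "n1 = card (on f)" and "n2 = card (on g)"
  have n: "n1 = 0 \<or> n1 = 1" "n2 = 0 \<or> n2 = 1" using F(2) G(2) unfolding n1_def n2_def by linarith+
  have low: "coeff \<beta> i = 0" if "i < 1 + n1" for i
  proof -
    have "coeff \<beta> 0 = 0" by (simp add: \<beta>_def coeff_along_0[OF E] F)
    moreover have "coeff \<beta> (Suc 0) = 0" if "n1 = 1" using that F(3) unfolding \<beta>_def n1_def by auto
    moreover have "i = 0 \<or> i = Suc 0 \<and> n1 = 1" using n(1) \<open>i < 1 + n1\<close> by auto
    ultimately show ?thesis by auto
  qed
  have high: "coeff \<beta> i = 0" if "i > 4 - n2" for i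
  proof -
    have sw: "coeff \<beta> i = coeff (along E g f) (5 - i)" if "i \<le> 5" for i
      unfolding \<beta>_def by (rule along_swap[OF E that])
    have "coeff \<beta> 5 = 0" using sw[of 5] by (simp add: coeff_along_0[OF E] G)
    moreover have "coeff \<beta> 4 = 0" if "n2 = 1" using that sw[of 4] G(3) unfolding n2_def by auto
    moreover have "coeff \<beta> i = 0" if "i > 5" using degree_along[OF E, of f g] that by (intro coeff_eq_0) (simp add: \<beta>_def)
    moreover have "i > 5 \<or> i = 5 \<or> i = 4 \<and> n2 = 1" using n(2) that by auto
    ultimately show ?thesis by auto
  qed
  have "monom 1 (1 + n1) dvd \<beta>" using low by (simp add: monom_1_dvd_iff')
  then obtain \<gamma> where \<gamma>: "\<beta> = monom 1 (1 + n1) * \<gamma>" by (auto elim: dvdE)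
  have \<gamma>0: "\<gamma> \<noteq> 0" using \<gamma> \<beta>0 by auto
  have "degree \<beta> \<le> 4 - n2" using high by (intro degree_le) auto
  moreover have "degree \<beta> = 1 + n1 + degree \<gamma>" unfolding \<gamma> using \<gamma>0 by (simp add: degree_mult_eq degree_monom_eq)
  ultimately have deg\<gamma>: "degree \<gamma> + n1 + n2 \<le> 3" using n by auto
  define A0 where "A0 = A - on f - on g"
  define \<sigma> where "\<sigma> z = vdot (fst z) f / vdot (fst z) g" for z :: "(complex^3) \<times> complex"
  have A0: "\<exists>\<alpha>. \<alpha> \<noteq> 0 \<and> \<sigma> (b, t) \<noteq> 0 \<and> b = \<alpha> *s (f + \<sigma> (b, t) *s g) \<and> (b, t) \<in> N" if "(b, t) \<in> A0" for b t
  proof -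
    have lb: "vdot l b = 0" "(b, t) \<in> N" and nf: "\<nexists>c. b = c *s f" and ng: "\<nexists>c. b = c *s g"
      using that by (auto simp: A0_def A_def on_def)
    have c0: "vcross f g \<noteq> 0"
    proof
      assume "vcross f g = 0"
      moreover have "f \<noteq> 0" using fg(5) by (auto simp: vdot_simps)
      ultimately obtain c where "g = c *s f" using vcross_eq_0_imp_proportional by blast
      then show False using fg by (simp add: vdot_simps)
    qed
    obtain k where k: "l = k *s vcross f g" using orthogonal_to_two[OF c0, of l] fg by (auto simp: vdot_commute)
    then have k0: "k \<noteq> 0" using l by auto
    have d: "vdet l f g \<noteq> 0" using ll k k0 by (auto simp: vdet_def vdot_simps)
    have "vdet b f g = 0" using lb k k0 by (simp add: vdet_def vdot_simps vdot_commute)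
    then have cr: "vdet l f g *s b = vdet l b g *s f + vdet l f b *s g" using vdet_cramer[of l f g b] by simp
    have "b = inverse (vdet l f g) *s (vdet l f g *s b)" using d by (simp add: vector_smult_assoc)
    also have "\<dots> = (vdet l b g / vdet l f g) *s f + (vdet l f b / vdet l f g) *s g"
      unfolding cr by (simp add: vector_add_ldistrib vector_smult_assoc divide_inverse mult.commute)
    finally obtain x y where b: "b = x *s f + y *s g" by blast
    have x: "x \<noteq> 0" and y: "y \<noteq> 0" using nf ng b by auto
    have \<sigma>: "\<sigma> (b, t) = y / x" using fg by (simp add: \<sigma>_def b vdot_simps gf)
    have "b = x *s (f + (y / x) *s g)" unfolding b using x by (simp add: vector_add_ldistrib vector_smult_assoc)
    then show ?thesis using x y lb(2) unfolding \<sigma> by (intro exI[of _ x]) simp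
  qed
  have "card A0 \<le> card {s. poly \<gamma> s = 0}"
  proof (rule card_inj_on_le)
    show "finite {s. poly \<gamma> s = 0}" by (rule poly_roots_finite[OF \<gamma>0])
    show "\<sigma> ` A0 \<subseteq> {s. poly \<gamma> s = 0}"
    proof
      fix s assume "s \<in> \<sigma> ` A0"
      then obtain b t where bt: "(b, t) \<in> A0" "s = \<sigma> (b, t)" by auto
      then obtain \<alpha> where a: "\<alpha> \<noteq> 0" "s \<noteq> 0" "b = \<alpha> *s (f + s *s g)" "(b, t) \<in> N" using A0 by blast
      have "E b = 0"
        by (rule cofactor_zero[OF E B l _ sing_double]) (use a nodeN lfg in \<open>auto simp: vdot_simps fg\<close>)
      then have "\<alpha> ^ 5 * E (f + s *s g) = 0" unfolding a(3) homog_smult[OF E] .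
      then have "poly \<beta> s = 0" using a(1) by (simp add: \<beta>)
      then show "s \<in> {s. poly \<gamma> s = 0}" using a(2) by (simp add: \<gamma> poly_monom)
    qed
    show "inj_on \<sigma> A0"
    proof (rule inj_onI)
      fix z z' assume z: "z \<in> A0" "z' \<in> A0" "\<sigma> z = \<sigma> z'"
      obtain b t b' t' where bt: "z = (b, t)" "z' = (b', t')" by (cases z, cases z')
      obtain \<alpha> where a: "\<alpha> \<noteq> 0" "\<sigma> z \<noteq> 0" "b = \<alpha> *s (f + \<sigma> z *s g)" "(b, t) \<in> N" using A0 z bt by blast
      obtain \<alpha>' where a': "\<alpha>' \<noteq> 0" "b' = \<alpha>' *s (f + \<sigma> z' *s g)" "(b', t') \<in> N" using A0 z bt by blast
      define u where "u = f + \<sigma> z *s g"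
      have bu: "b = \<alpha> *s u" "b' = \<alpha>' *s u" using a(3) a'(2) unfolding z(3)[symmetric] u_def by auto
      then have "b' = (\<alpha>' / \<alpha>) *s b" using a(1) by (simp add: vector_smult_assoc)
      then have bb: "b' = b" using proportional_nodes[OF a(4) a'(3)] by blast
      have "q2 b = \<alpha>\<^sup>2 * (2 * \<sigma> z * vdot f g)"
        unfolding bu u_def q2_def by (simp add: vdot_simps fg gf power2_eq_square algebra_simps)
      then have "q2 b \<noteq> 0" using a fg by simp
      then have "t = t'" using sing_unique_off_conic[of b t t'] nodeN[OF a(4)] nodeN[OF a'(3)] bb by blast
      then show "z = z'" using bb bt by simp
    qed
  qed
  also have "\<dots> \<le> degree \<gamma>" by (rule card_poly_roots_bound[OF \<gamma>0])
  finally have "card A0 + n1 + n2 \<le> 3" using deg\<gamma> by linarith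
  moreover have "card A \<le> card A0 + (n1 + n2)"
  proof -
    have "A \<subseteq> A0 \<union> (on f \<union> on g)" by (auto simp: A0_def)
    then have "card A \<le> card (A0 \<union> (on f \<union> on g))" using finA fin_on by (intro card_mono) (auto simp: A0_def)
    also have "\<dots> \<le> card A0 + card (on f \<union> on g)" by (rule card_Un_le)
    also have "card (on f \<union> on g) \<le> n1 + n2" unfolding n1_def n2_def by (rule card_Un_le)
    finally show ?thesis by simp
  qed
  ultimately show ?thesis by (simp add: A_def)
qed

text \<open>Linear factors are split off one at a time. As long as the lines found so far miss some node, that
  node lies on a further line of the branch curve; each new line carries only few nodes, so that the
  process cannot stop before four lines have been found.\<close>

lemma peel_line:
  assumes P: "homog k P" and E: "homog (6 - k) E" and k: "k \<le> 6" and B: "\<And>v. branch v = P v * E v"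
    and few: "card {(b, t) \<in> N. P b = 0} \<le> m" "m < 14"
  shows "k < 6 \<and> (\<exists>l E'. l \<noteq> 0 \<and> homog (6 - Suc k) E' \<and> (\<forall>v. E v = vdot l v * E' v) \<and>
     (\<exists>b. P b \<noteq> 0 \<and> vdot l b = 0) \<and> card {(b, t) \<in> N. vdot l b * P b = 0} \<le> m + (5 - k))"
proof -
  have "{(b, t) \<in> N. P b = 0} \<noteq> N" using few cardN by auto
  then obtain b t where bt: "(b, t) \<in> N" "P b \<noteq> 0" by auto
  have bz: "branch b = 0" using nodeN[OF bt(1)] sing_double by (auto simp: double_at_def)
  have k6: "k < 6"
  proof (rule ccontr)
    assume "\<not> k < 6"
    then have "homog 0 E" using E by simp
    then obtain c where c: "E = (\<lambda>_. c)" using homog_zero_const by blast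
    then have "c = 0" using bz B[of b] bt by simp
    then show False using branch_nonzero B c by simp
  qed
  obtain l where l: "l \<noteq> 0" "vdot l b = 0" "\<And>v. vdot l v = 0 \<Longrightarrow> branch v = 0" using line_through_node[OF bt(1)] by blast
  have Ez: "E v = 0" if "vdot l v = 0" for v
  proof -
    have "along P v b * along E v b = 0"
    proof -
      have "poly (along P v b * along E v b) s = 0" for s
        using B[of "v + s *s b"] l(3)[of "v + s *s b"] that l(2) by (simp add: poly_along[OF P] poly_along[OF E] vdot_simps)
      then show ?thesis by (simp add: poly_eq_poly_eq_iff[symmetric] fun_eq_iff)
    qed
    moreover have "coeff (along P v b) k = P b" using along_swap[OF P, of k v b] by (simp add: coeff_along_0[OF P])
    then have "along P v b \<noteq> 0" using bt by auto
    ultimately have "along E v b = 0" by simp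
    then show ?thesis using coeff_along_0[OF E, of v b] by simp
  qed
  obtain E' where E': "homog (6 - k - 1) E'" "\<And>v. E v = vdot l v * E' v"
    using homog_factor[OF E l(1)] Ez unfolding vdot_def by blast
  have hE': "homog (6 - Suc k) E'" using E'(1) by simp
  have "card {(b, t) \<in> N. vdot l b = 0 \<and> P b \<noteq> 0} \<le> 6 - Suc k"
    by (rule card_nodes_on_line[OF P hE' _ l(1)]) (simp add: B E')
  moreover have "{(b, t) \<in> N. vdot l b * P b = 0} = {(b, t) \<in> N. P b = 0} \<union> {(b, t) \<in> N. vdot l b = 0 \<and> P b \<noteq> 0}" by auto
  ultimately have "card {(b, t) \<in> N. vdot l b * P b = 0} \<le> m + (5 - k)"
    using few(1) card_Un_le[of "{(b, t) \<in> N. P b = 0}" "{(b, t) \<in> N. vdot l b = 0 \<and> P b \<noteq> 0}"] by simp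
  then show ?thesis using k6 l hE' E'(2) bt(2) by blast
qed

lemma peel_line':
  assumes "homog k P" "homog (6 - k) E" "k \<le> 6" "\<And>v. branch v = P v * E v"
    "card {(b, t) \<in> N. P b = 0} \<le> m" "m < 14"
  obtains l E' where "k < 6" "l \<noteq> 0" "homog (Suc k) (\<lambda>v. vdot l v * P v)" "homog (6 - Suc k) E'"
    "\<And>v. E v = vdot l v * E' v" "\<And>v. branch v = (vdot l v * P v) * E' v"
    "\<exists>b. P b \<noteq> 0 \<and> vdot l b = 0" "card {(b, t) \<in> N. vdot l b * P b = 0} \<le> m + (5 - k)"
proof -
  obtain l E' where *: "k < 6" "l \<noteq> 0" "homog (6 - Suc k) E'" "\<And>v. E v = vdot l v * E' v"
    "\<exists>b. P b \<noteq> 0 \<and> vdot l b = 0" "card {(b, t) \<in> N. vdot l b * P b = 0} \<le> m + (5 - k)"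
    using peel_line[OF assms] by blast
  show thesis
    by (rule that[OF *(1,2) _ *(3,4) _ *(5,6)])
       (use homog.mult[OF homog_vdot assms(1), of l] in \<open>simp_all add: assms(4) *(4)\<close>)
qed

lemma line_in_branch_isotropic:
  assumes l: "l \<noteq> 0" and E: "homog 5 E" and B: "\<And>v. branch v = vdot l v * E v"
  shows "vdot l l = 0"
proof (rule ccontr)
  assume "vdot l l \<noteq> 0"
  then have c1: "card {(b, t) \<in> N. vdot l b = 0} \<le> 3" using card_nodes_on_secant[OF E B] by blast
  have h1: "homog (Suc 0) (vdot l)" "homog (6 - Suc 0) E" using homog_vdot E by auto
  obtain l2 E2 where 2: "homog (Suc (Suc 0)) (\<lambda>v. vdot l2 v * vdot l v)" "homog (6 - Suc (Suc 0)) E2"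
    "\<And>v. branch v = (vdot l2 v * vdot l v) * E2 v" "card {(b, t) \<in> N. vdot l2 b * vdot l b = 0} \<le> 3 + (5 - Suc 0)"
    by (rule peel_line'[OF h1 _ B c1]) auto
  obtain l3 E3 where 3: "homog (Suc (Suc (Suc 0))) (\<lambda>v. vdot l3 v * (vdot l2 v * vdot l v))" "homog (6 - Suc (Suc (Suc 0))) E3"
    "\<And>v. branch v = (vdot l3 v * (vdot l2 v * vdot l v)) * E3 v"
    "card {(b, t) \<in> N. vdot l3 b * (vdot l2 b * vdot l b) = 0} \<le> 3 + (5 - Suc 0) + (5 - Suc (Suc 0))"
    by (rule peel_line'[OF 2(1,2) _ 2(3,4)]) auto
  obtain l4 E4 where 4: "homog (Suc (Suc (Suc (Suc 0)))) (\<lambda>v. vdot l4 v * (vdot l3 v * (vdot l2 v * vdot l v)))" "homog (6 - Suc (Suc (Suc (Suc 0)))) E4"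
    "\<And>v. branch v = (vdot l4 v * (vdot l3 v * (vdot l2 v * vdot l v))) * E4 v"
    "card {(b, t) \<in> N. vdot l4 b * (vdot l3 b * (vdot l2 b * vdot l b)) = 0} \<le> 12"
    by (rule peel_line'[OF 3(1,2) _ 3(3,4)]) auto
  obtain l5 E5 where 5: "homog (Suc (Suc (Suc (Suc (Suc 0))))) (\<lambda>v. vdot l5 v * (vdot l4 v * (vdot l3 v * (vdot l2 v * vdot l v))))"
    "homog (6 - Suc (Suc (Suc (Suc (Suc 0))))) E5"
    "\<And>v. branch v = (vdot l5 v * (vdot l4 v * (vdot l3 v * (vdot l2 v * vdot l v)))) * E5 v"
    "card {(b, t) \<in> N. vdot l5 b * (vdot l4 b * (vdot l3 b * (vdot l2 b * vdot l b))) = 0} \<le> 13"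
    by (rule peel_line'[OF 4(1,2) _ 4(3,4)]) auto
  obtain l6 E6 where 6: "homog (Suc (Suc (Suc (Suc (Suc (Suc 0)))))) (\<lambda>v. vdot l6 v * (vdot l5 v * (vdot l4 v * (vdot l3 v * (vdot l2 v * vdot l v)))))"
    "homog (6 - Suc (Suc (Suc (Suc (Suc (Suc 0)))))) E6"
    "\<And>v. branch v = (vdot l6 v * (vdot l5 v * (vdot l4 v * (vdot l3 v * (vdot l2 v * vdot l v))))) * E6 v"
    "card {(b, t) \<in> N. vdot l6 b * (vdot l5 b * (vdot l4 b * (vdot l3 b * (vdot l2 b * vdot l b)))) = 0} \<le> 13"
    by (rule peel_line'[OF 5(1,2) _ 5(3,4)]) auto
  show False using peel_line[OF 6(1,2) _ 6(3,4)] by simp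
qed

text \<open>A further line carries at most as many new nodes as the degree of the factor that
  remains after it, so that the first four lines account for at most \<open>5 + 4 + 3 + 2 =
  14\<close> nodes, and fewer lines do not suffice. A line that is not tangent to the conic would
  carry at most three nodes, and then even six lines could not account for all fourteen.\<close>

theorem branch_decomposition:
  "\<exists>l1 l2 l3 l4 C. homog 2 C \<and> (\<forall>v. branch v = vdot l1 v * vdot l2 v * vdot l3 v * vdot l4 v * C v) \<and>
     (\<forall>l\<in>{l1, l2, l3, l4}. l \<noteq> 0 \<and> vdot l l = 0) \<and>
     (\<forall>c. l2 \<noteq> c *s l1 \<and> l3 \<noteq> c *s l1 \<and> l3 \<noteq> c *s l2 \<and> l4 \<noteq> c *s l1 \<and> l4 \<noteq> c *s l2 \<and> l4 \<noteq> c *s l3)"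
proof -
  have one: "homog 0 (\<lambda>_::complex^3. 1::complex)" by (rule homog.const)
  have B0: "\<And>v. branch v = 1 * branch v" by simp
  have h0: "homog (6 - 0) branch" using homog_branch by simp
  obtain l1 E1 where 1: "l1 \<noteq> 0" "homog (Suc 0) (\<lambda>v. vdot l1 v * 1)" "homog (6 - Suc 0) E1"
    "\<And>v. branch v = (vdot l1 v * 1) * E1 v" "card {(b, t) \<in> N. vdot l1 b * 1 = 0} \<le> 5"
    by (rule peel_line'[OF one h0 _ B0, of 0]) auto
  obtain l2 E2 b2 where 2: "l2 \<noteq> 0" "homog (Suc (Suc 0)) (\<lambda>v. vdot l2 v * (vdot l1 v * 1))" "homog (6 - Suc (Suc 0)) E2"
    "\<And>v. branch v = (vdot l2 v * (vdot l1 v * 1)) * E2 v" "card {(b, t) \<in> N. vdot l2 b * (vdot l1 b * 1) = 0} \<le> 9"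
    and b2: "vdot l1 b2 \<noteq> 0" "vdot l2 b2 = 0"
    by (rule peel_line'[OF 1(2,3) _ 1(4,5)]) auto
  obtain l3 E3 b3 where 3: "l3 \<noteq> 0" "homog (Suc (Suc (Suc 0))) (\<lambda>v. vdot l3 v * (vdot l2 v * (vdot l1 v * 1)))" "homog (6 - Suc (Suc (Suc 0))) E3"
    "\<And>v. branch v = (vdot l3 v * (vdot l2 v * (vdot l1 v * 1))) * E3 v"
    "card {(b, t) \<in> N. vdot l3 b * (vdot l2 b * (vdot l1 b * 1)) = 0} \<le> 12"
    and b3: "vdot l1 b3 \<noteq> 0" "vdot l2 b3 \<noteq> 0" "vdot l3 b3 = 0"
    by (rule peel_line'[OF 2(2,3) _ 2(4,5)]) auto
  obtain l4 C b4 where 4: "l4 \<noteq> 0" "homog (6 - Suc (Suc (Suc (Suc 0)))) C"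
    "\<And>v. branch v = (vdot l4 v * (vdot l3 v * (vdot l2 v * (vdot l1 v * 1)))) * C v"
    and b4: "vdot l1 b4 \<noteq> 0" "vdot l2 b4 \<noteq> 0" "vdot l3 b4 \<noteq> 0" "vdot l4 b4 = 0"
    by (rule peel_line'[OF 3(2,3) _ 3(4,5)]) auto
  have hC: "homog 2 C" using 4(2) by (simp add: numeral_2_eq_2)
  have iso: "vdot l l = 0" if l: "l \<noteq> 0" and v: "\<And>v. vdot l v = 0 \<Longrightarrow> branch v = 0" for l
  proof -
    obtain E where "homog 5 E" "\<And>v. branch v = vdot l v * E v"
      using homog_factor[OF homog_branch l] v unfolding vdot_def by auto
    then show ?thesis using line_in_branch_isotropic[OF l] by blast
  qed
  have np: "l \<noteq> c *s l'" if "vdot l b = 0" "vdot l' b \<noteq> 0" "l \<noteq> 0" for l l' b c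
  proof
    assume *: "l = c *s l'"
    then have "c * vdot l' b = 0" using that(1) by (simp add: vdot_simps)
    then show False using that * by auto
  qed
  show ?thesis
  proof (intro exI conjI)
    show "homog 2 C" by fact
    show "\<forall>v. branch v = vdot l1 v * vdot l2 v * vdot l3 v * vdot l4 v * C v" by (simp add: 4(3) mult_ac)
    show "\<forall>l\<in>{l1, l2, l3, l4}. l \<noteq> 0 \<and> vdot l l = 0"
      using 1(1) 2(1) 3(1) 4(1) iso by (auto simp: 4(3))
    show "\<forall>c. l2 \<noteq> c *s l1 \<and> l3 \<noteq> c *s l1 \<and> l3 \<noteq> c *s l2 \<and> l4 \<noteq> c *s l1 \<and> l4 \<noteq> c *s l2 \<and> l4 \<noteq> c *s l3"
      using np[OF b2(2,1) 2(1)] np[OF b3(3,1) 3(1)] np[OF b3(3,2) 3(1)] np[OF b4(4,1) 4(1)] np[OF b4(4,2) 4(1)] np[OF b4(4,3) 4(1)] by blast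
  qed
qed

end

section \<open>The Igusa quartic in coordinates adapted to one of its singular lines\<close>

definition heron :: "complex \<Rightarrow> complex \<Rightarrow> complex \<Rightarrow> complex" where
  "heron u v w = (u + v + w) * (- u + v + w) * (u - v + w) * (u + v - w)"

definition polar_form :: "complex \<Rightarrow> complex \<Rightarrow> complex \<Rightarrow> complex \<Rightarrow> complex \<Rightarrow> complex \<Rightarrow> complex \<Rightarrow> complex" where
  "polar_form A B A' B' u v w = (A * A' + B * B' + (A + B) * (A' + B')) * (u * u + v * v + w * w)
     - 6 * (A * A' * (u * u) + B * B' * (v * v) + (A + B) * (A' + B') * (w * w))"

text \<open>Because of this identity the branch sextic of a section of the Igusa quartic, projected
  from a point of the singular line, is divisible by Heron's expression.\<close>

lemma polar_form_discriminant:
  "(polar_form A B A' B' u v w)\<^sup>2 - polar_form A B A B u v w * polar_form A' B' A' B' u v w = - 9 * (A * B' - A' * B)\<^sup>2 * heron u v w"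
  unfolding polar_form_def heron_def by algebra

lemma polar_form_quadratic:
  "polar_form (A * T + A' * m) (B * T + B' * m) (A * T + A' * m) (B * T + B' * m) u v w =
     polar_form A B A B u v w * T\<^sup>2 + 2 * polar_form A B A' B' u v w * m * T + polar_form A' B' A' B' u v w * m\<^sup>2"
  unfolding polar_form_def by algebra

lemma exhaust_5: "x = 1 \<or> x = 2 \<or> x = 3 \<or> x = 4 \<or> x = 5" for x :: 5
proof (induct x)
  case (of_int z)
  then have "z = 0 \<or> z = 1 \<or> z = 2 \<or> z = 3 \<or> z = 4" by fastforce
  then show ?case by auto
qed

lemma sum_5: "sum f (UNIV :: 5 set) = f 1 + f 2 + f 3 + f 4 + f 5"
proof -
  have U: "(UNIV :: 5 set) = {1, 2, 3, 4, 5}" using exhaust_5 by auto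
  show ?thesis unfolding U by (simp add: ac_simps)
qed

definition vec5 :: "'a \<Rightarrow> 'a \<Rightarrow> 'a \<Rightarrow> 'a \<Rightarrow> 'a \<Rightarrow> 'a^5" where
  "vec5 a b c d e = (\<chi> i. if i = 1 then a else if i = 2 then b else if i = 3 then c else if i = 4 then d else e)"

lemma vec5_nth [simp]:
  "vec5 a b c d e $ 1 = a" "vec5 a b c d e $ 2 = b" "vec5 a b c d e $ 3 = c" "vec5 a b c d e $ 4 = d" "vec5 a b c d e $ 5 = e"
  by (simp_all add: vec5_def)

lemma vec5_eq_iff: "x = y \<longleftrightarrow> x $ 1 = y $ 1 \<and> x $ 2 = y $ 2 \<and> x $ 3 = y $ 3 \<and> x $ 4 = y $ 4 \<and> x $ 5 = y $ 5" for x y :: "'a^5"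
proof
  assume e: "x $ 1 = y $ 1 \<and> x $ 2 = y $ 2 \<and> x $ 3 = y $ 3 \<and> x $ 4 = y $ 4 \<and> x $ 5 = y $ 5"
  have "x $ i = y $ i" for i using exhaust_5[of i] e by (elim disjE) simp_all
  then show "x = y" by (simp add: vec_eq_iff)
qed simp

text \<open>The coordinates are adapted to one of the singular lines of the Igusa quartic, \<open>u
  = v = w = 0\<close>. The sixth coordinate \<open>h\<close> is \<open>- (A + B) - w\<close>, so
  that the six coordinates form three pairs with opposite deviations from \<open>A\<close>,
  \<open>B\<close> and \<open>- (A + B)\<close>.\<close>

lemma igusa_adapted:
  "igusa_quartic (vec5 (A + u) (A - u) (B + v) (B - v) (w - (A + B))) = - 4 * (heron u v w + 2 * polar_form A B A B u v w)"
proof -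
  have "igusa_quartic (vec5 (A + u) (A - u) (B + v) (B - v) (w - (A + B))) =
    4 * ((A + u) ^ 4 + (A - u) ^ 4 + (B + v) ^ 4 + (B - v) ^ 4 + (w - (A + B)) ^ 4 + (- (A + B + w)) ^ 4)
     - ((A + u)\<^sup>2 + (A - u)\<^sup>2 + (B + v)\<^sup>2 + (B - v)\<^sup>2 + (w - (A + B))\<^sup>2 + (- (A + B + w))\<^sup>2)\<^sup>2"
    unfolding igusa_quartic_def Let_def sum_5 vec5_nth by (simp add: algebra_simps)
  also have "\<dots> = - 4 * (heron u v w + 2 * polar_form A B A B u v w)"
    unfolding polar_form_def heron_def by algebra
  finally show ?thesis .
qed

lemma ex_three_squares_sum_zero:
  fixes a b d :: complex
  assumes "2 * (a * b + b * d + d * a) = a\<^sup>2 + b\<^sup>2 + d\<^sup>2"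
  shows "\<exists>A B. A\<^sup>2 = a \<and> B\<^sup>2 = b \<and> (A + B)\<^sup>2 = d"
proof -
  define A where "A = csqrt a"
  define B where "B = csqrt b"
  have sq: "A\<^sup>2 = a" "B\<^sup>2 = b" by (simp_all add: A_def B_def)
  have "(2 * A * B - (d - a - b)) * (2 * A * B + (d - a - b)) = 4 * (A\<^sup>2 * B\<^sup>2) - (d - a - b)\<^sup>2" by algebra
  also have "\<dots> = 0" unfolding sq using assms by algebra
  finally consider "2 * A * B = d - a - b" | "2 * A * B = - (d - a - b)" by (auto simp: add_eq_0_iff2)
  then show ?thesis
  proof cases
    case 1
    have "(A + B)\<^sup>2 = A\<^sup>2 + B\<^sup>2 + 2 * A * B" by (rule power2_sum)
    then have "(A + B)\<^sup>2 = d" unfolding sq 1 by simp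
    then show ?thesis using sq by blast
  next
    case 2
    have "(A + - B)\<^sup>2 = A\<^sup>2 + B\<^sup>2 - 2 * A * B" by algebra
    then have "(A + - B)\<^sup>2 = d" unfolding sq 2 by simp
    moreover have "(- B)\<^sup>2 = b" using sq by simp
    ultimately show ?thesis using sq by blast
  qed
qed

lemma ex_polar_form:
  assumes "\<alpha> * \<beta> + \<beta> * \<gamma> + \<gamma> * \<alpha> = 0" "\<alpha> \<noteq> 0"
  shows "\<exists>A B A' B'. A * B' - A' * B = 1 \<and> (\<forall>u v w. polar_form A B A B u v w = \<alpha> * (u * u) + \<beta> * (v * v) + \<gamma> * (w * w))"
proof -
  define S where "S = - (\<alpha> + \<beta> + \<gamma>) / 3"
  have S: "\<alpha> + \<beta> + \<gamma> = - 3 * S" by (simp add: S_def)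
  define a b d where "a = (S - \<alpha>) / 6" and "b = (S - \<beta>) / 6" and "d = (S - \<gamma>) / 6"
  have abd: "\<alpha> = S - 6 * a" "\<beta> = S - 6 * b" "\<gamma> = S - 6 * d" by (simp_all add: a_def b_def d_def)
  have sum: "a + b + d = S"
  proof -
    have "6 * (a + b + d) = 3 * S - (\<alpha> + \<beta> + \<gamma>)" by (simp add: abd)
    then have "6 * (a + b + d) = 6 * S" unfolding S by simp
    then show ?thesis by (simp del: distrib_left_numeral)
  qed
  have "2 * (a * b + b * d + d * a) = a\<^sup>2 + b\<^sup>2 + d\<^sup>2"
  proof -
    have "36 * (a * b + b * d + d * a) - 12 * S * (a + b + d) + 3 * S\<^sup>2 = 0" using assms(1) unfolding abd by algebra
    then have "36 * (a * b + b * d + d * a) = 9 * S\<^sup>2" unfolding sum by algebra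
    then have "9 * (4 * (a * b + b * d + d * a)) = 9 * S\<^sup>2" by algebra
    then have 1: "4 * (a * b + b * d + d * a) = S\<^sup>2" by (simp del: distrib_left_numeral)
    have 2: "S\<^sup>2 = a\<^sup>2 + b\<^sup>2 + d\<^sup>2 + 2 * (a * b + b * d + d * a)" unfolding sum[symmetric] by algebra
    show ?thesis using 1 2 by algebra
  qed
  then obtain A B where AB: "A\<^sup>2 = a" "B\<^sup>2 = b" "(A + B)\<^sup>2 = d" using ex_three_squares_sum_zero by blast
  have pf: "polar_form A B A B u v w = \<alpha> * (u * u) + \<beta> * (v * v) + \<gamma> * (w * w)" for u v w
  proof -
    have "polar_form A B A B u v w = (A\<^sup>2 + B\<^sup>2 + (A + B)\<^sup>2) * (u * u + v * v + w * w) - 6 * (A\<^sup>2 * (u * u) + B\<^sup>2 * (v * v) + (A + B)\<^sup>2 * (w * w))"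
      unfolding polar_form_def power2_eq_square ..
    also have "\<dots> = \<alpha> * (u * u) + \<beta> * (v * v) + \<gamma> * (w * w)" unfolding AB sum abd by algebra
    finally show ?thesis .
  qed
  have "A \<noteq> 0 \<or> B \<noteq> 0"
  proof (rule ccontr)
    assume "\<not> ?thesis"
    then have "a = 0" "b = 0" "d = 0" using AB by auto
    then have "\<alpha> = 0" using sum abd by simp
    then show False using assms(2) by simp
  qed
  then obtain A' B' where "A * B' - A' * B = 1"
  proof
    assume "A \<noteq> 0" then show thesis using that[of "inverse A" 0] by simp
  next
    assume "B \<noteq> 0" then show thesis using that[of 0 "- inverse B"] by simp
  qed
  then show ?thesis using pf by blast
qed

lemma vdet_gram:
  "(vdet a b c)\<^sup>2 = vdot a a * vdot b b * vdot c c + 2 * vdot a b * vdot b c * vdot a c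
     - vdot a a * (vdot b c)\<^sup>2 - vdot b b * (vdot a c)\<^sup>2 - vdot c c * (vdot a b)\<^sup>2"
  unfolding vdet_def vdot_3 vcross_nth by algebra

lemma isotropic_not_orthogonal:
  assumes "vdot a a = 0" "vdot b b = 0" "a \<noteq> 0" "b \<noteq> 0" "\<And>c. b \<noteq> c *s a"
  shows "vdot a b \<noteq> 0"
proof
  assume ab: "vdot a b = 0"
  have c: "vcross a b \<noteq> 0" using vcross_eq_0_imp_proportional assms by blast
  obtain k where k: "a = k *s vcross a b" using orthogonal_to_two[OF c assms(1)] ab vdot_commute by metis
  obtain k' where k': "b = k' *s vcross a b" using orthogonal_to_two[OF c ab assms(2)] by blast
  have "k \<noteq> 0" using k assms(3) by auto
  have "b = k' *s (inverse k *s (k *s vcross a b))" using \<open>k \<noteq> 0\<close> k' by (simp add: vector_smult_assoc)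
  also have "\<dots> = (k' * inverse k) *s a" using k by (simp add: vector_smult_assoc)
  finally show False using assms(5) by blast
qed

text \<open>The diagonal triangle of the quadrilateral formed by four tangent lines is self-polar with respect to
  the conic; its sides \<open>U\<close>, \<open>V\<close>, \<open>W\<close> are the arguments of Heron's expression.\<close>

lemma four_isotropic_normal_form:
  assumes iso: "\<forall>l\<in>{l1, l2, l3, l4}. l \<noteq> 0 \<and> vdot l l = 0"
    and np: "\<forall>c. l2 \<noteq> c *s l1 \<and> l3 \<noteq> c *s l1 \<and> l3 \<noteq> c *s l2 \<and> l4 \<noteq> c *s l1 \<and> l4 \<noteq> c *s l2 \<and> l4 \<noteq> c *s l3"
  shows "\<exists>U V W k. k \<noteq> 0 \<and> vdot U V = 0 \<and> vdot U W = 0 \<and> vdot V W = 0 \<and> vdot U U \<noteq> 0 \<and> vdot V V \<noteq> 0 \<and> vdot W W \<noteq> 0 \<and>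
     vdot U U + vdot V V + vdot W W = 0 \<and>
     (\<forall>x. vdot l1 x * vdot l2 x * vdot l3 x * vdot l4 x = k * heron (vdot U x) (vdot V x) (vdot W x))"
proof -
  have g: "vdot l1 l2 \<noteq> 0" "vdot l1 l3 \<noteq> 0" "vdot l2 l3 \<noteq> 0" "vdot l1 l4 \<noteq> 0" "vdot l2 l4 \<noteq> 0" "vdot l3 l4 \<noteq> 0"
    by (rule isotropic_not_orthogonal; use iso np in blast)+
  have z: "vdot l1 l1 = 0" "vdot l2 l2 = 0" "vdot l3 l3 = 0" "vdot l4 l4 = 0" using iso by auto
  have nz: "vdet a b c \<noteq> 0" if "vdot a a = 0" "vdot b b = 0" "vdot c c = 0" "vdot a b \<noteq> 0" "vdot b c \<noteq> 0" "vdot a c \<noteq> 0" for a b c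
    using vdet_gram[of a b c] that by auto
  define d where "d = vdet l1 l2 l3"
  have d: "d \<noteq> 0" unfolding d_def by (rule nz[OF z(1,2,3) g(1,3,2)])
  define x1 x2 x3 where "x1 = vdet l4 l2 l3" and "x2 = vdet l1 l4 l3" and "x3 = vdet l1 l2 l4"
  have x: "x1 \<noteq> 0" "x2 \<noteq> 0" "x3 \<noteq> 0"
    unfolding x1_def x2_def x3_def
    using nz[OF z(4,2,3)] nz[OF z(1,4,3)] nz[OF z(1,2,4)] g by (simp_all add: vdot_commute)
  have cr: "d *s l4 = x1 *s l1 + x2 *s l2 + x3 *s l3" unfolding d_def x1_def x2_def x3_def by (rule vdet_cramer)
  define m1 m2 m3 m4 where "m1 = (- x1) *s l1" and "m2 = (- x2) *s l2" and "m3 = (- x3) *s l3" and "m4 = d *s l4"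
  have m4: "m4 = - (m1 + m2 + m3)" unfolding m4_def cr m1_def m2_def m3_def by (simp add: vec_eq_iff)
  have mz: "vdot m1 m1 = 0" "vdot m2 m2 = 0" "vdot m3 m3 = 0" "vdot m4 m4 = 0"
    unfolding m1_def m2_def m3_def m4_def by (simp_all add: vdot_simps z)
  have mg: "vdot m1 m2 \<noteq> 0" "vdot m1 m3 \<noteq> 0" "vdot m2 m3 \<noteq> 0"
    unfolding m1_def m2_def m3_def using g x by (simp_all add: vdot_simps)
  have s: "vdot m1 m2 + vdot m1 m3 + vdot m2 m3 = 0"
  proof -
    have "2 * (vdot m1 m2 + vdot m1 m3 + vdot m2 m3) = vdot m4 m4"
      unfolding m4 by (simp add: vdot_simps mz vdot_commute[of m2 m1] vdot_commute[of m3 m1] vdot_commute[of m3 m2])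
    then show ?thesis unfolding mz by (simp del: distrib_left_numeral)
  qed
  define U V W where "U = (1 / 2) *s (m2 + m3)" and "V = (1 / 2) *s (m1 + m3)" and "W = (1 / 2) *s (m1 + m2)"
  note c = vdot_commute[of m2 m1] vdot_commute[of m3 m1] vdot_commute[of m3 m2]
  have UV: "4 * vdot U V = vdot m1 m2 + vdot m1 m3 + vdot m2 m3" "4 * vdot U W = vdot m1 m2 + vdot m1 m3 + vdot m2 m3"
    "4 * vdot V W = vdot m1 m2 + vdot m1 m3 + vdot m2 m3"
    unfolding U_def V_def W_def by (simp_all add: vdot_simps mz c)
  have UU: "vdot U U = vdot m2 m3 / 2" "vdot V V = vdot m1 m3 / 2" "vdot W W = vdot m1 m2 / 2"
    unfolding U_def V_def W_def by (simp_all add: vdot_simps mz c)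
  have m: "vdot m1 y = vdot V y + vdot W y - vdot U y" "vdot m2 y = vdot U y + vdot W y - vdot V y"
    "vdot m3 y = vdot U y + vdot V y - vdot W y" "vdot m4 y = - (vdot U y + vdot V y + vdot W y)" for y
    unfolding U_def V_def W_def m4 by (simp_all add: vdot_simps)
  show ?thesis
  proof (intro exI conjI allI)
    show "inverse (x1 * x2 * x3 * d) \<noteq> 0" using x d by simp
    show "vdot U V = 0" "vdot U W = 0" "vdot V W = 0" using UV s by simp_all
    show "vdot U U \<noteq> 0" "vdot V V \<noteq> 0" "vdot W W \<noteq> 0" unfolding UU using mg by simp_all
    have "vdot U U + vdot V V + vdot W W = (vdot m1 m2 + vdot m1 m3 + vdot m2 m3) / 2" unfolding UU by (simp add: add_divide_distrib)
    then show "vdot U U + vdot V V + vdot W W = 0" using s by simp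
    fix y
    have "(- (x1 * x2 * x3 * d)) * (vdot l1 y * vdot l2 y * vdot l3 y * vdot l4 y) = vdot m1 y * vdot m2 y * vdot m3 y * vdot m4 y"
      unfolding m1_def m2_def m3_def m4_def vdot_simps by algebra
    also have "\<dots> = - heron (vdot U y) (vdot V y) (vdot W y)" unfolding m heron_def by algebra
    finally have "(x1 * x2 * x3 * d) * (vdot l1 y * vdot l2 y * vdot l3 y * vdot l4 y) = heron (vdot U y) (vdot V y) (vdot W y)" by simp
    then have "inverse (x1 * x2 * x3 * d) * ((x1 * x2 * x3 * d) * (vdot l1 y * vdot l2 y * vdot l3 y * vdot l4 y)) =
        inverse (x1 * x2 * x3 * d) * heron (vdot U y) (vdot V y) (vdot W y)" by (rule arg_cong)
    moreover have "inverse (x1 * x2 * x3 * d) * (x1 * x2 * x3 * d) = 1" by (rule left_inverse) (use x d in simp)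
    ultimately show "vdot l1 y * vdot l2 y * vdot l3 y * vdot l4 y = inverse (x1 * x2 * x3 * d) * heron (vdot U y) (vdot V y) (vdot W y)"
      by (metis mult.assoc mult_1)
  qed
qed

lemma orthogonal_expansion:
  assumes "vdot U V = 0" "vdot U W = 0" "vdot V W = 0" "vdot U U \<noteq> 0" "vdot V V \<noteq> 0" "vdot W W \<noteq> 0"
  shows "x = (vdot U x / vdot U U) *s U + (vdot V x / vdot V V) *s V + (vdot W x / vdot W W) *s W"
proof -
  have d: "vdet U V W \<noteq> 0" using vdet_gram[of U V W] assms by auto
  define y where "y = x - ((vdot U x / vdot U U) *s U + (vdot V x / vdot V V) *s V + (vdot W x / vdot W W) *s W)"
  have y: "vdot U y = 0" "vdot V y = 0" "vdot W y = 0"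
    using assms unfolding y_def by (simp_all add: vdot_simps vdot_commute[of V U] vdot_commute[of W U] vdot_commute[of W V])
  have "vdot y w = 0" for w
  proof -
    have "vdet U V W * vdot y w = vdot y (vdet U V W *s w)" by (simp add: vdot_simps)
    also have "\<dots> = 0" by (subst vdet_cramer) (simp add: vdot_simps y vdot_commute[of y U] vdot_commute[of y V] vdot_commute[of y W])
    finally show ?thesis using d by simp
  qed
  then have "y = 0" by (rule vdot_nondegenerate)
  then show ?thesis by (simp add: y_def)
qed

lemma conic_point_not_on_line:
  assumes "l \<noteq> 0" shows "finite {s. vdot l (conic_point s) = 0}"
proof -
  define p where "p = [:- l $ 1 + \<i> * l $ 2, 2 * l $ 3, l $ 1 + \<i> * l $ 2:]"
  have p: "poly p s = vdot l (conic_point s)" for s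
    by (simp add: p_def vdot_3 power2_eq_square algebra_simps)
  have "p \<noteq> 0"
  proof
    assume "p = 0"
    then have 1: "- l $ 1 + \<i> * l $ 2 = 0" "l $ 1 + \<i> * l $ 2 = 0" "2 * l $ 3 = 0"
      unfolding p_def pCons_eq_0_iff by blast+
    have "2 * (\<i> * l $ 2) = (- l $ 1 + \<i> * l $ 2) + (l $ 1 + \<i> * l $ 2)" by simp
    also have "\<dots> = 0" unfolding 1 by simp
    finally have 2: "l $ 2 = 0" by simp
    then have "l $ 1 = 0" using 1(2) by simp
    then show False using 1(3) 2 assms by (simp add: vec3_eq_iff)
  qed
  then have "finite {s. poly p s = 0}" by (rule poly_roots_finite)
  then show ?thesis by (simp add: p)
qed

lemma homog_on_conic_poly:
  assumes "homog d f" shows "\<exists>p. degree p \<le> 2 * d \<and> (\<forall>s. poly p s = f (conic_point s))"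
  using assms
proof induction
  case (const c) then show ?case by (intro exI[of _ "[:c:]"]) simp
next
  case (coord i)
  consider "i = 1" | "i = 2" | "i = 3" using exhaust_3 by blast
  then show ?case
  proof cases
    case 1 then show ?thesis by (intro exI[of _ "[:-1, 0, 1:]"]) (simp add: power2_eq_square)
  next
    case 2 then show ?thesis by (intro exI[of _ "[:\<i>, 0, \<i>:]"]) (simp add: power2_eq_square algebra_simps)
  next
    case 3 then show ?thesis by (intro exI[of _ "[:0, 2:]"]) simp
  qed
next
  case (add d f g)
  then obtain p q where "degree p \<le> 2 * d \<and> (\<forall>s. poly p s = f (conic_point s))" "degree q \<le> 2 * d \<and> (\<forall>s. poly q s = g (conic_point s))" by blast
  then show ?case by (intro exI[of _ "p + q"]) (auto intro: degree_add_le)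
next
  case (mult d f e g)
  then obtain p q where "degree p \<le> 2 * d \<and> (\<forall>s. poly p s = f (conic_point s))" "degree q \<le> 2 * e \<and> (\<forall>s. poly q s = g (conic_point s))" by blast
  then show ?case using degree_mult_le[of p q] by (intro exI[of _ "p * q"]) auto
qed

lemma linear_form_with_values:
  assumes "degree r \<le> 2" shows "\<exists>\<mu>. \<forall>s. vdot \<mu> (conic_point s) = poly r s"
proof -
  define a b c where "a = coeff r 2 / 2" and "b = coeff r 0 / 2" and "c = coeff r 1 / 2"
  have abc: "coeff r 2 = 2 * a" "coeff r 0 = 2 * b" "coeff r 1 = 2 * c" by (simp_all add: a_def b_def c_def)
  define \<mu> :: "complex^3" where "\<mu> = vector [a - b, - \<i> * (a + b), c]"
  have "vdot \<mu> (conic_point s) = poly r s" for s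
  proof -
    have i: "- \<i> * z * (\<i> * y) = z * y" for z y :: complex
    proof -
      have "- \<i> * z * (\<i> * y) = - (\<i> * \<i>) * (z * y)" by algebra
      then show ?thesis by simp
    qed
    have "{..2::nat} = {0, 1, 2}" by auto
    then have "poly r s = coeff r 0 + coeff r 1 * s + coeff r 2 * s\<^sup>2"
      using poly_eq_sum_le[OF assms, of s] by simp
    also have "\<dots> = (a - b) * (s\<^sup>2 - 1) + (a + b) * (s\<^sup>2 + 1) + c * (2 * s)" unfolding abc by algebra
    also have "\<dots> = vdot \<mu> (conic_point s)"
      unfolding vdot_3 conic_point_nth \<mu>_def vector_3 i ..
    finally show ?thesis by (rule sym)
  qed
  then show ?thesis by blast
qed

context nodes15
begin

text \<open>A squared linear factor would make every point of a line a double point of the branch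
  curve.\<close>

lemma branch_not_square_multiple:
  assumes m: "homog d m" "homog d' h" and B: "\<And>v. branch v = vdot \<mu> v * (h v * vdot \<mu> v)"
  shows False
proof (cases "\<mu> = 0")
  case True
  then show ?thesis using branch_nonzero B by (simp add: vdot_simps)
next
  case False
  then obtain i where i: "\<mu> $ i \<noteq> 0" by (auto simp: vec_eq_iff)
  obtain j k where jk: "j \<noteq> i" "k \<noteq> i" "j \<noteq> k"
  proof -
    have "(1::3) \<noteq> 2" "(1::3) \<noteq> 3" "(2::3) \<noteq> 3" by simp_all
    then show thesis using that exhaust_3[of i] by metis
  qed
  define f where "f = \<mu> $ i *s axis j 1 - \<mu> $ j *s axis i 1"
  define g where "g = \<mu> $ i *s axis k 1 - \<mu> $ k *s axis i 1"
  have z: "vdot \<mu> (f + s *s g) = 0" for s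
    by (simp add: f_def g_def vdot_simps vdot_axis)
  have fj: "(f + s *s g) $ j = \<mu> $ i" and fk: "(f + s *s g) $ k = s * \<mu> $ i" for s
    using jk by (auto simp: f_def g_def axis_def)
  have Bfun: "branch = (\<lambda>v. vdot \<mu> v * (h v * vdot \<mu> v))" using B by blast
  have "finite (UNIV :: complex set)"
  proof (rule double_family_finite)
    fix s :: complex
    have "D1 branch (f + s *s g) w = 0" for w
      unfolding Bfun D1_mult[OF homog_vdot homog.mult[OF m(2) homog_vdot]] by (simp add: z)
    moreover have "f + s *s g \<noteq> 0" using fj[of s] i by (metis zero_index)
    ultimately show "f + s *s g \<noteq> 0 \<and> double_at branch (f + s *s g)" by (simp add: double_at_def B z)
  next
    fix x y c assume eq: "f + x *s g = c *s (f + y *s g)"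
    have "(f + x *s g) $ j = c * (f + y *s g) $ j" "(f + x *s g) $ k = c * (f + y *s g) $ k"
      by (simp_all only: eq vector_smult_component)
    then show "x = y" unfolding fj fk using i by simp
  qed
  then show False using infinite_UNIV_char_0 by blast
qed

text \<open>On the conic a tangent line restricts to a square and so does the sextic; hence the
  residual conic of the sextic is there the square of a linear form. The four tangent lines can be
  written as Heron's expression in three orthogonal linear forms. Comparing the quartic with the
  Igusa quartic in the adapted coordinates then amounts to choosing the hyperplane and a shift of
  \<open>t\<close>.\<close>

theorem igusa_normal_form:
  "\<exists>(R :: 5 \<Rightarrow> complex^3) (s :: 5 \<Rightarrow> complex) (a :: complex^5) c. a \<noteq> 0 \<and> c \<noteq> 0 \<and>
     (\<forall>v t. quartic v t = c * igusa_quartic (\<chi> i. vdot (R i) v + s i * t)) \<and>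
     (\<forall>v t. (\<chi> i. vdot (R i) v + s i * t) = 0 \<longrightarrow> v = 0 \<and> t = 0) \<and>
     (\<forall>x. (\<Sum>i\<in>UNIV. a $ i * x $ i) = 0 \<longleftrightarrow> (\<exists>v t. x = (\<chi> i. vdot (R i) v + s i * t)))"
proof -
  obtain l1 l2 l3 l4 C where C: "homog 2 C" and BC: "\<And>v. branch v = vdot l1 v * vdot l2 v * vdot l3 v * vdot l4 v * C v"
    and l: "\<forall>l\<in>{l1, l2, l3, l4}. l \<noteq> 0 \<and> vdot l l = 0"
    and np: "\<forall>c. l2 \<noteq> c *s l1 \<and> l3 \<noteq> c *s l1 \<and> l3 \<noteq> c *s l2 \<and> l4 \<noteq> c *s l1 \<and> l4 \<noteq> c *s l2 \<and> l4 \<noteq> c *s l3"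
    using branch_decomposition by blast
  obtain U V W k where k: "k \<noteq> 0" and orth: "vdot U V = 0" "vdot U W = 0" "vdot V W = 0"
    and nz: "vdot U U \<noteq> 0" "vdot V V \<noteq> 0" "vdot W W \<noteq> 0" and sum0: "vdot U U + vdot V V + vdot W W = 0"
    and lh: "\<And>x. vdot l1 x * vdot l2 x * vdot l3 x * vdot l4 x = k * heron (vdot U x) (vdot V x) (vdot W x)"
    using four_isotropic_normal_form[OF l np] by blast
  define H where "H v = heron (vdot U v) (vdot V v) (vdot W v)" for v
  define C' where "C' v = k * C v" for v
  have hC': "homog 2 C'" unfolding C'_def by (rule homog_scaleC[OF C])
  have BH: "branch v = H v * C' v" for v unfolding BC lh H_def C'_def by (simp only: mult_ac)
  have hU: "homog 1 (vdot X)" for X using homog_vdot by simp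
  have h1: "homog 1 (\<lambda>v. vdot X v + vdot Y v + vdot Z v)" "homog 1 (\<lambda>v. - vdot X v + vdot Y v + vdot Z v)"
    "homog 1 (\<lambda>v. vdot X v - vdot Y v + vdot Z v)" "homog 1 (\<lambda>v. vdot X v + vdot Y v - vdot Z v)" for X Y Z
    using homog_scaleC[OF hU[of X], of "-1"] by (auto intro!: homog.add homog_diff homog_vdot)
  have hH: "homog 4 H"
    using homog.mult[OF homog.mult[OF homog.mult[OF h1(1,2)] h1(3)] h1(4), of U V W U V W U V W U V W]
    unfolding H_def[abs_def] heron_def by (simp add: numeral_eq_Suc)
  define \<alpha> \<beta> \<gamma> where "\<alpha> = inverse (vdot U U)" and "\<beta> = inverse (vdot V V)" and "\<gamma> = inverse (vdot W W)"
  have abg: "\<alpha> * \<beta> + \<beta> * \<gamma> + \<gamma> * \<alpha> = 0"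
  proof -
    have "\<alpha> * \<beta> + \<beta> * \<gamma> + \<gamma> * \<alpha> = (vdot U U + vdot V V + vdot W W) * (\<alpha> * \<beta> * \<gamma>)"
    proof -
      have i: "vdot U U * \<alpha> = 1" "vdot V V * \<beta> = 1" "vdot W W * \<gamma> = 1" using nz by (simp_all add: \<alpha>_def \<beta>_def \<gamma>_def)
      have "(vdot U U + vdot V V + vdot W W) * (\<alpha> * \<beta> * \<gamma>) =
        (vdot U U * \<alpha>) * (\<beta> * \<gamma>) + (vdot V V * \<beta>) * (\<alpha> * \<gamma>) + (vdot W W * \<gamma>) * (\<alpha> * \<beta>)" by algebra
      then show ?thesis unfolding i by (simp add: mult_ac)
    qed
    then show ?thesis using sum0 by simp
  qed
  have \<alpha>0: "\<alpha> \<noteq> 0" using nz by (simp add: \<alpha>_def)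
  obtain A B A' B' where det1: "A * B' - A' * B = 1"
    and pf: "\<And>u v w. polar_form A B A B u v w = \<alpha> * (u * u) + \<beta> * (v * v) + \<gamma> * (w * w)"
    using ex_polar_form[OF abg \<alpha>0] by blast
  define K where "K A B A' B' v = polar_form A B A' B' (vdot U v) (vdot V v) (vdot W v)" for A B A' B' v
  have hK: "homog 2 (K a b a' b')" for a b a' b'
  proof -
    have sq: "homog 2 (\<lambda>v. vdot X v * vdot X v)" for X using homog.mult[OF hU hU] by (simp add: numeral_2_eq_2)
    show ?thesis unfolding K_def[abs_def] polar_form_def
      by (intro homog_diff homog_scaleC homog.add sq)
  qed
  have expand: "v = (vdot U v * \<alpha>) *s U + (vdot V v * \<beta>) *s V + (vdot W v * \<gamma>) *s W" for v
    using orthogonal_expansion[OF orth nz, of v] by (simp add: \<alpha>_def \<beta>_def \<gamma>_def divide_inverse)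
  have q2K: "q2 v = K A B A B v" for v
  proof -
    have "vdot v v = vdot v ((vdot U v * \<alpha>) *s U + (vdot V v * \<beta>) *s V + (vdot W v * \<gamma>) *s W)" using expand[of v] by metis
    also have "\<dots> = \<alpha> * (vdot U v * vdot U v) + \<beta> * (vdot V v * vdot V v) + \<gamma> * (vdot W v * vdot W v)"
      by (simp add: vdot_simps vdot_commute[of v U] vdot_commute[of v V] vdot_commute[of v W] mult_ac)
    finally show ?thesis unfolding q2_def K_def pf .
  qed
  have disc: "(K A B A' B' v)\<^sup>2 - q2 v * K A' B' A' B' v = - 9 * H v" for v
    using polar_form_discriminant[of A B A' B' "vdot U v" "vdot V v" "vdot W v"] unfolding q2K unfolding K_def det1 H_def by simp

  \<comment> \<open>on the conic, \<open>C'\<close> is a square\<close>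
  obtain pk where pk: "\<And>s. poly pk s = K A B A' B' (conic_point s)" using homog_on_conic_poly[OF hK] by blast
  obtain pc where pc: "\<And>s. poly pc s = C' (conic_point s)" "degree pc \<le> 4" using homog_on_conic_poly[OF hC'] by auto
  obtain p3 where p3: "\<And>s. poly p3 s = q3 (conic_point s)" using homog_on_conic_poly[OF hq3] by blast
  have q2c: "q2 (conic_point s) = 0" for s by (simp add: q2_def conic_point_isotropic)
  have pk0: "pk \<noteq> 0"
  proof
    assume "pk = 0"
    then have "H (conic_point s) = 0" for s using disc[of "conic_point s"] pk[of s] q2c by simp
    then have "\<exists>l\<in>{l1, l2, l3, l4}. vdot l (conic_point s) = 0" for s
      using lh[of "conic_point s"] unfolding H_def by auto
    then have "UNIV \<subseteq> (\<Union>l\<in>{l1, l2, l3, l4}. {s. vdot l (conic_point s) = 0})" by auto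
    moreover have "finite (\<Union>l\<in>{l1, l2, l3, l4}. {s. vdot l (conic_point s) = 0})"
      using l conic_point_not_on_line by (intro finite_UN_I) auto
    ultimately show False using infinite_UNIV_char_0 finite_subset by blast
  qed
  define p3' where "p3' = smult (3 * \<i>) p3"
  have sq: "pk\<^sup>2 * pc = p3'\<^sup>2"
  proof -
    have "poly (pk\<^sup>2 * pc) s = poly (p3'\<^sup>2) s" for s
    proof -
      let ?v = "conic_point s"
      have 1: "(K A B A' B' ?v)\<^sup>2 = - 9 * H ?v" using disc[of ?v] q2c[of s] by simp
      have 2: "q3 ?v * q3 ?v = H ?v * C' ?v" using BH[of ?v] q2c[of s] by (simp add: branch_def)
      have "(3 * \<i> * q3 ?v)\<^sup>2 = - 9 * (q3 ?v * q3 ?v)" by (simp add: power_mult_distrib power2_eq_square)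
      then show ?thesis by (simp add: pk pc p3'_def p3 1 2)
    qed
    then show ?thesis by (simp add: poly_eq_poly_eq_iff[symmetric] fun_eq_iff)
  qed
  then have "pk\<^sup>2 dvd p3'\<^sup>2" by (metis dvd_triv_left)
  then have "pk dvd p3'" by (simp add: pow_divides_pow_iff)
  then obtain r where r: "p3' = pk * r" by (auto elim: dvdE)
  have "pk\<^sup>2 * pc = pk\<^sup>2 * r\<^sup>2" using sq unfolding r by (simp add: power_mult_distrib)
  then have pcr: "pc = r\<^sup>2" using pk0 by simp
  have "degree r \<le> 2"
    using pc(2) unfolding pcr by (cases "r = 0") (simp_all add: degree_power_eq)
  then obtain \<nu> where \<nu>: "\<And>s. vdot \<nu> (conic_point s) = poly r s" using linear_form_with_values by blast
  define \<mu> where "\<mu> = inverse (3 * \<i>) *s \<nu>"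
  define m where "m v = vdot \<mu> v" for v
  have \<nu>m: "vdot \<nu> v = 3 * \<i> * m v" for v by (simp add: m_def \<mu>_def vdot_simps)
  have hm: "homog 1 m" unfolding m_def[abs_def] by (rule hU)
  have hmm: "homog 2 (\<lambda>v. m v * m v)" using homog.mult[OF hm hm] by (simp add: numeral_2_eq_2)
  have "\<exists>g. homog (2 - 2) g \<and> (\<forall>v. C' v - (- 9) * (m v * m v) = vdot v v * g v)"
  proof (rule homog_vanishing_on_conic)
    show "homog 2 (\<lambda>v. C' v - (- 9) * (m v * m v))" by (intro homog_diff hC' homog_scaleC hmm)
    fix s
    have "C' (conic_point s) = (vdot \<nu> (conic_point s))\<^sup>2" using pc(1)[of s] unfolding pcr \<nu> by simp
    also have "\<dots> = (- 9) * (m (conic_point s) * m (conic_point s))" unfolding \<nu>m by (simp add: power_mult_distrib power2_eq_square)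
    finally show "C' (conic_point s) - (- 9) * (m (conic_point s) * m (conic_point s)) = 0" by simp
  qed
  then obtain c0f where c0f: "homog 0 c0f" "\<And>v. C' v - (- 9) * (m v * m v) = vdot v v * c0f v" by auto
  then obtain c0 where "c0f = (\<lambda>_. c0)" using homog_zero_const by blast
  then have C'eq: "C' v = - 9 * (m v * m v) + c0 * q2 v" for v using c0f(2)[of v] by (simp add: q2_def algebra_simps)
  have "\<exists>g. homog (3 - 2) g \<and> (\<forall>v. q3 v - K A B A' B' v * m v = vdot v v * g v)"
  proof (rule homog_vanishing_on_conic)
    show "homog 3 (\<lambda>v. q3 v - K A B A' B' v * m v)" using homog_diff[OF hq3] homog.mult[OF hK hm] by simp
    fix s
    have "3 * \<i> * q3 (conic_point s) = poly p3' s" by (simp add: p3'_def p3)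
    also have "\<dots> = K A B A' B' (conic_point s) * (3 * \<i> * m (conic_point s))" unfolding r poly_mult pk \<nu>[symmetric] \<nu>m ..
    also have "\<dots> = 3 * \<i> * (K A B A' B' (conic_point s) * m (conic_point s))" by (simp only: mult_ac)
    finally have "q3 (conic_point s) = K A B A' B' (conic_point s) * m (conic_point s)"
      by (simp only: mult_cancel_left) simp
    then show "q3 (conic_point s) - K A B A' B' (conic_point s) * m (conic_point s) = 0" by simp
  qed
  then obtain n0 where n0: "homog 1 n0" "\<And>v. q3 v - K A B A' B' v * m v = vdot v v * n0 v" by auto
  obtain n where n: "\<And>v. n0 v = vdot n v" using homog_one_linear[OF n0(1)] by (auto simp: vdot_def)
  have q3eq: "q3 v = K A B A' B' v * m v + q2 v * vdot n v" for v using n0(2)[of v] by (simp add: n q2_def algebra_simps)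
  have c0: "c0 \<noteq> 0"
  proof
    assume "c0 = 0"
    then have "branch v = vdot \<mu> v * ((- 9 * H v) * vdot \<mu> v)" for v
      unfolding BH C'eq m_def by (simp add: mult_ac)
    then show False using branch_not_square_multiple[OF hm homog_scaleC[OF hH]] by blast
  qed
  define rest where "rest v = K A' B' A' B' v * (m v * m v) + 2 * (K A B A' B' v * (m v * vdot n v)) + q2 v * (vdot n v * vdot n v) - c0 * H v" for v
  have q4eq: "q4 v = rest v" for v
  proof -
    have hmn: "homog 2 (\<lambda>v. m v * vdot n v)" "homog 2 (\<lambda>v. vdot n v * vdot n v)"
      using homog.mult[OF hm hU] homog.mult[OF hU hU] by (simp_all add: numeral_2_eq_2)
    have m22: "homog 4 (\<lambda>v. f v * g v)" if "homog 2 f" "homog 2 g" for f g :: "complex^3 \<Rightarrow> complex"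
      using homog.mult[OF that] by simp
    have hr: "homog 4 rest" unfolding rest_def[abs_def]
      by (intro homog_diff homog.add homog_scaleC hH m22 hK hmm hmn hq2)
    have "q2 v * (q4 v - rest v) = 0" for v
    proof -
      have "q2 v * q4 v = q3 v * q3 v - H v * C' v" using BH[of v] by (simp add: branch_def algebra_simps)
      then show ?thesis using disc[of v] unfolding rest_def q3eq C'eq by algebra
    qed
    then have "(q4 v - rest v) * q2 v = 0" for v by (metis mult.commute)
    moreover have "q2 U \<noteq> 0" using nz by (simp add: q2_def)
    ultimately have "q4 v - rest v = 0" by (rule homog_domain[OF homog_diff[OF hq4 hr] hq2])
    then show ?thesis by simp
  qed
  have quartic_eq: "quartic v t = polar_form (A * (t + vdot n v) + A' * m v) (B * (t + vdot n v) + B' * m v)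
      (A * (t + vdot n v) + A' * m v) (B * (t + vdot n v) + B' * m v) (vdot U v) (vdot V v) (vdot W v) - c0 * H v" for v t
  proof -
    have "quartic v t = q2 v * t\<^sup>2 + 2 * (K A B A' B' v * m v + q2 v * vdot n v) * t + rest v"
      unfolding quartic_def q3eq q4eq ..
    also have "\<dots> = q2 v * (t + vdot n v)\<^sup>2 + 2 * K A B A' B' v * m v * (t + vdot n v) + K A' B' A' B' v * (m v)\<^sup>2 - c0 * H v"
      unfolding rest_def by algebra
    also have "\<dots> = polar_form (A * (t + vdot n v) + A' * m v) (B * (t + vdot n v) + B' * m v)
      (A * (t + vdot n v) + A' * m v) (B * (t + vdot n v) + B' * m v) (vdot U v) (vdot V v) (vdot W v) - c0 * H v"
      unfolding polar_form_quadratic q2K K_def ..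
    finally show ?thesis .
  qed
  define \<sigma> where "\<sigma> = csqrt (- 2 * c0)"
  have \<sigma>2: "\<sigma> * \<sigma> = - 2 * c0" using power2_csqrt[of "- 2 * c0"] by (simp add: \<sigma>_def power2_eq_square)
  have \<sigma>0: "\<sigma> \<noteq> 0" using \<sigma>2 c0 by auto
  define aa where "aa v t = A * (t + vdot n v) + A' * m v" for v t
  define bb where "bb v t = B * (t + vdot n v) + B' * m v" for v t
  define X where "X v t = vec5 (aa v t + \<sigma> * vdot U v) (aa v t - \<sigma> * vdot U v) (bb v t + \<sigma> * vdot V v) (bb v t - \<sigma> * vdot V v)
     (\<sigma> * vdot W v - (aa v t + bb v t))" for v t
  define R :: "5 \<Rightarrow> complex^3" where "R i = (vec5 (A *s n + A' *s \<mu> + \<sigma> *s U) (A *s n + A' *s \<mu> - \<sigma> *s U) (B *s n + B' *s \<mu> + \<sigma> *s V)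
     (B *s n + B' *s \<mu> - \<sigma> *s V) (\<sigma> *s W - (A *s n + A' *s \<mu> + (B *s n + B' *s \<mu>)))) $ i" for i
  define s :: "5 \<Rightarrow> complex" where "s i = vec5 A A B B (- (A + B)) $ i" for i
  have XR: "(\<chi> i. vdot (R i) v + s i * t) = X v t" for v t
    unfolding vec5_eq_iff X_def R_def s_def aa_def bb_def m_def by (simp add: vdot_simps algebra_simps)
  define \<rho>U \<rho>V \<rho>W where "\<rho>U = vdot \<mu> U * \<alpha>" and "\<rho>V = vdot \<mu> V * \<beta>" and "\<rho>W = vdot \<mu> W * \<gamma>"
  have mexp: "m v = \<rho>U * vdot U v + \<rho>V * vdot V v + \<rho>W * vdot W v" for v
  proof -
    have "m v = vdot \<mu> ((vdot U v * \<alpha>) *s U + (vdot V v * \<beta>) *s V + (vdot W v * \<gamma>) *s W)" unfolding m_def using expand[of v] by metis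
    then show ?thesis by (simp add: vdot_simps \<rho>U_def \<rho>V_def \<rho>W_def mult_ac)
  qed
  define \<tau> where "\<tau> = inverse (2 * \<sigma>)"
  have \<tau>: "2 * \<tau> * \<sigma> = 1" using \<sigma>0 by (simp add: \<tau>_def)
  define a where "a = vec5 (- B / 2 - \<rho>U * \<tau> - \<rho>W * \<tau>) (- B / 2 + \<rho>U * \<tau> - \<rho>W * \<tau>) (A / 2 - \<rho>V * \<tau> - \<rho>W * \<tau>) (A / 2 + \<rho>V * \<tau> - \<rho>W * \<tau>) (- 2 * \<rho>W * \<tau>)"
  have a_apply: "(\<Sum>i\<in>UNIV. a $ i * x $ i) = A * ((x $ 3 + x $ 4) / 2) - B * ((x $ 1 + x $ 2) / 2)
     - (\<rho>U * (\<tau> * (x $ 1 - x $ 2)) + \<rho>V * (\<tau> * (x $ 3 - x $ 4)) + \<rho>W * (2 * \<tau> * (x $ 5 + (x $ 1 + x $ 2) / 2 + (x $ 3 + x $ 4) / 2)))" for x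
    unfolding sum_5 a_def vec5_nth by (simp add: algebra_simps add_divide_distrib diff_divide_distrib)
  show ?thesis
  proof (intro exI conjI allI)
    show "a \<noteq> 0"
    proof
      assume "a = 0"
      then have 0: "(\<Sum>i\<in>UNIV. a $ i * x $ i) = 0" for x by simp
      have "\<rho>W * (2 * \<tau>) = 0" using 0[of "vec5 0 0 0 0 1"] unfolding a_apply by simp
      then have w: "\<rho>W = 0" using \<tau> by auto
      have "B = 0" using 0[of "vec5 1 1 0 0 0"] unfolding a_apply by (simp add: w)
      moreover have "A = 0" using 0[of "vec5 0 0 1 1 0"] unfolding a_apply by (simp add: w)
      ultimately show False using det1 by simp
    qed
    have "8 * (\<sigma> * \<sigma>) \<noteq> 0" using \<sigma>0 by simp
    then show "- inverse (8 * (\<sigma> * \<sigma>)) \<noteq> 0" by simp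
    fix v t
    show "quartic v t = - inverse (8 * (\<sigma> * \<sigma>)) * igusa_quartic (\<chi> i. vdot (R i) v + s i * t)"
    proof -
      have "igusa_quartic (X v t) = - 4 * (heron (\<sigma> * vdot U v) (\<sigma> * vdot V v) (\<sigma> * vdot W v) +
         2 * polar_form (aa v t) (bb v t) (aa v t) (bb v t) (\<sigma> * vdot U v) (\<sigma> * vdot V v) (\<sigma> * vdot W v))"
        unfolding X_def by (rule igusa_adapted)
      also have "\<dots> = - 4 * ((\<sigma> * \<sigma>) * ((\<sigma> * \<sigma>) * H v) + 2 * ((\<sigma> * \<sigma>) * polar_form (aa v t) (bb v t) (aa v t) (bb v t) (vdot U v) (vdot V v) (vdot W v)))"
        unfolding H_def heron_def polar_form_def by algebra
      also have "(\<sigma> * \<sigma>) * ((\<sigma> * \<sigma>) * H v) = (\<sigma> * \<sigma>) * (- 2 * c0 * H v)" unfolding \<sigma>2 ..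
      also have "- 4 * ((\<sigma> * \<sigma>) * (- 2 * c0 * H v) + 2 * ((\<sigma> * \<sigma>) * polar_form (aa v t) (bb v t) (aa v t) (bb v t) (vdot U v) (vdot V v) (vdot W v)))
          = - (8 * (\<sigma> * \<sigma>)) * (polar_form (aa v t) (bb v t) (aa v t) (bb v t) (vdot U v) (vdot V v) (vdot W v) - c0 * H v)" by algebra
      also have "\<dots> = - (8 * (\<sigma> * \<sigma>)) * quartic v t" unfolding quartic_eq aa_def bb_def ..
      finally have "igusa_quartic (X v t) = - (8 * (\<sigma> * \<sigma>)) * quartic v t" .
      moreover have "- inverse z * (- z * y) = y" if "z \<noteq> 0" for z y :: complex using that by simp
      ultimately show ?thesis using \<open>8 * (\<sigma> * \<sigma>) \<noteq> 0\<close> unfolding XR by metis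
    qed
  next
    fix v t
    show "(\<chi> i. vdot (R i) v + s i * t) = 0 \<longrightarrow> v = 0 \<and> t = 0"
    proof
      assume "(\<chi> i. vdot (R i) v + s i * t) = 0"
      then have x: "aa v t + \<sigma> * vdot U v = 0" "aa v t - \<sigma> * vdot U v = 0" "bb v t + \<sigma> * vdot V v = 0" "bb v t - \<sigma> * vdot V v = 0"
        "\<sigma> * vdot W v - (aa v t + bb v t) = 0"
        unfolding XR X_def vec5_eq_iff vec5_nth zero_index by blast+
      have "2 * aa v t = (aa v t + \<sigma> * vdot U v) + (aa v t - \<sigma> * vdot U v)" "2 * bb v t = (bb v t + \<sigma> * vdot V v) + (bb v t - \<sigma> * vdot V v)" by simp_all
      then have ab: "aa v t = 0" "bb v t = 0" unfolding x by simp_all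
      then have "vdot U v = 0" "vdot V v = 0" "vdot W v = 0" using x[unfolded ab] \<sigma>0 by simp_all
      then have v: "v = 0" using expand[of v] by simp
      then have "A * t = 0" "B * t = 0" using ab by (simp_all add: aa_def bb_def m_def vdot_simps)
      then have "t = 0" using det1 by auto
      with v show "v = 0 \<and> t = 0" by blast
    qed
  next
    fix x :: "complex^5"
    show "(\<Sum>i\<in>UNIV. a $ i * x $ i) = 0 \<longleftrightarrow> (\<exists>v t. x = (\<chi> i. vdot (R i) v + s i * t))"
    proof
      assume "\<exists>v t. x = (\<chi> i. vdot (R i) v + s i * t)"
      then obtain v t where x: "x = X v t" unfolding XR by blast
      have d: "\<tau> * (2 * (\<sigma> * y)) = y" for y
      proof -
        have "\<tau> * (2 * (\<sigma> * y)) = (2 * \<tau> * \<sigma>) * y" by (simp only: mult_ac)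
        then show ?thesis by (simp only: \<tau> mult_1)
      qed
      have "(\<Sum>i\<in>UNIV. a $ i * x $ i) = A * bb v t - B * aa v t - (\<rho>U * (\<tau> * (2 * (\<sigma> * vdot U v))) + \<rho>V * (\<tau> * (2 * (\<sigma> * vdot V v))) + \<rho>W * (\<tau> * (2 * (\<sigma> * vdot W v))))"
        unfolding a_apply x X_def vec5_nth by (simp add: mult_ac)
      also have "\<dots> = A * bb v t - B * aa v t - m v" unfolding d mexp ..
      also have "\<dots> = (A * B' - A' * B) * m v - m v" unfolding aa_def bb_def by algebra
      finally show "(\<Sum>i\<in>UNIV. a $ i * x $ i) = 0" unfolding det1 by simp
    next
      assume x0: "(\<Sum>i\<in>UNIV. a $ i * x $ i) = 0"
      define p q u w z where "p = (x $ 1 + x $ 2) / 2" and "q = (x $ 3 + x $ 4) / 2" and "u = \<tau> * (x $ 1 - x $ 2)"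
        and "w = \<tau> * (x $ 3 - x $ 4)" and "z = 2 * \<tau> * (x $ 5 + p + q)"
      define v where "v = (u * \<alpha>) *s U + (w * \<beta>) *s V + (z * \<gamma>) *s W"
      have i: "\<alpha> * vdot U U = 1" "\<beta> * vdot V V = 1" "\<gamma> * vdot W W = 1" using nz by (simp_all add: \<alpha>_def \<beta>_def \<gamma>_def)
      have uvw: "vdot U v = u" "vdot V v = w" "vdot W v = z"
        unfolding v_def by (simp_all add: vdot_simps orth vdot_commute[of V U] vdot_commute[of W U] vdot_commute[of W V] mult.assoc i)
      have mv: "m v = A * q - B * p"
        using x0 unfolding a_apply mexp uvw p_def[symmetric] q_def[symmetric] u_def[symmetric] w_def[symmetric]
        by (simp add: z_def algebra_simps)
      define t where "t = p * B' - A' * q - vdot n v"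
      have aav: "aa v t = p * (A * B' - A' * B)" and bbv: "bb v t = q * (A * B' - A' * B)"
        unfolding aa_def bb_def t_def mv by algebra+
      have su: "\<sigma> * u = (x $ 1 - x $ 2) / 2" "\<sigma> * w = (x $ 3 - x $ 4) / 2" "\<sigma> * z = x $ 5 + p + q"
      proof -
        have h: "\<sigma> * (\<tau> * y) = y / 2" for y
        proof -
          have "2 * (\<sigma> * (\<tau> * y)) = (2 * \<tau> * \<sigma>) * y" by (simp only: mult_ac)
          also have "\<dots> = y" by (simp only: \<tau> mult_1)
          finally show ?thesis by (metis nonzero_mult_div_cancel_left zero_neq_numeral)
        qed
        show "\<sigma> * u = (x $ 1 - x $ 2) / 2" "\<sigma> * w = (x $ 3 - x $ 4) / 2" unfolding u_def w_def by (rule h)+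
        have "\<sigma> * z = 2 * (\<sigma> * (\<tau> * (x $ 5 + p + q)))" unfolding z_def by (simp only: mult_ac)
        then show "\<sigma> * z = x $ 5 + p + q" unfolding h by simp
      qed
      have "x = X v t"
        unfolding X_def aav bbv det1 uvw su vec5_eq_iff vec5_nth p_def q_def by (simp add: field_simps)
      then show "\<exists>v t. x = (\<chi> i. vdot (R i) v + s i * t)" unfolding XR by blast
    qed
  qed
qed

end

section \<open>From a 15-nodal quartic to the projected normal form\<close>

lemma invertible_kernelI:
  fixes A :: "complex^'n^'n"
  assumes "\<And>v. A *v v = 0 \<Longrightarrow> v = 0" shows "invertible A"
proof -
  have "inj ((*v) A)"
  proof (rule injI)
    fix x y assume "A *v x = A *v y"
    then have "A *v (x - y) = 0" by (simp add: matrix_vector_mult_diff_distrib)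
    then show "x = y" using assms[of "x - y"] by simp
  qed
  then show ?thesis using matrix_left_invertible_injective[of A] invertible_left_inverse[of A] by blast
qed

lemma ex_invertible_axis:
  fixes p :: "complex^'n" and k :: 'n
  assumes "p \<noteq> 0" shows "\<exists>A. invertible A \<and> A *v axis k 1 = p"
proof -
  obtain j where j: "p $ j \<noteq> 0" using assms by (auto simp: vec_eq_iff)
  define \<tau> where "\<tau> = Transposition.transpose j k"
  have \<tau>: "\<tau> (\<tau> i) = i" "\<tau> j = k" "\<tau> k = j" for i by (simp_all add: \<tau>_def)
  define A :: "complex^'n^'n" where "A = (\<chi> i l. if l = k then p $ i else if i = \<tau> l then 1 else 0)"
  have A: "(A *v v) $ i = p $ i * v $ k + (if i = j then 0 else v $ \<tau> i)" for v i
  proof -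
    have "(A *v v) $ i = (\<Sum>l\<in>UNIV. (if l = k then p $ i * v $ k else 0) + (if l = \<tau> i then (if \<tau> i = k then 0 else v $ \<tau> i) else 0))"
    proof -
      have sw: "i = \<tau> l \<longleftrightarrow> l = \<tau> i" for l using \<tau>(1) by metis
      have "(A *v v) $ i = (\<Sum>l\<in>UNIV. A $ i $ l * v $ l)" by (simp add: matrix_vector_mult_def)
      also have "\<dots> = (\<Sum>l\<in>UNIV. (if l = k then p $ i * v $ k else 0) + (if l = \<tau> i then (if \<tau> i = k then 0 else v $ \<tau> i) else 0))"
        by (rule sum.cong) (auto simp: A_def sw)
      finally show ?thesis .
    qed
    also have "\<dots> = p $ i * v $ k + (if \<tau> i = k then 0 else v $ \<tau> i)"
      by (simp only: sum.distrib) simp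
    also have "\<tau> i = k \<longleftrightarrow> i = j" using \<tau> by metis
    finally show ?thesis .
  qed
  have "A *v axis k 1 = p"
    using A[of "axis k 1"] \<tau> by (auto simp: vec_eq_iff axis_def) (metis \<tau>)
  moreover have "invertible A"
  proof (rule invertible_kernelI)
    fix v assume v: "A *v v = 0"
    then have "p $ j * v $ k = 0" using A[of v j] by simp
    then have k: "v $ k = 0" using j by simp
    have "v $ l = 0" for l
    proof (cases "l = k")
      case False
      then have "\<tau> l \<noteq> j" using \<tau> by metis
      then show ?thesis using A[of v "\<tau> l"] v k \<tau> by simp
    qed (simp add: k)
    then show "v = 0" by (simp add: vec_eq_iff)
  qed
  ultimately show ?thesis by blast
qed

lemma ex_orthogonal_to_two: "\<exists>w. w \<noteq> 0 \<and> vdot a w = 0 \<and> vdot b w = 0"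
proof -
  have one: "\<exists>w. w \<noteq> 0 \<and> vdot h w = 0" for h
  proof (cases "h $ 1 = 0")
    case True
    then show ?thesis by (intro exI[of _ "axis 1 1"]) (simp add: vdot_axis)
  next
    case False
    then have "vector [h $ 2, - h $ 1, 0] \<noteq> (0 :: complex^3)" by (simp add: vec3_eq_iff)
    moreover have "vdot h (vector [h $ 2, - h $ 1, 0]) = 0" by (simp add: vdot_3)
    ultimately show ?thesis by blast
  qed
  consider "vcross a b \<noteq> 0" | "a = 0" | "a \<noteq> 0" "vcross a b = 0" by blast
  then show ?thesis
  proof cases
    case 1
    then show ?thesis using vdot_vcross by blast
  next
    case 2
    then show ?thesis using one[of b] by (auto simp: vdot_simps)
  next
    case 3
    then obtain c where "b = c *s a" using vcross_eq_0_imp_proportional by blast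
    then show ?thesis using one[of a] by (auto simp: vdot_simps)
  qed
qed

text \<open>A nondegenerate quadratic form has an orthonormal basis.\<close>

lemma orthonormal_basis:
  assumes g: "homog 2 g" and nondeg: "\<And>w. (\<And>w'. g (w + w') = g w') \<Longrightarrow> w = 0"
  shows "\<exists>M :: complex^3^3. invertible M \<and> (\<forall>v. g (M *v v) = vdot v v)"
proof -
  define b where "b x y = D1 g x y / 2" for x y
  have gadd: "g (x + y) = g x + 2 * b x y + g y" for x y
  proof -
    have "g (x + 1 *s y) = poly (along g x y) 1" by (simp only: poly_along[OF g])
    also have "\<dots> = coeff (along g x y) 0 + coeff (along g x y) 1 + coeff (along g x y) 2"
    proof -
      have "{..2::nat} = {0, 1, 2}" by auto
      then show ?thesis using poly_eq_sum_le[OF degree_along[OF g], of x y 1] by simp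
    qed
    also have "coeff (along g x y) 2 = g y" using along_swap[OF g, of 0 y x] by (simp add: coeff_along_0[OF g])
    finally show ?thesis by (simp add: coeff_along_0[OF g] b_def)
  qed
  have blin: "b x (c *s y + c' *s z) = c * b x y + c' * b x z" for x y z c c'
    unfolding b_def D1_linear[OF g] by (simp add: add_divide_distrib)
  have bsym: "b x y = b y x" for x y using gadd[of x y] gadd[of y x] by (simp add: add.commute)
  have gs: "g (c *s x) = c\<^sup>2 * g x" for c x by (rule homog_smult[OF g])
  have bs: "b x (c *s y) = c * b x y" for x y c using blin[of x c y 0 0] by simp
  have bself: "b x x = g x" for x by (simp add: b_def D1_self[OF g])
  have badd: "b x (y + z) = b x y + b x z" for x y z using blin[of x 1 y 1 z] by simp
  define h where "h x = (\<chi> i. b x (axis i 1))" for x :: "complex^3"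
  have h: "vdot (h x) y = b x y" for x y
  proof -
    have y: "y = y $ 1 *s axis 1 1 + (y $ 2 *s axis 2 1 + y $ 3 *s axis 3 1)"
      by (simp add: vec3_eq_iff axis_def)
    have "b x y = y $ 1 * b x (axis 1 1) + (y $ 2 * b x (axis 2 1) + y $ 3 * b x (axis 3 1))"
      by (subst y) (simp only: badd bs)
    then show ?thesis by (simp add: vdot_3 h_def mult.commute)
  qed
  have scale: "\<exists>e. g e = 1 \<and> (\<exists>c. e = c *s x)" if "g x \<noteq> 0" for x
  proof -
    have "g (inverse (csqrt (g x)) *s x) = 1"
      unfolding gs using that by (simp add: power_inverse)
    then show ?thesis by blast
  qed
  have "\<exists>x. g x \<noteq> 0"
  proof (rule ccontr)
    assume "\<not> ?thesis"
    then have "axis 1 1 = (0 :: complex^3)" by (intro nondeg) simp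
    then show False by (simp add: axis_eq_0_iff)
  qed
  then obtain e1 where e1: "g e1 = 1" using scale by blast
  have "\<exists>x. b e1 x = 0 \<and> g x \<noteq> 0"
  proof (rule ccontr)
    assume no: "\<not> ?thesis"
    have gx: "g x = (b e1 x)\<^sup>2" for x
    proof -
      let ?y = "x + (- b e1 x) *s e1"
      have "b e1 ?y = 0" unfolding badd bs by (simp add: bself e1)
      then have "g ?y = 0" using no by blast
      moreover have "g ?y = g x - 2 * b e1 x * b e1 x + (b e1 x)\<^sup>2"
        unfolding gadd gs bs by (simp add: e1 bsym[of x e1])
      ultimately show ?thesis by (simp add: power2_eq_square)
    qed
    obtain w where w: "w \<noteq> 0" "vdot (h e1) w = 0" using ex_orthogonal_to_two by blast
    have "w = 0" by (rule nondeg) (use w in \<open>simp add: gx badd h\<close>)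
    then show False using w by simp
  qed
  then obtain x where x: "b e1 x = 0" "g x \<noteq> 0" by blast
  obtain e2 where e2: "g e2 = 1" "b e1 e2 = 0" using scale[OF x(2)] x(1) bs by (metis mult_zero_right)
  have "\<exists>x. b e1 x = 0 \<and> b e2 x = 0 \<and> g x \<noteq> 0"
  proof (rule ccontr)
    assume no: "\<not> ?thesis"
    have gx: "g x = (b e1 x)\<^sup>2 + (b e2 x)\<^sup>2" for x
    proof -
      define z where "z = (- b e1 x) *s e1 + (- b e2 x) *s e2"
      have bz: "b y z = - b e1 x * b y e1 + - b e2 x * b y e2" for y unfolding z_def blin ..
      have "b e1 (x + z) = 0" "b e2 (x + z) = 0" unfolding badd bz by (simp_all add: bself e1 e2 bsym[of e2 e1])
      then have "g (x + z) = 0" using no by blast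
      moreover have "g z = (b e1 x)\<^sup>2 + (b e2 x)\<^sup>2"
      proof -
        have z12: "b (c *s e1) e2 = 0" for c using bs[of e2 c e1] bsym[of "c *s e1" e2] bsym[of e2 e1] e2 by simp
        show ?thesis unfolding z_def gadd gs bs z12 e1 e2 by simp
      qed
      moreover have "b x z = - ((b e1 x)\<^sup>2 + (b e2 x)\<^sup>2)" unfolding bz bsym[of x e1] bsym[of x e2] by (simp add: power2_eq_square)
      ultimately show ?thesis using gadd[of x z] by (simp add: diff_eq_eq)
    qed
    obtain w where w: "w \<noteq> 0" "vdot (h e1) w = 0" "vdot (h e2) w = 0" using ex_orthogonal_to_two by blast
    have "w = 0" by (rule nondeg) (use w in \<open>simp add: gx badd h\<close>)
    then show False using w by simp
  qed
  then obtain x where x: "b e1 x = 0" "b e2 x = 0" "g x \<noteq> 0" by blast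
  obtain e3 where e3: "g e3 = 1" "b e1 e3 = 0" "b e2 e3 = 0" using scale[OF x(3)] x(1,2) bs by (metis mult_zero_right)
  define M :: "complex^3^3" where "M = (\<chi> i j. (if j = 1 then e1 else if j = 2 then e2 else e3) $ i)"
  have M: "M *v v = v $ 1 *s e1 + (v $ 2 *s e2 + v $ 3 *s e3)" for v
    by (simp add: M_def matrix_vector_mult_def vec_eq_iff sum_3 mult.commute)
  have bM: "b y (M *v v) = v $ 1 * b y e1 + (v $ 2 * b y e2 + v $ 3 * b y e3)" for y v
    unfolding M badd bs ..
  note ee = e1 e2 e3 bself bsym[of e2 e1] bsym[of e3 e1] bsym[of e3 e2]
  have be: "b e1 (M *v v) = v $ 1" "b e2 (M *v v) = v $ 2" "b e3 (M *v v) = v $ 3" for v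
    unfolding bM by (simp_all add: ee)
  have gM: "g (M *v v) = vdot v v" for v
  proof -
    have "g (M *v v) = b (M *v v) (M *v v)" by (simp only: bself)
    also have "\<dots> = v $ 1 * b (M *v v) e1 + (v $ 2 * b (M *v v) e2 + v $ 3 * b (M *v v) e3)" by (rule bM)
    also have "\<dots> = vdot v v" by (simp only: bsym[of "M *v v"] be vdot_3 add.assoc)
    finally show ?thesis .
  qed
  have "invertible M"
  proof (rule invertible_kernelI)
    have b0: "b y 0 = 0" for y using bs[of y 0 0] by simp
    fix v assume z: "M *v v = 0"
    have "v $ 1 = 0" "v $ 2 = 0" "v $ 3 = 0" using be[of v] unfolding z b0 by simp_all
    then show "v = 0" unfolding vec3_eq_iff by simp
  qed
  then show ?thesis using gM by blast
qed

lemma span_singleton_eq_iff: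
  fixes u v :: "complex^'n"
  assumes "u \<noteq> 0" "v \<noteq> 0"
  shows "vec.span {u} = vec.span {v} \<longleftrightarrow> (\<exists>c. c \<noteq> 0 \<and> u = c *s v)"
proof
  assume "vec.span {u} = vec.span {v}"
  then have "u \<in> vec.span {v}" by (metis singletonI vec.span_base)
  then obtain c where "u = c *s v" unfolding vec.span_singleton by blast
  then show "\<exists>c. c \<noteq> 0 \<and> u = c *s v" using assms by auto
next
  assume "\<exists>c. c \<noteq> 0 \<and> u = c *s v"
  then obtain c where c: "c \<noteq> 0" "u = c *s v" by blast
  have 1: "k *s v = (k / c) *s u" for k using c by (simp add: vector_smult_assoc)
  have 2: "k *s u = (k * c) *s v" for k using c by (simp add: vector_smult_assoc)
  show "vec.span {u} = vec.span {v}"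
  proof (intro subset_antisym subsetI)
    fix x assume "x \<in> vec.span {u}"
    then obtain k where "x = k *s u" unfolding vec.span_singleton by blast
    then show "x \<in> vec.span {v}" unfolding vec.span_singleton 2 by blast
  next
    fix x assume "x \<in> vec.span {v}"
    then obtain k where "x = k *s v" unfolding vec.span_singleton by blast
    then show "x \<in> vec.span {u}" unfolding vec.span_singleton 1 by blast
  qed
qed

definition embed3 :: "complex^3^4" where
  "embed3 = (\<chi> i j. if (i = 1 \<and> j = 1) \<or> (i = 2 \<and> j = 2) \<or> (i = 3 \<and> j = 3) then 1 else 0)"

lemma embed3_nth: "(embed3 *v v) $ 1 = v $ 1" "(embed3 *v v) $ 2 = v $ 2" "(embed3 *v v) $ 3 = v $ 3" "(embed3 *v v) $ 4 = 0"
  by (simp_all add: embed3_def matrix_vector_mult_def sum_3)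

lemma transpose_embed3_nth:
  "(Finite_Cartesian_Product.transpose embed3 *v y) $ 1 = y $ 1" "(Finite_Cartesian_Product.transpose embed3 *v y) $ 2 = y $ 2"
  "(Finite_Cartesian_Product.transpose embed3 *v y) $ 3 = y $ 3"
  by (simp_all add: embed3_def matrix_vector_mult_def Finite_Cartesian_Product.transpose_def sum_4)

lemma vec4_eq_iff: "v = w \<longleftrightarrow> v $ 1 = w $ 1 \<and> v $ 2 = w $ 2 \<and> v $ 3 = w $ 3 \<and> v $ 4 = w $ 4" for v w :: "complex^4"
  by (simp add: vec_eq_iff forall_4)

text \<open>Coordinates \<open>(v, t)\<close> in which a given node is the point \<open>v = 0\<close>.\<close>

lemma node_coordinates:
  assumes F: "F \<in> forms 4" and p: "node_at F p"
  shows "\<exists>(P :: complex^3^4) (R :: complex^4^3) (\<rho> :: complex^4) q3 q4.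
     (\<forall>v t. R *v (P *v v + t *s p) = v \<and> (\<Sum>i\<in>UNIV. \<rho> $ i * (P *v v + t *s p) $ i) = t) \<and>
     (\<forall>y. P *v (R *v y) + (\<Sum>i\<in>UNIV. \<rho> $ i * y $ i) *s p = y) \<and>
     homog 3 q3 \<and> homog 4 q4 \<and>
     (\<forall>v t. form_at F (P *v v + t *s p) = vdot v v * t\<^sup>2 + 2 * q3 v * t + q4 v)"
proof -
  let ?f = "form_at F"
  have f: "homog 4 ?f" by (rule homog_form_at[OF F])
  have sp: "p \<noteq> 0" "?f p = 0" "\<And>w. D1 ?f p w = 0" using p by (auto simp: node_at_def singular_at_iff)
  obtain A :: "complex^4^4" where A: "invertible A" "A *v axis 4 1 = p" using ex_invertible_axis[OF sp(1), of 4] by blast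
  obtain A' where A': "A ** A' = mat 1" "A' ** A = mat 1" using A(1) by (auto simp: invertible_def)
  define P0 where "P0 = A ** embed3"
  have P0: "P0 *v v + t *s p = A *v (embed3 *v v + t *s axis 4 1)" for v t
    by (simp add: P0_def A(2)[symmetric] matrix_vector_mul_assoc[symmetric] matrix_vector_right_distrib vector_scalar_commute)
  obtain g where g: "\<And>k. k \<le> 4 \<Longrightarrow> homog (4 - k) (g k)" "\<And>v t. ?f (P0 *v v + t *s p) = (\<Sum>k\<le>4. g k v * t ^ k)"
    using homog_pencil_expand[OF f, of P0 p] by blast
  have hg: "homog 4 (g 0)" "homog 3 (g 1)" "homog 2 (g 2)" "homog 1 (g 3)" "homog 0 (g 4)"
    using g(1)[of 0] g(1)[of 1] g(1)[of 2] g(1)[of 3] g(1)[of 4] by simp_all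
  have at4: "{..4::nat} = {0, 1, 2, 3, 4}" by auto
  have exp4: "?f (P0 *v v + t *s p) = g 0 v + g 1 v * t + g 2 v * t\<^sup>2 + g 3 v * t ^ 3 + g 4 v * t ^ 4" for v t
    unfolding g(2) at4 by simp
  have al: "along ?f p (P0 *v v + t *s p) = [:g 4 v * 0, 0:] + monom (g 0 v) 4 + monom (g 1 v) 3 * [:1, t:] + monom (g 2 v) 2 * [:1, t:]\<^sup>2
     + monom (g 3 v) 1 * [:1, t:] ^ 3 + smult (g 4 v) ([:1, t:] ^ 4)" for v t
  proof (rule alongI)
    fix s
    have "p + s *s (P0 *v v + t *s p) = P0 *v (s *s v) + (1 + t * s) *s p"
      by (simp add: vector_scalar_commute vec_eq_iff algebra_simps)
    then have "?f (p + s *s (P0 *v v + t *s p)) = g 0 (s *s v) + g 1 (s *s v) * (1 + t * s) + g 2 (s *s v) * (1 + t * s)\<^sup>2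
      + g 3 (s *s v) * (1 + t * s) ^ 3 + g 4 (s *s v) * (1 + t * s) ^ 4" by (simp only: exp4)
    then show "poly ([:g 4 v * 0, 0:] + monom (g 0 v) 4 + monom (g 1 v) 3 * [:1, t:] + monom (g 2 v) 2 * [:1, t:]\<^sup>2
     + monom (g 3 v) 1 * [:1, t:] ^ 3 + smult (g 4 v) ([:1, t:] ^ 4)) s = ?f (p + s *s (P0 *v v + t *s p))"
      unfolding homog_smult[OF hg(1)] homog_smult[OF hg(2)] homog_smult[OF hg(3)] homog_smult[OF hg(4)] homog_smult[OF hg(5)]
      by (simp add: poly_monom algebra_simps)
  qed
  have g4: "g 4 v = 0" for v
  proof -
    have "coeff (along ?f p (P0 *v v + 0 *s p)) 0 = g 4 v" unfolding al by (simp add: coeff_monom_mult coeff_monom power2_eq_square flip: one_pCons)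
    then show ?thesis by (simp add: coeff_along_0[OF f] sp)
  qed
  have g3: "g 3 v = 0" for v
  proof -
    have "D1 ?f p (P0 *v v + 0 *s p) = g 3 v" unfolding al g4 by (simp add: coeff_monom_mult coeff_monom power2_eq_square flip: one_pCons)
    then show ?thesis using sp(3) by simp
  qed
  have g2: "coeff (along ?f p (P0 *v v + t *s p)) 2 = g 2 v" for v t
    unfolding al g3 g4 by (simp add: coeff_monom_mult coeff_monom power2_eq_square numeral_eq_Suc)
  have A'A: "A' *v (P0 *v v + t *s p) = embed3 *v v + t *s axis 4 1" for v t
    unfolding P0 by (simp add: matrix_vector_mul_assoc A')
  have decomp: "\<exists>v t. y = P0 *v v + t *s p" for y
  proof -
    define z where "z = A' *v y"
    have z: "embed3 *v (vector [z $ 1, z $ 2, z $ 3]) + z $ 4 *s axis 4 1 = z"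
      by (simp add: vec4_eq_iff embed3_nth axis_def)
    have "P0 *v (vector [z $ 1, z $ 2, z $ 3]) + z $ 4 *s p = A *v z" unfolding P0 z ..
    also have "A *v z = y" by (simp add: z_def matrix_vector_mul_assoc A')
    finally show ?thesis by metis
  qed
  have "\<exists>M :: complex^3^3. invertible M \<and> (\<forall>v. g 2 (M *v v) = vdot v v)"
  proof (rule orthonormal_basis[OF hg(3)])
    fix w assume w: "\<And>w'. g 2 (w + w') = g 2 w'"
    have "P0 *v w + 0 *s p \<in> vec.span {p}"
    proof (rule node_radical[OF p])
      fix y
      obtain v t where y: "y = P0 *v v + t *s p" using decomp by blast
      have "P0 *v w + 0 *s p + y = P0 *v (w + v) + t *s p" by (simp add: y matrix_vector_right_distrib add_ac)
      then show "coeff (along ?f p (P0 *v w + 0 *s p + y)) 2 = coeff (along ?f p y) 2"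
        unfolding y by (simp only: g2 w)
    qed
    then obtain c where "P0 *v w + 0 *s p = c *s p" by (auto simp: vec.span_singleton)
    then have "P0 *v w + 0 *s p = P0 *v 0 + c *s p" by simp
    then have "embed3 *v w + 0 *s axis 4 1 = embed3 *v 0 + c *s axis 4 1" by (metis A'A)
    then have "(embed3 *v w) = c *s axis 4 1" by simp
    then show "w = 0" by (simp add: vec4_eq_iff vec3_eq_iff embed3_nth axis_def)
  qed
  then obtain M :: "complex^3^3" where M: "invertible M" "\<And>v. g 2 (M *v v) = vdot v v" by blast
  obtain M' where M': "M ** M' = mat 1" "M' ** M = mat 1" using M(1) by (auto simp: invertible_def)
  define P where "P = P0 ** M"
  define R where "R = M' ** (Finite_Cartesian_Product.transpose embed3 ** A')"
  define \<rho> where "\<rho> = A' $ 4"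
  have tr: "Finite_Cartesian_Product.transpose embed3 *v (embed3 *v v + t *s axis 4 1) = v" for v t
    unfolding vec3_eq_iff transpose_embed3_nth by (simp add: embed3_nth axis_def)
  have rho: "(\<Sum>i\<in>UNIV. \<rho> $ i * y $ i) = (A' *v y) $ 4" for y by (simp add: \<rho>_def matrix_vector_mult_def)
  have P: "P *v v = P0 *v (M *v v)" for v by (simp add: P_def matrix_vector_mul_assoc)
  have R: "R *v y = M' *v (Finite_Cartesian_Product.transpose embed3 *v (A' *v y))" for y by (simp add: R_def matrix_vector_mul_assoc)
  have inv: "R *v (P *v v + t *s p) = v \<and> (\<Sum>i\<in>UNIV. \<rho> $ i * (P *v v + t *s p) $ i) = t" for v t
  proof -
    have 1: "R *v (P *v v + t *s p) = M' *v (M *v v)" unfolding R P A'A tr ..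
    have 2: "(\<Sum>i\<in>UNIV. \<rho> $ i * (P *v v + t *s p) $ i) = (embed3 *v (M *v v) + t *s axis 4 1) $ 4"
      unfolding rho P A'A ..
    have 3: "M' *v (M *v v) = v" by (simp add: matrix_vector_mul_assoc M')
    have 4: "(embed3 *v (M *v v) + t *s axis 4 1) $ 4 = t"
      unfolding vector_add_component embed3_nth by (simp add: axis_def)
    show ?thesis by (simp only: 1 2 3 4 simp_thms)
  qed
  have "P *v (R *v y) + (\<Sum>i\<in>UNIV. \<rho> $ i * y $ i) *s p = y" for y
  proof -
    obtain v t where "y = P0 *v v + t *s p" using decomp by blast
    moreover have "v = M *v (M' *v v)" by (simp add: matrix_vector_mul_assoc M')
    ultimately have y: "y = P *v (M' *v v) + t *s p" unfolding P by metis
    have "R *v y = M' *v v" "(\<Sum>i\<in>UNIV. \<rho> $ i * y $ i) = t" unfolding y using inv[of "M' *v v" t] by blast+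
    then show ?thesis by (simp only: y)
  qed
  moreover have "homog 3 (\<lambda>v. (1 / 2) * g 1 (M *v v))" "homog 4 (\<lambda>v. g 0 (M *v v))"
    by (intro homog_scaleC homog_matrix hg)+
  moreover have "?f (P *v v + t *s p) = vdot v v * t\<^sup>2 + 2 * ((1 / 2) * g 1 (M *v v)) * t + g 0 (M *v v)" for v t
    unfolding P exp4 g3 g4 M(2) by simp
  ultimately show ?thesis
    by (intro exI[of _ P] exI[of _ R] exI[of _ \<rho>] exI[of _ "\<lambda>v. (1 / 2) * g 1 (M *v v)"]
        exI[of _ "\<lambda>v. g 0 (M *v v)"] conjI allI conjunct1[OF inv] conjunct2[OF inv])
qed

text \<open>Every node can serve as the centre of projection. The other nodes become pairs of a
  vector in the plane and a fibre coordinate, and the linear change of coordinates back to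
  \<open>\<complex>\<^sup>4\<close> turns the normal form of the projected quartic into a hyperplane
  section.\<close>

theorem nodal15_is_hyperplane_section:
  assumes F15: "F \<in> nodal15" shows "is_hyperplane_section igusa_quartic F"
proof -
  let ?f = "form_at F"
  have F: "F \<in> forms 4" and nodes: "\<And>v. singular_at F v \<Longrightarrow> node_at F v"
    and fin: "finite (singular_points F)" and card15: "card (singular_points F) = 15"
    using F15 by (auto simp: nodal15_def)
  have f: "homog 4 ?f" by (rule homog_form_at[OF F])
  have "singular_points F \<noteq> {}" using card15 by auto
  then obtain p where p: "singular_at F p" by (auto simp: singular_points_def)
  have p0: "p \<noteq> 0" using p by (simp add: singular_at_def)
  obtain P :: "complex^3^4" and R :: "complex^4^3" and \<rho> :: "complex^4" and q3 q4 where
    inv: "\<And>v t. R *v (P *v v + t *s p) = v" "\<And>v t. (\<Sum>i\<in>UNIV. \<rho> $ i * (P *v v + t *s p) $ i) = t"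
    and surj: "\<And>y. P *v (R *v y) + (\<Sum>i\<in>UNIV. \<rho> $ i * y $ i) *s p = y"
    and hq: "homog 3 q3" "homog 4 q4" and fq: "\<And>v t. ?f (P *v v + t *s p) = vdot v v * t\<^sup>2 + 2 * q3 v * t + q4 v"
    using node_coordinates[OF F nodes[OF p]] by blast
  interpret projected_quartic q3 q4 by unfold_locales (rule hq)+
  define L where "L v t = P *v v + t *s p" for v t
  have fL: "?f (L v t) = quartic v t" for v t by (simp add: L_def fq quartic_def q2_def)
  have Linj: "L v t = L v' t' \<Longrightarrow> v = v' \<and> t = t'" for v t v' t' unfolding L_def by (metis inv)
  have L0: "L 0 t = t *s p" for t by (simp add: L_def)
  have Lscale: "L (c *s v) (c * t) = c *s L v t" for c v t
    by (simp add: L_def vector_scalar_commute vector_add_ldistrib vector_smult_assoc)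
  have Ladd: "L (v + v') (t + t') = L v t + L v' t'" for v v' t t'
    by (simp add: L_def vec_eq_iff matrix_vector_right_distrib algebra_simps)
  have Lsurj: "\<exists>v t. y = L v t" for y unfolding L_def using surj[of y] by metis
  have Lnz: "L v t \<noteq> 0" if "v \<noteq> 0" for v t using Linj[of v t 0 0] that by (auto simp: L0)
  have al: "along ?f (L v t) (L w \<tau>) = along q2 v w * [:t, \<tau>:]\<^sup>2 + 2 * along q3 v w * [:t, \<tau>:] + along q4 v w" for v t w \<tau>
  proof (rule alongI)
    fix s
    have "L v t + s *s L w \<tau> = L (v + s *s w) (t + s * \<tau>)" by (simp only: Ladd Lscale)
    then have "?f (L v t + s *s L w \<tau>) = quartic (v + s *s w) (t + s * \<tau>)" by (simp only: fL)
    then show "poly (along q2 v w * [:t, \<tau>:]\<^sup>2 + 2 * along q3 v w * [:t, \<tau>:] + along q4 v w) s = ?f (L v t + s *s L w \<tau>)"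
      by (simp add: quartic_def poly_along[OF hq2] poly_along[OF hq(1)] poly_along[OF hq(2)] ring_distribs mult_ac)
  qed
  have two: "(2 :: complex poly) = [:2:]" by (simp add: numeral_poly)
  have c1: "D1 ?f (L v t) (L w \<tau>) = (t\<^sup>2 * D1 q2 v w + 2 * t * D1 q3 v w + D1 q4 v w) + 2 * \<tau> * (q2 v * t + q3 v)" for v t w \<tau>
    unfolding al two by (simp add: coeff_mult power2_eq_square coeff_along_0[OF hq2] coeff_along_0[OF hq(1)] algebra_simps)
  have sing_iff: "singular_at F (L v t) \<longleftrightarrow> sing v t" if "v \<noteq> 0" for v t
  proof
    assume "singular_at F (L v t)"
    then have s: "quartic v t = 0" "\<And>w. D1 ?f (L v t) w = 0" by (auto simp: singular_at_iff fL)
    have "2 * (q2 v * t + q3 v) = D1 ?f (L v t) (L 0 1) - D1 ?f (L v t) (L 0 0)" unfolding c1 by (simp add: algebra_simps)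
    then have "2 * (q2 v * t + q3 v) = 0" unfolding s(2) by simp
    then have "q2 v * t + q3 v = 0" by (simp only: mult_eq_0_iff) simp
    then show "sing v t" using s unfolding sing_def by (metis (no_types, lifting) c1 add.right_neutral mult_zero_right)
  next
    assume s: "sing v t"
    have "D1 ?f (L v t) y = 0" for y
    proof -
      obtain w \<tau> where "y = L w \<tau>" using Lsurj by blast
      then show ?thesis using s by (simp add: c1 sing_def)
    qed
    then show "singular_at F (L v t)" using s Lnz[OF that] by (simp add: singular_at_iff fL sing_def)
  qed

  \<comment> \<open>the other fourteen nodes, normalised by a linear form that vanishes at none of them\<close>
  define T where "T = singular_points F - {vec.span {p}}"
  have "vec.span {p} \<in> singular_points F" using p by (auto simp: singular_points_def)
  then have cardT: "card T = 14" "finite T" using card15 fin by (simp_all add: T_def)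
  have raw: "\<exists>b. fst b \<noteq> 0 \<and> sing (fst b) (snd b) \<and> S = vec.span {L (fst b) (snd b)}" if "S \<in> T" for S
  proof -
    obtain y where y: "singular_at F y" "S = vec.span {y}" "S \<noteq> vec.span {p}" using \<open>S \<in> T\<close> by (auto simp: T_def singular_points_def)
    obtain v t where vt: "y = L v t" using Lsurj by blast
    have "v \<noteq> 0"
    proof
      assume "v = 0"
      then have e: "y = t *s p" using vt L0 by simp
      then have "t \<noteq> 0" using y(1) by (auto simp: singular_at_def)
      then have "vec.span {y} = vec.span {p}" using span_singleton_eq_iff[of y p] e p0 by auto
      then show False using y by simp
    qed
    then show ?thesis using y vt sing_iff by (intro exI[of _ "(v, t)"]) simp
  qed
  then have "\<exists>\<psi>. \<forall>S\<in>T. fst (\<psi> S) \<noteq> 0 \<and> sing (fst (\<psi> S)) (snd (\<psi> S)) \<and> S = vec.span {L (fst (\<psi> S)) (snd (\<psi> S))}"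
    by (intro bchoice) blast
  then obtain \<psi> where \<psi>: "\<And>S. S \<in> T \<Longrightarrow> fst (\<psi> S) \<noteq> 0" "\<And>S. S \<in> T \<Longrightarrow> sing (fst (\<psi> S)) (snd (\<psi> S))"
    "\<And>S. S \<in> T \<Longrightarrow> S = vec.span {L (fst (\<psi> S)) (snd (\<psi> S))}" by blast
  have "finite (\<Union>S\<in>T. {s. vdot (fst (\<psi> S)) (conic_point s) = 0})"
    using cardT(2) \<psi>(1) by (intro finite_UN_I conic_point_not_on_line) auto
  then obtain s0 where s0: "s0 \<notin> (\<Union>S\<in>T. {s. vdot (fst (\<psi> S)) (conic_point s) = 0})"
    using ex_new_if_finite[OF infinite_UNIV_char_0] by blast
  define \<theta> where "\<theta> = conic_point s0"
  define k where "k S = inverse (vdot \<theta> (fst (\<psi> S)))" for S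
  have th: "vdot \<theta> (fst (\<psi> S)) \<noteq> 0" if "S \<in> T" for S using s0 that by (auto simp: \<theta>_def vdot_commute)
  have k0: "k S \<noteq> 0" if "S \<in> T" for S using th[OF that] by (simp add: k_def)
  define \<phi> where "\<phi> S = (k S *s fst (\<psi> S), k S * snd (\<psi> S))" for S
  define N where "N = \<phi> ` T"
  have \<phi>span: "vec.span {L (fst (\<phi> S)) (snd (\<phi> S))} = S" if "S \<in> T" for S
  proof -
    have "vec.span {L (fst (\<phi> S)) (snd (\<phi> S))} = vec.span {L (fst (\<psi> S)) (snd (\<psi> S))}"
    proof (subst span_singleton_eq_iff)
      show "L (fst (\<phi> S)) (snd (\<phi> S)) \<noteq> 0" "L (fst (\<psi> S)) (snd (\<psi> S)) \<noteq> 0"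
        using \<psi>(1)[OF that] k0[OF that] by (auto simp: \<phi>_def intro!: Lnz)
      show "\<exists>c. c \<noteq> 0 \<and> L (fst (\<phi> S)) (snd (\<phi> S)) = c *s L (fst (\<psi> S)) (snd (\<psi> S))"
        using k0[OF that] by (auto simp: \<phi>_def Lscale)
    qed
    then show ?thesis using \<psi>(3)[OF that] by simp
  qed
  have "inj_on \<phi> T" by (rule inj_onI) (metis \<phi>span)
  then have cardN: "card N = 14" "finite N" using cardT by (simp_all add: N_def card_image)
  have nodeN: "sing b t \<and> vdot \<theta> b = 1" if bt: "(b, t) \<in> N" for b t
  proof -
    obtain S where S: "S \<in> T" "(b, t) = \<phi> S" using bt unfolding N_def by blast
    then have bt: "b = k S *s fst (\<psi> S)" "t = k S * snd (\<psi> S)" by (simp_all add: \<phi>_def)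
    show ?thesis unfolding bt using sing_scale[OF \<psi>(2)[OF S(1)] k0[OF S(1)]] th[OF S(1)] by (simp add: vdot_simps k_def)
  qed
  have b0: "b \<noteq> 0" if "(b, t) \<in> N" for b t using nodeN[OF that] by (auto simp: vdot_simps)
  have complete: "\<exists>c b0 t0. c \<noteq> 0 \<and> (b0, t0) \<in> N \<and> b = c *s b0 \<and> t = c * t0" if s: "sing b t" and b: "b \<noteq> 0" for b t
  proof -
    have sg: "singular_at F (L b t)" using sing_iff[OF b] s by blast
    have "vec.span {L b t} \<noteq> vec.span {p}"
    proof
      assume "vec.span {L b t} = vec.span {p}"
      then obtain c where "L b t = c *s p" using span_singleton_eq_iff[OF Lnz[OF b] p0] by blast
      then have "L b t = L 0 c" by (simp add: L0)
      then show False using Linj b by blast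
    qed
    then have S: "vec.span {L b t} \<in> T" using sg by (auto simp: T_def singular_points_def)
    define S where "S = vec.span {L b t}"
    have ST: "S \<in> T" using S by (simp add: S_def)
    obtain u \<tau> where u: "\<phi> S = (u, \<tau>)" by (cases "\<phi> S")
    have uN: "(u, \<tau>) \<in> N" using ST u by (metis N_def imageI)
    have "vec.span {L b t} = vec.span {L u \<tau>}" by (metis \<phi>span[OF ST] S_def u fst_conv snd_conv)
    then obtain c where c: "c \<noteq> 0" "L b t = c *s L u \<tau>" using span_singleton_eq_iff[OF Lnz[OF b] Lnz[OF b0[OF uN]]] by blast
    then have "L b t = L (c *s u) (c * \<tau>)" by (simp add: Lscale)
    then show ?thesis using Linj c uN by blast
  qed
  have quad: "\<exists>w. coeff (along branch b w) 2 \<noteq> 0" if bt: "(b, t) \<in> N" for b t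
  proof (rule ccontr)
    assume "\<not> ?thesis"
    then have z: "coeff (along branch b w) 2 = 0" for w by blast
    have s: "sing b t" using nodeN[OF bt] by blast
    have node: "node_at F (L b t)" using nodes sing_iff[OF b0[OF bt]] s by blast
    have rad: "b0 = c *s b \<and> \<tau>0 = c * t" if "L b0 \<tau>0 = c *s L b t" for b0 \<tau>0 c
      using Linj[of b0 \<tau>0 "c *s b" "c * t"] that by (simp add: Lscale)
    have z1: "q2 b * t + q3 b = 0" using s by (simp add: sing_def)
    define G2 where "G2 w \<tau> = coeff (along ?f (L b t) (L w \<tau>)) 2" for w \<tau>
    define ell where "ell w \<tau> = t * D1 q2 b w + \<tau> * q2 b + D1 q3 b w" for w \<tau>
    have key: "q2 b * G2 w \<tau> = (ell w \<tau>)\<^sup>2" for w \<tau>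
    proof -
      have poly_id: "along q2 b w * along ?f (L b t) (L w \<tau>) = (along q2 b w * [:t, \<tau>:] + along q3 b w)\<^sup>2 - along branch b w"
        unfolding al along_branch by algebra
      have "coeff (along q2 b w * along ?f (L b t) (L w \<tau>)) 2 = q2 b * G2 w \<tau>"
      proof -
        have "coeff (along ?f (L b t) (L w \<tau>)) 0 = 0" "D1 ?f (L b t) (L w \<tau>) = 0"
          using s by (simp_all add: coeff_along_0[OF f] fL c1 sing_def)
        then show ?thesis by (simp add: coeff_mult numeral_2_eq_2 G2_def coeff_along_0[OF hq2])
      qed
      moreover have "coeff ((along q2 b w * [:t, \<tau>:] + along q3 b w)\<^sup>2) 2 = (ell w \<tau>)\<^sup>2"
      proof -
        have "coeff (along q2 b w * [:t, \<tau>:] + along q3 b w) 0 = 0"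
          using z1[unfolded mult.commute[of "q2 b"]] by (simp add: coeff_mult coeff_along_0[OF hq2] coeff_along_0[OF hq(1)])
        moreover have "coeff (along q2 b w * [:t, \<tau>:] + along q3 b w) (Suc 0) = ell w \<tau>"
          by (simp add: coeff_mult coeff_along_0[OF hq2] ell_def algebra_simps)
        moreover have "coeff (g\<^sup>2) 2 = (coeff g (Suc 0))\<^sup>2" if "coeff g 0 = 0" for g :: "complex poly"
          using that by (simp add: power2_eq_square[of g] coeff_mult numeral_2_eq_2)
        ultimately show ?thesis by simp
      qed
      ultimately show ?thesis using arg_cong[OF poly_id, of "\<lambda>g. coeff g 2"] z[of w] by simp
    qed
    have ell_add: "ell (w + w') (\<tau> + \<tau>') = ell w \<tau> + ell w' \<tau>'" for w w' \<tau> \<tau>'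
      using D1_linear[OF hq2, of b 1 w 1 w'] D1_linear[OF hq(1), of b 1 w 1 w'] by (simp add: ell_def algebra_simps)
    show False
    proof (cases "q2 b = 0")
      case False
      obtain w where w: "w \<noteq> 0" "vdot \<theta> w = 0" using ex_orthogonal_to_two by blast
      define \<tau> where "\<tau> = - (t * D1 q2 b w + D1 q3 b w) / q2 b"
      have e0: "ell w \<tau> = 0" using False by (simp add: ell_def \<tau>_def)
      have "L w \<tau> \<in> vec.span {L b t}"
      proof (rule node_radical[OF node])
        fix y
        obtain w' \<tau>' where y: "y = L w' \<tau>'" using Lsurj by blast
        have "q2 b * G2 (w + w') (\<tau> + \<tau>') = q2 b * G2 w' \<tau>'" unfolding key ell_add e0 by simp
        then show "coeff (along ?f (L b t) (L w \<tau> + y)) 2 = coeff (along ?f (L b t) y) 2"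
          using False by (simp add: y G2_def flip: Ladd)
      qed
      then obtain c where "L w \<tau> = c *s L b t" unfolding vec.span_singleton by blast
      then have wc: "w = c *s b" using rad by blast
      then have "c = 0" using w(2) nodeN[OF bt] by (simp add: vdot_simps)
      then show False using w(1) wc by simp
    next
      case True
      have e0: "t * D1 q2 b w + D1 q3 b w = 0" for w using key[of w 0] True by (simp add: ell_def)
      have "L 0 1 \<in> vec.span {L b t}"
      proof (rule node_radical[OF node])
        fix y
        obtain w' \<tau>' where y: "y = L w' \<tau>'" using Lsurj by blast
        have q30: "q3 b = 0" using True z1 by simp
        have "G2 w' \<tau> = t\<^sup>2 * coeff (along q2 b w') 2 + 2 * t * coeff (along q3 b w') 2 + coeff (along q4 b w') 2
            + 2 * \<tau> * (t * D1 q2 b w' + D1 q3 b w')" for \<tau>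
          unfolding G2_def al two using True q30
          by (simp add: coeff_mult power2_eq_square numeral_2_eq_2 coeff_along_0[OF hq2] coeff_along_0[OF hq(1)] algebra_simps)
        then have "G2 w' (1 + \<tau>') = G2 w' \<tau>'" unfolding e0 by simp
        then show "coeff (along ?f (L b t) (L 0 1 + y)) 2 = coeff (along ?f (L b t) y) 2"
          using Ladd[of 0 w' 1 \<tau>'] by (simp add: y G2_def)
      qed
      then obtain c where "L 0 1 = c *s L b t" unfolding vec.span_singleton by blast
      then have c: "0 = c *s b" "1 = c * t" using rad by blast+
      then have "c = 0" using b0[OF bt] by simp
      then show False using c by simp
    qed
  qed
  interpret nodes15 q3 q4 N \<theta>
    by unfold_locales (use cardN nodeN quad complete in blast)+
  obtain r :: "5 \<Rightarrow> complex^3" and s :: "5 \<Rightarrow> complex" and a :: "complex^5" and c where a: "a \<noteq> 0" "c \<noteq> 0"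
    and q: "\<And>v t. quartic v t = c * igusa_quartic (\<chi> i. vdot (r i) v + s i * t)"
    and ker: "\<And>v t. (\<chi> i. vdot (r i) v + s i * t) = 0 \<Longrightarrow> v = 0 \<and> t = 0"
    and range: "\<And>x. (\<Sum>i\<in>UNIV. a $ i * x $ i) = 0 \<longleftrightarrow> (\<exists>v t. x = (\<chi> i. vdot (r i) v + s i * t))"
    using igusa_normal_form by blast
  define A :: "complex^4^5" where "A = (\<chi> i j. (\<Sum>k\<in>UNIV. r i $ k * R $ k $ j) + s i * \<rho> $ j)"
  have A: "A *v y = (\<chi> i. vdot (r i) (R *v y) + s i * (\<Sum>j\<in>UNIV. \<rho> $ j * y $ j))" for y
  proof -
    have "(A *v y) $ i = vdot (r i) (R *v y) + s i * (\<Sum>j\<in>UNIV. \<rho> $ j * y $ j)" for i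
      by (simp add: A_def matrix_vector_mult_def vdot_3 sum_3 sum_4 algebra_simps)
    then show ?thesis by (simp add: vec_eq_iff)
  qed
  have AL: "A *v L v t = (\<chi> i. vdot (r i) v + s i * t)" for v t unfolding A by (simp only: L_def inv)
  show ?thesis
    unfolding is_hyperplane_section_def
  proof (intro exI conjI allI)
    show "a \<noteq> 0" "c \<noteq> 0" by fact+
    show "inj ((*v) A)"
    proof (rule injI)
      fix y y' assume "A *v y = A *v y'"
      then have "A *v (y - y') = 0" by (simp add: matrix_vector_mult_diff_distrib)
      moreover obtain v t where vt: "y - y' = L v t" using Lsurj by blast
      ultimately have "v = 0 \<and> t = 0" using ker by (simp only: AL)
      then have "y - y' = 0" using vt by (simp add: L0)
      then show "y = y'" by simp
    qed
    show "range ((*v) A) = {x. (\<Sum>i\<in>UNIV. a $ i * x $ i) = 0}"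
    proof (intro subset_antisym subsetI)
      fix x assume "x \<in> range ((*v) A)"
      then obtain y where y: "x = A *v y" by blast
      obtain v t where "y = L v t" using Lsurj by blast
      then have "x = (\<chi> i. vdot (r i) v + s i * t)" using y by (simp only: AL)
      then have "(\<Sum>i\<in>UNIV. a $ i * x $ i) = 0" using range by blast
      then show "x \<in> {x. (\<Sum>i\<in>UNIV. a $ i * x $ i) = 0}" by (rule CollectI)
    next
      fix x assume "x \<in> {x. (\<Sum>i\<in>UNIV. a $ i * x $ i) = 0}"
      then obtain v t where "x = (\<chi> i. vdot (r i) v + s i * t)" using range by blast
      then have "x = A *v L v t" by (simp only: AL)
      then show "x \<in> range ((*v) A)" by (rule range_eqI)
    qed
    fix y
    obtain v t where y: "y = L v t" using Lsurj by blast
    show "?f y = c * igusa_quartic (A *v y)" unfolding y fL AL by (rule q)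
  qed
qed

section \<open>A quartic surface with fifteen nodes\<close>

definition monomial4 :: "nat \<Rightarrow> nat \<Rightarrow> nat \<Rightarrow> nat \<Rightarrow> complex \<Rightarrow> (4, complex) mpoly" where
  "monomial4 a b c d k = Poly_Mapping.single
     (Poly_Mapping.single 1 a + Poly_Mapping.single 2 b + Poly_Mapping.single 3 c + Poly_Mapping.single 4 d) k"

lemma form_at_add: "form_at (p + q) v = form_at p v + form_at q v"
  by (simp add: form_at_def mpoly_eval_add)

lemma prod_UNIV_4: "prod f (UNIV :: 4 set) = f 1 * f 2 * f 3 * f 4"
  unfolding UNIV_4 by (simp add: mult_ac)

lemma form_at_monomial4:
  "form_at (monomial4 a b c d k) v = k * v $ 1 ^ a * v $ 2 ^ b * v $ 3 ^ c * v $ 4 ^ d"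
  by (simp add: form_at_def monomial4_def mpoly_eval_single prod_UNIV_4 lookup_add lookup_single mult_ac)

lemma mpoly_pderiv_add: "mpoly_pderiv i (p + q) = mpoly_pderiv i p + mpoly_pderiv i q"
  by (rule poly_mapping_eqI) (simp add: lookup_mpoly_pderiv lookup_add distrib_left)

lemma mpoly_pderiv_single:
  "mpoly_pderiv i (Poly_Mapping.single m k) =
     Poly_Mapping.single (m - Poly_Mapping.single i 1) (of_nat (Poly_Mapping.lookup m i) * k)"
  by (cases "k = 0") (simp_all add: mpoly_pderiv_def)

lemma mpoly_pderiv_monomial4:
  "mpoly_pderiv 1 (monomial4 a b c d k) = monomial4 (a - 1) b c d (of_nat a * k)"
  "mpoly_pderiv 2 (monomial4 a b c d k) = monomial4 a (b - 1) c d (of_nat b * k)"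
  "mpoly_pderiv 3 (monomial4 a b c d k) = monomial4 a b (c - 1) d (of_nat c * k)"
  "mpoly_pderiv 4 (monomial4 a b c d k) = monomial4 a b c (d - 1) (of_nat d * k)"
  unfolding monomial4_def mpoly_pderiv_single
  by (intro arg_cong2[of _ _ _ _ Poly_Mapping.single] poly_mapping_eqI;
      auto simp: lookup_add lookup_minus lookup_single when_def)+

lemma monomial4_in_forms: "a + b + c + d = n \<Longrightarrow> monomial4 a b c d k \<in> forms n"
  by (auto simp: forms_def monomial4_def sum_4 lookup_add lookup_single)

lemma forms_add: "p \<in> forms d \<Longrightarrow> q \<in> forms d \<Longrightarrow> p + q \<in> forms d"
  for p q :: "('v::finite, complex) mpoly"
  using Poly_Mapping.keys_add[of p q] by (auto simp: forms_def)

text \<open>In coordinates \<open>u, v, w, t\<close> this is \<open>t\<^sup>2 (4 w\<^sup>2 - 8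
  u\<^sup>2 - 8 v\<^sup>2)\<close> plus Heron's expression in \<open>u, v, w\<close>. The plane
  \<open>t = 0\<close> cuts out four lines, which meet in six nodes; one node is the point \<open>u
  = v = w = 0\<close>, and the other eight differ by signs.\<close>

definition fifteen_nodal :: "(4, complex) mpoly" where
  "fifteen_nodal = monomial4 2 0 0 2 (-8) + monomial4 0 2 0 2 (-8) + monomial4 0 0 2 2 4
     + monomial4 2 2 0 0 2 + monomial4 2 0 2 0 2 + monomial4 0 2 2 0 2
     + monomial4 4 0 0 0 (-1) + monomial4 0 4 0 0 (-1) + monomial4 0 0 4 0 (-1)"

lemma fifteen_nodal_in_forms: "fifteen_nodal \<in> forms 4"
  unfolding fifteen_nodal_def
  by (intro forms_add monomial4_in_forms) simp_all

lemmas fifteen_nodal_simps = fifteen_nodal_def mpoly_pderiv_add mpoly_pderiv_monomial4 form_at_add form_at_monomial4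

lemma singular_fifteen_nodal_iff:
  "singular_at fifteen_nodal x \<longleftrightarrow> x \<noteq> 0 \<and>
     x $ 1 * ((x $ 2)\<^sup>2 + (x $ 3)\<^sup>2 - (x $ 1)\<^sup>2 - 4 * (x $ 4)\<^sup>2) = 0 \<and>
     x $ 2 * ((x $ 1)\<^sup>2 + (x $ 3)\<^sup>2 - (x $ 2)\<^sup>2 - 4 * (x $ 4)\<^sup>2) = 0 \<and>
     x $ 3 * ((x $ 1)\<^sup>2 + (x $ 2)\<^sup>2 - (x $ 3)\<^sup>2 + 2 * (x $ 4)\<^sup>2) = 0 \<and>
     x $ 4 * ((x $ 3)\<^sup>2 - 2 * (x $ 1)\<^sup>2 - 2 * (x $ 2)\<^sup>2) = 0" (is "_ \<longleftrightarrow> _ \<and> ?g1 = 0 \<and> ?g2 = 0 \<and> ?g3 = 0 \<and> ?g4 = 0")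
proof -
  have d: "form_at (mpoly_pderiv 1 fifteen_nodal) x = 4 * ?g1" "form_at (mpoly_pderiv 2 fifteen_nodal) x = 4 * ?g2"
    "form_at (mpoly_pderiv 3 fifteen_nodal) x = 4 * ?g3" "form_at (mpoly_pderiv 4 fifteen_nodal) x = 8 * ?g4"
    by (simp_all add: fifteen_nodal_simps power2_eq_square power3_eq_cube algebra_simps)
  have "form_at fifteen_nodal x = x $ 1 * ?g1 + x $ 2 * ?g2 + x $ 3 * ?g3 + 2 * (x $ 4 * ?g4)"
    by (simp add: fifteen_nodal_simps power2_eq_square power4_eq_xxxx algebra_simps)
  then show ?thesis unfolding singular_at_def forall_4 d by auto
qed

lemma hessian_fifteen_nodal:
  fixes x w :: "complex^4"
  shows
  "(hessian fifteen_nodal x *v w) $ 1 = 4 * (((x $ 2)\<^sup>2 + (x $ 3)\<^sup>2 - 3 * (x $ 1)\<^sup>2 - 4 * (x $ 4)\<^sup>2) * w $ 1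
      + 2 * x $ 1 * x $ 2 * w $ 2 + 2 * x $ 1 * x $ 3 * w $ 3 - 8 * x $ 1 * x $ 4 * w $ 4)"
  "(hessian fifteen_nodal x *v w) $ 2 = 4 * (2 * x $ 1 * x $ 2 * w $ 1
      + ((x $ 1)\<^sup>2 + (x $ 3)\<^sup>2 - 3 * (x $ 2)\<^sup>2 - 4 * (x $ 4)\<^sup>2) * w $ 2 + 2 * x $ 2 * x $ 3 * w $ 3 - 8 * x $ 2 * x $ 4 * w $ 4)"
  "(hessian fifteen_nodal x *v w) $ 3 = 4 * (2 * x $ 1 * x $ 3 * w $ 1 + 2 * x $ 2 * x $ 3 * w $ 2
      + ((x $ 1)\<^sup>2 + (x $ 2)\<^sup>2 - 3 * (x $ 3)\<^sup>2 + 2 * (x $ 4)\<^sup>2) * w $ 3 + 4 * x $ 3 * x $ 4 * w $ 4)"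
  "(hessian fifteen_nodal x *v w) $ 4 = 8 * (- 4 * x $ 1 * x $ 4 * w $ 1 - 4 * x $ 2 * x $ 4 * w $ 2
      + 2 * x $ 3 * x $ 4 * w $ 3 + ((x $ 3)\<^sup>2 - 2 * (x $ 1)\<^sup>2 - 2 * (x $ 2)\<^sup>2) * w $ 4)"
  by (simp_all add: hessian_def matrix_vector_mult_def sum_4 fifteen_nodal_simps power2_eq_square algebra_simps)

lemma singular_fifteen_nodal_cases:
  assumes "singular_at fifteen_nodal x"
  obtains (vertex) "x $ 1 = 0" "x $ 2 = 0" "x $ 3 = 0" "x $ 4 \<noteq> 0"
  | (plane1) "x $ 4 = 0" "x $ 1 = 0" "x $ 2 \<noteq> 0" "(x $ 3)\<^sup>2 = (x $ 2)\<^sup>2"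
  | (plane2) "x $ 4 = 0" "x $ 2 = 0" "x $ 1 \<noteq> 0" "(x $ 3)\<^sup>2 = (x $ 1)\<^sup>2"
  | (plane3) "x $ 4 = 0" "x $ 3 = 0" "x $ 1 \<noteq> 0" "(x $ 2)\<^sup>2 = (x $ 1)\<^sup>2"
  | (cube) "x $ 4 \<noteq> 0" "(x $ 1)\<^sup>2 = (x $ 4)\<^sup>2" "(x $ 2)\<^sup>2 = (x $ 4)\<^sup>2" "(x $ 3)\<^sup>2 = 4 * (x $ 4)\<^sup>2"
proof -
  define a b c d where abcd: "a = (x $ 1)\<^sup>2" "b = (x $ 2)\<^sup>2" "c = (x $ 3)\<^sup>2" "d = (x $ 4)\<^sup>2"
  have nz: "a \<noteq> 0 \<or> b \<noteq> 0 \<or> c \<noteq> 0 \<or> d \<noteq> 0"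
    using assms by (auto simp: singular_at_def abcd vec_eq_iff forall_4)
  have eqs: "a = 0 \<or> b + c = a + 4 * d" "b = 0 \<or> a + c = b + 4 * d" "c = 0 \<or> a + b + 2 * d = c" "d = 0 \<or> c = 2 * a + 2 * b"
  proof -
    have z: "x $ 1 = 0 \<longleftrightarrow> a = 0" "x $ 2 = 0 \<longleftrightarrow> b = 0" "x $ 3 = 0 \<longleftrightarrow> c = 0" "x $ 4 = 0 \<longleftrightarrow> d = 0"
      by (simp_all add: abcd)
    have m: "b + c - a - 4 * d = 0 \<longleftrightarrow> b + c = a + 4 * d" "a + c - b - 4 * d = 0 \<longleftrightarrow> a + c = b + 4 * d"
      "a + b - c + 2 * d = 0 \<longleftrightarrow> a + b + 2 * d = c" "c - 2 * a - 2 * b = 0 \<longleftrightarrow> c = 2 * a + 2 * b"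
      by (auto simp: algebra_simps)
    show "a = 0 \<or> b + c = a + 4 * d" "b = 0 \<or> a + c = b + 4 * d" "c = 0 \<or> a + b + 2 * d = c" "d = 0 \<or> c = 2 * a + 2 * b"
      using assms unfolding singular_fifteen_nodal_iff abcd[symmetric] mult_eq_0_iff z m by blast+
  qed
  have "(a = 0 \<and> b = 0 \<and> c = 0 \<and> d \<noteq> 0) \<or> (d = 0 \<and> a = 0 \<and> b \<noteq> 0 \<and> c = b) \<or> (d = 0 \<and> b = 0 \<and> a \<noteq> 0 \<and> c = a)
      \<or> (d = 0 \<and> c = 0 \<and> a \<noteq> 0 \<and> b = a) \<or> (d \<noteq> 0 \<and> a = d \<and> b = d \<and> c = 4 * d)"
  proof (cases "d = 0")
    case True
    show ?thesis
    proof (cases "a = 0 \<or> b = 0 \<or> c = 0")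
      case True then show ?thesis using eqs nz \<open>d = 0\<close> by auto
    next
      case False
      then have e: "b + c = a" "a + c = b" using eqs \<open>d = 0\<close> by auto
      have "b + (c + c) = b" unfolding add.assoc[symmetric] e(1) by (rule e(2))
      then have "2 * c = 0" unfolding mult_2 by (simp only: add_cancel_left_right)
      then show ?thesis using False by simp
    qed
  next
    case d: False
    then have c: "c = 2 * a + 2 * b" using eqs by simp
    show ?thesis
    proof (cases "a = 0 \<and> b = 0")
      case True then show ?thesis using c d by simp
    next
      case False
      \<comment> \<open>if just one of \<open>a\<close> and \<open>b\<close> vanishes, two equations disagree on the ratio of the other to \<open>d\<close>\<close>
      have "a \<noteq> 0"
      proof
        assume "a = 0"
        then have "b \<noteq> 0" "c = 2 * b" using False c by auto
        then have e: "2 * b = b + 4 * d" "b + 2 * d = 2 * b" using eqs \<open>a = 0\<close> by auto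
        have "2 * d = - (2 * b - (b + 4 * d)) - (b + 2 * d - 2 * b)" by (simp add: algebra_simps)
        also have "\<dots> = 0" unfolding iffD1[OF eq_iff_diff_eq_0 e(1)] iffD1[OF eq_iff_diff_eq_0 e(2)] by simp
        finally have "d = 0" by simp
        then show False using d by simp
      qed
      moreover have "b \<noteq> 0"
      proof
        assume "b = 0"
        then have "a \<noteq> 0" "c = 2 * a" using False c by auto
        then have e: "2 * a = a + 4 * d" "a + 2 * d = 2 * a" using eqs \<open>b = 0\<close> by auto
        have "2 * d = - (2 * a - (a + 4 * d)) - (a + 2 * d - 2 * a)" by (simp add: algebra_simps)
        also have "\<dots> = 0" unfolding iffD1[OF eq_iff_diff_eq_0 e(1)] iffD1[OF eq_iff_diff_eq_0 e(2)] by simp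
        finally have "d = 0" by simp
        then show False using d by simp
      qed
      ultimately have e: "b + c = a + 4 * d" "a + c = b + 4 * d" using eqs by auto
      note z = iffD1[OF eq_iff_diff_eq_0 e(1)] iffD1[OF eq_iff_diff_eq_0 e(2)] iffD1[OF eq_iff_diff_eq_0 c]
      have "2 * (c - 4 * d) = (b + c - (a + 4 * d)) + (a + c - (b + 4 * d))"
        "8 * (a - d) = - (b + c - (a + 4 * d)) + 3 * (a + c - (b + 4 * d)) - 2 * (c - (2 * a + 2 * b))"
        "8 * (b - d) = 3 * (b + c - (a + 4 * d)) - (a + c - (b + 4 * d)) - 2 * (c - (2 * a + 2 * b))"
        by (simp_all add: algebra_simps)
      then have "2 * (c - 4 * d) = 0" "8 * (a - d) = 0" "8 * (b - d) = 0" unfolding z by simp_all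
      then have "a = d" "b = d" "c = 4 * d" by simp_all
      then show ?thesis using d by simp
    qed
  qed
  then consider "a = 0" "b = 0" "c = 0" "d \<noteq> 0" | "d = 0" "a = 0" "b \<noteq> 0" "c = b" | "d = 0" "b = 0" "a \<noteq> 0" "c = a"
    | "d = 0" "c = 0" "a \<noteq> 0" "b = a" | "d \<noteq> 0" "a = d" "b = d" "c = 4 * d" by blast
  then show ?thesis
  proof cases
    case 1 then show ?thesis by (intro vertex) (simp_all add: abcd)
  next
    case 2 then show ?thesis by (intro plane1) (simp_all add: abcd)
  next
    case 3 then show ?thesis by (intro plane2) (simp_all add: abcd)
  next
    case 4 then show ?thesis by (intro plane3) (simp_all add: abcd)
  next
    case 5 then show ?thesis by (intro cube) (simp_all add: abcd)
  qed
qed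

text \<open>By Euler's relation the Hessian annihilates the singular point itself. Conversely,
  suitable multiples of its rows, reduced by the relations between the squared coordinates, show
  that every vector of the kernel is proportional to the point.\<close>

lemma fifteen_nodal_node:
  assumes s: "singular_at fifteen_nodal x" shows "node_at fifteen_nodal x"
proof -
  let ?H = "hessian fifteen_nodal x"
  have "(?H *v x) $ 1 = 12 * (x $ 1 * ((x $ 2)\<^sup>2 + (x $ 3)\<^sup>2 - (x $ 1)\<^sup>2 - 4 * (x $ 4)\<^sup>2))"
    "(?H *v x) $ 2 = 12 * (x $ 2 * ((x $ 1)\<^sup>2 + (x $ 3)\<^sup>2 - (x $ 2)\<^sup>2 - 4 * (x $ 4)\<^sup>2))"
    "(?H *v x) $ 3 = 12 * (x $ 3 * ((x $ 1)\<^sup>2 + (x $ 2)\<^sup>2 - (x $ 3)\<^sup>2 + 2 * (x $ 4)\<^sup>2))"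
    "(?H *v x) $ 4 = 24 * (x $ 4 * ((x $ 3)\<^sup>2 - 2 * (x $ 1)\<^sup>2 - 2 * (x $ 2)\<^sup>2))"
    unfolding hessian_fifteen_nodal by (simp_all add: algebra_simps power2_eq_square)
  moreover note s[unfolded singular_fifteen_nodal_iff]
  ultimately have "?H *v x = 0" unfolding vec_eq_iff forall_4 by (simp only: mult_zero_right zero_index simp_thms)
  then have "?H *v (c *s x) = 0" for c by (metis vector_scalar_commute vec.scale_zero_right)
  then have "vec.span {x} \<subseteq> {w. ?H *v w = 0}" unfolding vec.span_singleton by auto
  moreover have "w \<in> vec.span {x}" if w: "?H *v w = 0" for w
  proof -
    have h: "(?H *v w) $ i = 0" for i unfolding w by simp
    have "\<exists>c. \<forall>i. w $ i = c * x $ i"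
      using s
    proof (cases rule: singular_fifteen_nodal_cases)
      case vertex
      have "16 * (x $ 4)\<^sup>2 * w $ 1 = - (?H *v w) $ 1" "16 * (x $ 4)\<^sup>2 * w $ 2 = - (?H *v w) $ 2"
        "8 * (x $ 4)\<^sup>2 * w $ 3 = (?H *v w) $ 3"
        using vertex(1-3) unfolding hessian_fifteen_nodal by simp_all
      then have "w $ 1 = 0" "w $ 2 = 0" "w $ 3 = 0" using vertex(4) unfolding h by simp_all
      then show ?thesis using vertex unfolding forall_4
        by (intro exI[of _ "w $ 4 / x $ 4"]) simp
    next
      case plane1
      have rel: "((x $ 3)\<^sup>2 - (x $ 2)\<^sup>2) = 0" using plane1(4) by simp
      have "8 * (x $ 2)\<^sup>2 * w $ 1 = (?H *v w) $ 1 - 4 * w $ 1 * ((x $ 3)\<^sup>2 - (x $ 2)\<^sup>2)"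
        "(- 8) * (x $ 2)\<^sup>2 * w $ 4 = (?H *v w) $ 4 + (- 8) * w $ 4 * ((x $ 3)\<^sup>2 - (x $ 2)\<^sup>2)"
        "8 * x $ 2 * (x $ 3 * w $ 3 - x $ 2 * w $ 2) = (?H *v w) $ 2 - 4 * w $ 2 * ((x $ 3)\<^sup>2 - (x $ 2)\<^sup>2)"
        using plane1(1,2) unfolding hessian_fifteen_nodal by (simp_all add: algebra_simps power2_eq_square)
      then have e: "w $ 1 = 0" "w $ 4 = 0" "x $ 3 * w $ 3 - x $ 2 * w $ 2 = 0" using plane1(3) unfolding h rel by simp_all
      have "x $ 2 * (x $ 2 * w $ 3 - w $ 2 * x $ 3) = x $ 3 * (x $ 3 * w $ 3 - x $ 2 * w $ 2) - w $ 3 * ((x $ 3)\<^sup>2 - (x $ 2)\<^sup>2)"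
        by (simp add: algebra_simps power2_eq_square)
      then have "x $ 2 * w $ 3 = w $ 2 * x $ 3" using plane1(3) unfolding e rel by simp
      then show ?thesis using plane1 e(1,2) unfolding forall_4
        by (intro exI[of _ "w $ 2 / x $ 2"]) (simp add: field_simps)
    next
      case plane2
      have rel: "((x $ 3)\<^sup>2 - (x $ 1)\<^sup>2) = 0" using plane2(4) by simp
      have "8 * (x $ 1)\<^sup>2 * w $ 2 = (?H *v w) $ 2 - 4 * w $ 2 * ((x $ 3)\<^sup>2 - (x $ 1)\<^sup>2)"
        "(- 8) * (x $ 1)\<^sup>2 * w $ 4 = (?H *v w) $ 4 + (- 8) * w $ 4 * ((x $ 3)\<^sup>2 - (x $ 1)\<^sup>2)"
        "8 * x $ 1 * (x $ 3 * w $ 3 - x $ 1 * w $ 1) = (?H *v w) $ 1 - 4 * w $ 1 * ((x $ 3)\<^sup>2 - (x $ 1)\<^sup>2)"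
        using plane2(1,2) unfolding hessian_fifteen_nodal by (simp_all add: algebra_simps power2_eq_square)
      then have e: "w $ 2 = 0" "w $ 4 = 0" "x $ 3 * w $ 3 - x $ 1 * w $ 1 = 0" using plane2(3) unfolding h rel by simp_all
      have "x $ 1 * (x $ 1 * w $ 3 - w $ 1 * x $ 3) = x $ 3 * (x $ 3 * w $ 3 - x $ 1 * w $ 1) - w $ 3 * ((x $ 3)\<^sup>2 - (x $ 1)\<^sup>2)"
        by (simp add: algebra_simps power2_eq_square)
      then have "x $ 1 * w $ 3 = w $ 1 * x $ 3" using plane2(3) unfolding e rel by simp
      then show ?thesis using plane2 e(1,2) unfolding forall_4
        by (intro exI[of _ "w $ 1 / x $ 1"]) (simp add: field_simps)
    next
      case plane3
      have rel: "((x $ 2)\<^sup>2 - (x $ 1)\<^sup>2) = 0" using plane3(4) by simp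
      have "8 * (x $ 1)\<^sup>2 * w $ 3 = (?H *v w) $ 3 - 4 * w $ 3 * ((x $ 2)\<^sup>2 - (x $ 1)\<^sup>2)"
        "(- 32) * (x $ 1)\<^sup>2 * w $ 4 = (?H *v w) $ 4 + 16 * w $ 4 * ((x $ 2)\<^sup>2 - (x $ 1)\<^sup>2)"
        "8 * x $ 1 * (x $ 2 * w $ 2 - x $ 1 * w $ 1) = (?H *v w) $ 1 - 4 * w $ 1 * ((x $ 2)\<^sup>2 - (x $ 1)\<^sup>2)"
        using plane3(1,2) unfolding hessian_fifteen_nodal by (simp_all add: algebra_simps power2_eq_square)
      then have e: "w $ 3 = 0" "w $ 4 = 0" "x $ 2 * w $ 2 - x $ 1 * w $ 1 = 0" using plane3(3) unfolding h rel by simp_all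
      have "x $ 1 * (x $ 1 * w $ 2 - w $ 1 * x $ 2) = x $ 2 * (x $ 2 * w $ 2 - x $ 1 * w $ 1) - w $ 2 * ((x $ 2)\<^sup>2 - (x $ 1)\<^sup>2)"
        by (simp add: algebra_simps power2_eq_square)
      then have "x $ 1 * w $ 2 = w $ 1 * x $ 2" using plane3(3) unfolding e rel by simp
      then show ?thesis using plane3 e(1,2) unfolding forall_4
        by (intro exI[of _ "w $ 1 / x $ 1"]) (simp add: field_simps)
    next
      case cube
      have rel: "((x $ 1)\<^sup>2 - (x $ 4)\<^sup>2) = 0" "((x $ 2)\<^sup>2 - (x $ 4)\<^sup>2) = 0" "((x $ 3)\<^sup>2 - 4 * (x $ 4)\<^sup>2) = 0" using cube(2-4) by simp_all
      have "8 * (x $ 4)\<^sup>2 * (- (x $ 1 * w $ 1) + x $ 2 * w $ 2 + x $ 3 * w $ 3 - 4 * (x $ 4 * w $ 4)) = x $ 1 * (?H *v w) $ 1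
          - 4 * (x $ 1 * w $ 1) * (((x $ 2)\<^sup>2 - (x $ 4)\<^sup>2) + ((x $ 3)\<^sup>2 - 4 * (x $ 4)\<^sup>2) - 3 * ((x $ 1)\<^sup>2 - (x $ 4)\<^sup>2)) - 8 * (x $ 2 * w $ 2 + x $ 3 * w $ 3 - 4 * (x $ 4 * w $ 4)) * ((x $ 1)\<^sup>2 - (x $ 4)\<^sup>2)"
        "8 * (x $ 4)\<^sup>2 * (x $ 1 * w $ 1 - x $ 2 * w $ 2 + x $ 3 * w $ 3 - 4 * (x $ 4 * w $ 4)) = x $ 2 * (?H *v w) $ 2
          - 4 * (x $ 2 * w $ 2) * (((x $ 1)\<^sup>2 - (x $ 4)\<^sup>2) + ((x $ 3)\<^sup>2 - 4 * (x $ 4)\<^sup>2) - 3 * ((x $ 2)\<^sup>2 - (x $ 4)\<^sup>2)) - 8 * (x $ 1 * w $ 1 + x $ 3 * w $ 3 - 4 * (x $ 4 * w $ 4)) * ((x $ 2)\<^sup>2 - (x $ 4)\<^sup>2)"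
        "32 * (x $ 4)\<^sup>2 * (x $ 1 * w $ 1 + x $ 2 * w $ 2 - x $ 3 * w $ 3 + 2 * (x $ 4 * w $ 4)) = x $ 3 * (?H *v w) $ 3
          - 8 * (x $ 1 * w $ 1 + x $ 2 * w $ 2) * ((x $ 3)\<^sup>2 - 4 * (x $ 4)\<^sup>2) - 4 * (x $ 3 * w $ 3) * (((x $ 1)\<^sup>2 - (x $ 4)\<^sup>2) + ((x $ 2)\<^sup>2 - (x $ 4)\<^sup>2) - 3 * ((x $ 3)\<^sup>2 - 4 * (x $ 4)\<^sup>2)) - 16 * ((x $ 3)\<^sup>2 - 4 * (x $ 4)\<^sup>2) * (x $ 4 * w $ 4)"
        unfolding hessian_fifteen_nodal by (simp_all add: algebra_simps power2_eq_square)
      then have e: "- (x $ 1 * w $ 1) + x $ 2 * w $ 2 + x $ 3 * w $ 3 - 4 * (x $ 4 * w $ 4) = 0" "x $ 1 * w $ 1 - x $ 2 * w $ 2 + x $ 3 * w $ 3 - 4 * (x $ 4 * w $ 4) = 0"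
        "x $ 1 * w $ 1 + x $ 2 * w $ 2 - x $ 3 * w $ 3 + 2 * (x $ 4 * w $ 4) = 0" using cube(1) unfolding h rel by simp_all
      have "2 * (x $ 1 * w $ 1 - x $ 4 * w $ 4) = (x $ 1 * w $ 1 - x $ 2 * w $ 2 + x $ 3 * w $ 3 - 4 * (x $ 4 * w $ 4)) + (x $ 1 * w $ 1 + x $ 2 * w $ 2 - x $ 3 * w $ 3 + 2 * (x $ 4 * w $ 4))"
        "2 * (x $ 2 * w $ 2 - x $ 4 * w $ 4) = (- (x $ 1 * w $ 1) + x $ 2 * w $ 2 + x $ 3 * w $ 3 - 4 * (x $ 4 * w $ 4)) + (x $ 1 * w $ 1 + x $ 2 * w $ 2 - x $ 3 * w $ 3 + 2 * (x $ 4 * w $ 4))"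
        "2 * (x $ 3 * w $ 3 - 4 * (x $ 4 * w $ 4)) = (- (x $ 1 * w $ 1) + x $ 2 * w $ 2 + x $ 3 * w $ 3 - 4 * (x $ 4 * w $ 4)) + (x $ 1 * w $ 1 - x $ 2 * w $ 2 + x $ 3 * w $ 3 - 4 * (x $ 4 * w $ 4))"
        by (simp_all add: algebra_simps)
      then have e': "x $ 1 * w $ 1 - x $ 4 * w $ 4 = 0" "x $ 2 * w $ 2 - x $ 4 * w $ 4 = 0" "x $ 3 * w $ 3 - 4 * (x $ 4 * w $ 4) = 0" unfolding e add_0_left by (simp_all only: mult_eq_0_iff numeral_neq_zero simp_thms)
      have "x $ 4 * (x $ 4 * w $ 1 - w $ 4 * x $ 1) = x $ 1 * (x $ 1 * w $ 1 - x $ 4 * w $ 4) - w $ 1 * ((x $ 1)\<^sup>2 - (x $ 4)\<^sup>2)"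
        "x $ 4 * (x $ 4 * w $ 2 - w $ 4 * x $ 2) = x $ 2 * (x $ 2 * w $ 2 - x $ 4 * w $ 4) - w $ 2 * ((x $ 2)\<^sup>2 - (x $ 4)\<^sup>2)"
        "4 * x $ 4 * (x $ 4 * w $ 3 - w $ 4 * x $ 3) = x $ 3 * (x $ 3 * w $ 3 - 4 * (x $ 4 * w $ 4)) - w $ 3 * ((x $ 3)\<^sup>2 - 4 * (x $ 4)\<^sup>2)"
        by (simp_all add: algebra_simps power2_eq_square)
      then have "x $ 4 * w $ 1 = w $ 4 * x $ 1" "x $ 4 * w $ 2 = w $ 4 * x $ 2" "x $ 4 * w $ 3 = w $ 4 * x $ 3"
        using cube(1) unfolding e' rel
        by (simp_all only: mult_zero_right diff_self mult_eq_0_iff numeral_neq_zero simp_thms right_minus_eq)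
      then show ?thesis using cube(1) unfolding forall_4
        by (intro exI[of _ "w $ 4 / x $ 4"]) (simp add: field_simps)
    qed
    then show ?thesis unfolding vec.span_singleton by (auto simp: vec_eq_iff)
  qed
  ultimately show ?thesis using s unfolding node_at_def by blast
qed

definition node_table :: "(int \<times> int \<times> int \<times> int) set" where
  "node_table = {(0,0,0,1), (1,1,0,0), (1,-1,0,0), (1,0,1,0), (1,0,-1,0), (0,1,1,0), (0,1,-1,0),
     (1,1,2,1), (1,1,-2,1), (1,-1,2,1), (1,-1,-2,1), (-1,1,2,1), (-1,1,-2,1), (-1,-1,2,1), (-1,-1,-2,1)}"

definition int_point :: "int \<times> int \<times> int \<times> int \<Rightarrow> complex^4" where
  "int_point = (\<lambda>(a, b, c, d). \<chi> i. of_int (if i = 1 then a else if i = 2 then b else if i = 3 then c else d))"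

lemma card_node_table: "finite node_table" "card node_table = 15"
  by (simp_all add: node_table_def)

lemma int_point_nth: "int_point (a, b, c, d) $ 1 = of_int a" "int_point (a, b, c, d) $ 2 = of_int b"
  "int_point (a, b, c, d) $ 3 = of_int c" "int_point (a, b, c, d) $ 4 = of_int d"
  by (simp_all add: int_point_def)

lemma singular_int_point:
  assumes "m \<in> node_table" shows "singular_at fifteen_nodal (int_point m)"
proof -
  obtain a b c d where m: "m = (a, b, c, d)" by (cases m)
  have "\<forall>m\<in>node_table. case m of (a, b, c, d) \<Rightarrow> (a \<noteq> 0 \<or> b \<noteq> 0 \<or> c \<noteq> 0 \<or> d \<noteq> 0) \<and> a * (b\<^sup>2 + c\<^sup>2 - a\<^sup>2 - 4 * d\<^sup>2) = 0 \<and> b * (a\<^sup>2 + c\<^sup>2 - b\<^sup>2 - 4 * d\<^sup>2) = 0 \<and>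
      c * (a\<^sup>2 + b\<^sup>2 - c\<^sup>2 + 2 * d\<^sup>2) = 0 \<and> d * (c\<^sup>2 - 2 * a\<^sup>2 - 2 * b\<^sup>2) = 0"
    unfolding node_table_def by simp
  from bspec[OF this assms] have i: "a \<noteq> 0 \<or> b \<noteq> 0 \<or> c \<noteq> 0 \<or> d \<noteq> 0" "a * (b\<^sup>2 + c\<^sup>2 - a\<^sup>2 - 4 * d\<^sup>2) = 0"
      "b * (a\<^sup>2 + c\<^sup>2 - b\<^sup>2 - 4 * d\<^sup>2) = 0" "c * (a\<^sup>2 + b\<^sup>2 - c\<^sup>2 + 2 * d\<^sup>2) = 0" "d * (c\<^sup>2 - 2 * a\<^sup>2 - 2 * b\<^sup>2) = 0"
    unfolding m prod.case by blast+
  have "int_point (a, b, c, d) \<noteq> 0"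
  proof
    assume z: "int_point (a, b, c, d) = 0"
    have "of_int a = (0 :: complex)" "of_int b = (0 :: complex)" "of_int c = (0 :: complex)" "of_int d = (0 :: complex)"
      using int_point_nth[of a b c d] unfolding z zero_index by simp_all
    then show False using i(1) by simp
  qed
  moreover have "(of_int (a * (b\<^sup>2 + c\<^sup>2 - a\<^sup>2 - 4 * d\<^sup>2)) :: complex) = 0" "(of_int (b * (a\<^sup>2 + c\<^sup>2 - b\<^sup>2 - 4 * d\<^sup>2)) :: complex) = 0"
    "(of_int (c * (a\<^sup>2 + b\<^sup>2 - c\<^sup>2 + 2 * d\<^sup>2)) :: complex) = 0" "(of_int (d * (c\<^sup>2 - 2 * a\<^sup>2 - 2 * b\<^sup>2)) :: complex) = 0"
    by (simp_all only: i(2-5) of_int_0)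
  ultimately show ?thesis
    unfolding m singular_fifteen_nodal_iff int_point_nth of_int_mult of_int_diff of_int_add of_int_power of_int_numeral
    by blast
qed

text \<open>The first nonzero entry among the last, first and second coordinates is homogeneous of degree
  one and equal to \<open>1\<close> throughout the table; hence no two entries are proportional.\<close>

lemma inj_int_point_span: "inj_on (\<lambda>m. vec.span {int_point m}) node_table"
proof (rule inj_onI)
  define N :: "complex^4 \<Rightarrow> complex" where "N x = (if x $ 4 \<noteq> 0 then x $ 4 else if x $ 1 \<noteq> 0 then x $ 1 else x $ 2)" for x
  have N1: "N (int_point m) = 1" if m: "m \<in> node_table" for m
  proof -
    obtain a b c d where abcd: "m = (a, b, c, d)" by (cases m)
    have "\<forall>m\<in>node_table. case m of (a, b, c, d) \<Rightarrow> d = 1 \<or> (d = 0 \<and> a = 1) \<or> (d = 0 \<and> a = 0 \<and> b = 1)"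
      unfolding node_table_def by simp
    from bspec[OF this m] have "d = 1 \<or> (d = 0 \<and> a = 1) \<or> (d = 0 \<and> a = 0 \<and> b = 1)" unfolding abcd prod.case .
    then show ?thesis unfolding N_def abcd int_point_nth by (elim disjE conjE) simp_all
  qed
  fix m m' assume m: "m \<in> node_table" "m' \<in> node_table" and e: "vec.span {int_point m} = vec.span {int_point m'}"
  have "int_point m \<in> vec.span {int_point m'}" unfolding e[symmetric] by (rule vec.span_base) simp
  then obtain k where k: "int_point m = k *s int_point m'" unfolding vec.span_singleton by blast
  have "k \<noteq> 0"
  proof
    assume "k = 0"
    then have "int_point m = 0" using k by simp
    then show False using N1[OF m(1)] by (simp add: N_def)
  qed
  then have "N (k *s int_point m') = k * N (int_point m')" by (simp add: N_def)
  then have "N (int_point m) = k * N (int_point m')" by (simp only: k)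
  then have "k = 1" unfolding N1[OF m(1)] N1[OF m(2)] by simp
  then have same: "int_point m = int_point m'" using k by simp
  obtain a b c d where m1: "m = (a, b, c, d)" by (cases m)
  obtain a' b' c' d' where m2: "m' = (a', b', c', d')" by (cases m')
  have "int_point (a, b, c, d) $ i = int_point (a', b', c', d') $ i" for i using same unfolding m1 m2 by simp
  from this[of 1] this[of 2] this[of 3] this[of 4] have "a = a'" "b = b'" "c = c'" "d = d'"
    unfolding int_point_nth of_int_eq_iff by blast+
  then show "m = m'" unfolding m1 m2 by simp
qed

lemma singular_points_fifteen_nodal:
  "singular_points fifteen_nodal = (\<lambda>m. vec.span {int_point m}) ` node_table"
proof (intro subset_antisym subsetI)
  fix S assume "S \<in> (\<lambda>m. vec.span {int_point m}) ` node_table"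
  then obtain m where "m \<in> node_table" "S = vec.span {int_point m}" by blast
  then show "S \<in> singular_points fifteen_nodal"
    using singular_int_point unfolding singular_points_def by blast
next
  fix S assume "S \<in> singular_points fifteen_nodal"
  then obtain x where x: "singular_at fifteen_nodal x" "S = vec.span {x}" unfolding singular_points_def by blast
  have x0: "x \<noteq> 0" using x(1) unfolding singular_at_def by blast
  have mem: "S \<in> (\<lambda>m. vec.span {int_point m}) ` node_table"
    if t: "(a, b, c, d) \<in> node_table" and k: "k \<noteq> 0"
      and xk: "x $ 1 = k * of_int a" "x $ 2 = k * of_int b" "x $ 3 = k * of_int c" "x $ 4 = k * of_int d" for a b c d k
  proof -
    have e: "x = k *s int_point (a, b, c, d)"
      unfolding vec_eq_iff forall_4 vector_smult_component int_point_nth using xk by blast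
    have v0: "int_point (a, b, c, d) \<noteq> 0"
    proof
      assume "int_point (a, b, c, d) = 0"
      then have "x = 0" using e by simp
      then show False using x0 by blast
    qed
    have "vec.span {x} = vec.span {int_point (a, b, c, d)}"
      using span_singleton_eq_iff[OF x0 v0] e k by blast
    then show ?thesis using t x(2) by blast
  qed
  show "S \<in> (\<lambda>m. vec.span {int_point m}) ` node_table"
    using x(1)
  proof (cases rule: singular_fifteen_nodal_cases)
    case vertex
    show ?thesis by (rule mem[of 0 0 0 1 "x $ 4"]) (use vertex in \<open>simp_all add: node_table_def\<close>)
  next
    case plane1
    from plane1(4)[unfolded power2_eq_iff] show ?thesis
    proof
      assume "x $ 3 = x $ 2"
      then show ?thesis by (intro mem[of 0 1 1 0 "x $ 2"]) (use plane1(1-3) in \<open>simp_all add: node_table_def\<close>)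
    next
      assume "x $ 3 = - x $ 2"
      then show ?thesis by (intro mem[of 0 1 "-1" 0 "x $ 2"]) (use plane1(1-3) in \<open>simp_all add: node_table_def\<close>)
    qed
  next
    case plane2
    from plane2(4)[unfolded power2_eq_iff] show ?thesis
    proof
      assume "x $ 3 = x $ 1"
      then show ?thesis by (intro mem[of 1 0 1 0 "x $ 1"]) (use plane2(1-3) in \<open>simp_all add: node_table_def\<close>)
    next
      assume "x $ 3 = - x $ 1"
      then show ?thesis by (intro mem[of 1 0 "-1" 0 "x $ 1"]) (use plane2(1-3) in \<open>simp_all add: node_table_def\<close>)
    qed
  next
    case plane3
    from plane3(4)[unfolded power2_eq_iff] show ?thesis
    proof
      assume "x $ 2 = x $ 1"
      then show ?thesis by (intro mem[of 1 1 0 0 "x $ 1"]) (use plane3(1-3) in \<open>simp_all add: node_table_def\<close>)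
    next
      assume "x $ 2 = - x $ 1"
      then show ?thesis by (intro mem[of 1 "-1" 0 0 "x $ 1"]) (use plane3(1-3) in \<open>simp_all add: node_table_def\<close>)
    qed
  next
    case cube
    have sign: "\<exists>a\<in>{1, -1 :: int}. y = x $ 4 * of_int a" if "y\<^sup>2 = (x $ 4)\<^sup>2" for y
      using that[unfolded power2_eq_iff] by simp
    obtain a b where ab: "a \<in> {1, -1 :: int}" "x $ 1 = x $ 4 * of_int a" "b \<in> {1, -1 :: int}" "x $ 2 = x $ 4 * of_int b"
      using sign[OF cube(2)] sign[OF cube(3)] by blast
    have "(x $ 3 / 2)\<^sup>2 = (x $ 4)\<^sup>2" unfolding power_divide cube(4) by simp
    then obtain c where c: "c \<in> {1, -1 :: int}" "x $ 3 / 2 = x $ 4 * of_int c" using sign by blast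
    have "x $ 3 = 2 * (x $ 3 / 2)" by simp
    also have "\<dots> = x $ 4 * of_int (2 * c)" unfolding c(2) by simp
    finally have c2: "x $ 3 = x $ 4 * of_int (2 * c)" .
    have "(a, b, 2 * c, 1) \<in> node_table" using ab(1,3) c(1) unfolding node_table_def by (elim insertE emptyE) simp_all
    then show ?thesis by (rule mem[OF _ cube(1) ab(2,4) c2]) simp
  qed
qed

lemma fifteen_nodal: "fifteen_nodal \<in> nodal15"
  unfolding nodal15_def mem_Collect_eq singular_points_fifteen_nodal
  using fifteen_nodal_in_forms fifteen_nodal_node card_node_table
  by (simp add: card_image inj_int_point_span)

section \<open>Generic quartic surfaces with fifteen nodes\<close>

theorem theorem24:
  shows "generically moduli15 (\<lambda>C. \<forall>F\<in>C. is_hyperplane_section igusa_quartic F)"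
  unfolding generically_def
proof (intro exI[of _ "topspace moduli15"] conjI ballI)
  show "openin moduli15 (topspace moduli15)" by simp
  show "topspace moduli15 \<noteq> {}"
  proof
    assume e: "topspace moduli15 = {}"
    have "proj_equiv `` {fifteen_nodal} \<in> topspace moduli15"
      unfolding topspace_moduli15 by (rule quotientI[OF fifteen_nodal])
    then show False by (simp only: e empty_iff)
  qed
  show "moduli15 closure_of topspace moduli15 = topspace moduli15" by (rule closure_of_topspace)
  fix C F assume C: "C \<in> topspace moduli15" and F: "F \<in> C"
  from C have "C \<in> nodal15 // proj_equiv" by (simp only: topspace_moduli15)
  then have "F \<in> nodal15"
  proof (rule quotientE)
    fix G assume "C = proj_equiv `` {G}"
    then have "(G, F) \<in> proj_equiv" using F by (simp only: Image_singleton_iff)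
    then show "F \<in> nodal15" by (simp only: proj_equiv_def mem_Collect_eq case_prod_conv)
  qed
  then show "is_hyperplane_section igusa_quartic F" by (rule nodal15_is_hyperplane_section)
qed

end
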